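(* Let $d\ge 3$ be an integer. The arrangement $\mathcal{H}_d$ of $d^2+3$ lines in $\mathbb{P}^2$ is a free arrangement if and only if $3\le d\le 4$. Moreover, $\mathcal{H}_3$ is an arrangement of $12$ lines, free with exponents $(4,7)$, and $\mathcal{H}_4$ is an arrangement of $19$ lines, free with exponents $(9,9)$.
   Context: $K$ is an algebraically closed field of characteristic zero and $e\in K$ is a primitive $d$-th root of $1$. For $0\le i,j\le d-1$ put $L_{i,j}=x+e^iy+e^jz$. $\mathcal{H}_d$ is the arrangement of the $d^2+3$ lines in $\mathbb{P}^2$ defined by the linear forms $\{x,y,z\}\cup\{L_{i,j}\}_{0\le i,j\le d-1}$. Let $F=xyz\prod_{0\le i,j\le d-1}L_{i,j}$ and let the derivation bundle $\mathcal{D}_0$ be the kernel of the jacobian map $\nabla F=(\partial F/\partial x,\partial F/\partial y,\partial F/\partial z):\mathcal{O}_{\mathbb{P}^2}^3\to\mathcal{O}_{\mathbb{P}^2}(d^2+2)$. The arrangement is free with exponents $(a,b)$ if $\mathcal{D}_0\cong\mathcal{O}_{\mathbb{P}^2}(-a)\oplus\mathcal{O}_{\mathbb{P}^2}(-b)$; it is free if this holds for some $(a,b)$. *)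

theory Defs
  imports "HOL-Analysis.Analysis"
begin

text \<open>The ring \<open>K[x,y,z]\<close> is the iterated polynomial ring \<open>K[x][y][z]\<close>, with \<open>z\<close> as the
  outermost variable. A vector \<open>v :: 'a ^ 3\<close> has the coordinates \<open>v $ 1, v $ 2, v $ 3\<close>.\<close>

type_synonym 'a poly3 = "'a poly poly poly"

definition Const3 :: "'a::comm_ring_1 \<Rightarrow> 'a poly3" where
  "Const3 c = [:[:[:c:]:]:]"

definition X3 :: "'a::comm_ring_1 poly3" where "X3 = [:[:[:0, 1:]:]:]"
definition Y3 :: "'a::comm_ring_1 poly3" where "Y3 = [:[:0, 1:]:]"
definition Z3 :: "'a::comm_ring_1 poly3" where "Z3 = [:0, 1:]"

definition eval3 :: "'a::comm_ring_1 poly3 \<Rightarrow> 'a ^ 3 \<Rightarrow> 'a" where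
  "eval3 p v = poly (poly (poly p [:[:v $ 3:]:]) [:v $ 2:]) (v $ 1)"

definition partial3 :: "3 \<Rightarrow> 'a::idom poly3 \<Rightarrow> 'a poly3" where
  "partial3 i = (if i = 1 then map_poly (map_poly pderiv)
                 else if i = 2 then map_poly pderiv
                 else pderiv)"

text \<open>The zero polynomial is homogeneous of every degree.\<close>

definition homogeneous3 :: "nat \<Rightarrow> 'a::comm_ring_1 poly3 \<Rightarrow> bool" where
  "homogeneous3 n p \<longleftrightarrow>
     (\<forall>i j k. coeff (coeff (coeff p k) j) i \<noteq> 0 \<longrightarrow> i + j + k = n)"

text \<open>Subsets of \<open>\<bbbP>\<^sup>2\<close> are represented by their preimages under the projection
  \<open>K\<^sup>3 - {0} \<rightarrow> \<bbbP>\<^sup>2\<close>; this is a bijection between subsets of \<open>\<bbbP>\<^sup>2\<close> and subsets of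
  \<open>K\<^sup>3 - {0}\<close> closed under scaling by units.\<close>

definition zariski_open :: "('a::comm_ring_1 ^ 3) set \<Rightarrow> bool" where
  "zariski_open U \<longleftrightarrow>
     (\<exists>S. (\<forall>G\<in>S. \<exists>n. homogeneous3 n G) \<and> U = {v. v \<noteq> 0 \<and> (\<exists>G\<in>S. eval3 G v \<noteq> 0)})"

text \<open>Sections over \<open>U\<close> are functions on the cone over \<open>U\<close>, extended by \<open>0\<close> so that equality of
  functions is equality of sections. A section of \<open>\<O>(k)\<close> is locally a quotient of homogeneous
  polynomials whose degrees differ by \<open>k\<close>.\<close>

definition O_sections :: "int \<Rightarrow> ('a::field ^ 3) set \<Rightarrow> ('a ^ 3 \<Rightarrow> 'a) set" where
  "O_sections k U = {f. (\<forall>v. v \<notin> U \<longrightarrow> f v = 0) \<and>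
     (\<forall>v\<in>U. \<exists>W p q m n. zariski_open W \<and> v \<in> W \<and> W \<subseteq> U \<and>
        homogeneous3 m p \<and> homogeneous3 n q \<and> int m = int n + k \<and>
        (\<forall>w\<in>W. eval3 q w \<noteq> 0 \<and> f w = eval3 p w / eval3 q w))}"

definition O_sum_sections :: "int \<Rightarrow> int \<Rightarrow> ('a::field ^ 3) set \<Rightarrow> ('a ^ 3 \<Rightarrow> 'a ^ 2) set" where
  "O_sum_sections k l U =
     {s. (\<lambda>v. s v $ 1) \<in> O_sections k U \<and> (\<lambda>v. s v $ 2) \<in> O_sections l U}"

text \<open>The kernel of \<open>\<nabla>F : \<O>\<^sup>3 \<rightarrow> \<O>(deg F - 1)\<close>; kernels of sheaf morphisms are computed on
  sections.\<close>

definition jacobian_map :: "'a::field poly3 \<Rightarrow> ('a ^ 3 \<Rightarrow> 'a ^ 3) \<Rightarrow> ('a ^ 3 \<Rightarrow> 'a)" where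
  "jacobian_map F s = (\<lambda>v. \<Sum>i\<in>UNIV. eval3 (partial3 i F) v * s v $ i)"

definition derivation_sections ::
    "'a::field poly3 \<Rightarrow> ('a ^ 3) set \<Rightarrow> ('a ^ 3 \<Rightarrow> 'a ^ 3) set" where
  "derivation_sections F U =
     {s. (\<forall>i. (\<lambda>v. s v $ i) \<in> O_sections 0 U) \<and> jacobian_map F s = (\<lambda>_. 0)}"

definition restrict_section :: "'b set \<Rightarrow> ('b \<Rightarrow> 'c::zero) \<Rightarrow> 'b \<Rightarrow> 'c" where
  "restrict_section V s = (\<lambda>v. if v \<in> V then s v else 0)"

text \<open>Isomorphism of sheaves of \<open>\<O>\<close>-modules, for sheaves \<open>M\<close>, \<open>N\<close> given by their sets of
  sections, with pointwise module operations and the restriction maps above.\<close>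

definition O_module_isomorphic ::
    "(('a::field ^ 3) set \<Rightarrow> ('a ^ 3 \<Rightarrow> 'a ^ 'm) set) \<Rightarrow>
     (('a ^ 3) set \<Rightarrow> ('a ^ 3 \<Rightarrow> 'a ^ 'n) set) \<Rightarrow> bool" where
  "O_module_isomorphic M N \<longleftrightarrow>
     (\<exists>\<phi>. (\<forall>U. zariski_open U \<longrightarrow>
              bij_betw (\<phi> U) (M U) (N U) \<and>
              (\<forall>s\<in>M U. \<forall>t\<in>M U. \<phi> U (\<lambda>v. s v + t v) = (\<lambda>v. \<phi> U s v + \<phi> U t v)) \<and>
              (\<forall>f\<in>O_sections 0 U. \<forall>s\<in>M U. \<phi> U (\<lambda>v. f v *s s v) = (\<lambda>v. f v *s \<phi> U s v))) \<and>
          (\<forall>U V. zariski_open U \<and> zariski_open V \<and> V \<subseteq> U \<longrightarrow>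
              (\<forall>s\<in>M U. \<phi> V (restrict_section V s) = restrict_section V (\<phi> U s))))"

definition free_with_exponents :: "'a::field poly3 \<Rightarrow> int \<Rightarrow> int \<Rightarrow> bool" where
  "free_with_exponents F a b \<longleftrightarrow>
     O_module_isomorphic (derivation_sections F) (O_sum_sections (- a) (- b))"

definition free_arrangement :: "'a::field poly3 \<Rightarrow> bool" where
  "free_arrangement F \<longleftrightarrow> (\<exists>a b. free_with_exponents F a b)"

definition primitive_root_of_one :: "nat \<Rightarrow> 'a::field \<Rightarrow> bool" where
  "primitive_root_of_one d e \<longleftrightarrow> d > 0 \<and> e ^ d = 1 \<and> (\<forall>k. 0 < k \<and> k < d \<longrightarrow> e ^ k \<noteq> 1)"

definition L_form :: "'a::field \<Rightarrow> nat \<Rightarrow> nat \<Rightarrow> 'a poly3" where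
  "L_form e i j = X3 + Const3 (e ^ i) * Y3 + Const3 (e ^ j) * Z3"

definition line_of_form :: "'a::field poly3 \<Rightarrow> ('a ^ 3) set" where
  "line_of_form l = {v. v \<noteq> 0 \<and> eval3 l v = 0}"

definition H_arrangement :: "nat \<Rightarrow> 'a::field \<Rightarrow> ('a ^ 3) set set" where
  "H_arrangement d e =
     line_of_form ` ({X3, Y3, Z3} \<union> {L_form e i j | i j. i < d \<and> j < d})"

definition H_polynomial :: "nat \<Rightarrow> 'a::field \<Rightarrow> 'a poly3" where
  "H_polynomial d e = X3 * Y3 * Z3 * (\<Prod>i<d. \<Prod>j<d. L_form e i j)"

end

(* For a free arrangement D_0 has generators T1, T2 with T1 x T2 = c grad F, and Saito's criterion is
   the converse. For d = 3, 4 the generators come from logarithmic vector fields on the image of the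
   line x + y + z = 0 under (x, y, z) |-> (x^d, y^d, z^d), so that their coefficients are x, y, z
   times forms in x^d, y^d, z^d.

   Freeness with exponents (k, l) forces k + l <= d^2 + 2. For d >= 5 let T be the generator of the
   smaller degree k <= (d^2 + 2) / 2. At a point v on two lines T is proportional to v, and each line
   L_ij carries (d - 1)(d - 2) + 3 > k + 1 such points, since no three lines L_ij meet outside xyz = 0.
   Hence T x v, which has degree k + 1, vanishes on all d^2 > k + 1 lines L_ij, so that it is zero,
   and Euler's formula gives T = 0. *)

theory Submission
  imports Defs "HOL-Computational_Algebra.Fundamental_Theorem_Algebra"
begin

text \<open>A section is only a function that is locally a quotient of forms, so the generators are
  studied through their values. On a line, a section of O(k) with more than k zeros, the point at
  infinity included, vanishes. The bound k + l <= d^2 + 2 comes from the same count: on a line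
  missing all singular points the multiplier that takes T1 x T2 to grad F vanishes nowhere, so its
  degree is not negative.

  Three lines L_ij meeting outside xyz = 0 would give an equation (r - 1)(s' - 1) = (r' - 1)(s - 1)
  between d-th roots of 1. Such an equation survives inverting all the roots: \<open>e\<close> is
  replaced by a complex root of its minimal polynomial over the rationals, where inversion is
  conjugation. The two equations together force two of the three lines to coincide.

  The counts suffice when 2 ((d - 1)(d - 2) + 3) > d^2 + 4, that is d^2 - 6 d + 6 > 0. This holds
  from d = 5 on and fails for d = 3 and d = 4.\<close>

section \<open>Dot and cross products, over K and over the polynomial ring\<close>

definition dot3 :: "'a::comm_ring_1 ^ 3 \<Rightarrow> 'a ^ 3 \<Rightarrow> 'a" where
  "dot3 a b = a $ 1 * b $ 1 + a $ 2 * b $ 2 + a $ 3 * b $ 3"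

definition vprod :: "'a::comm_ring_1 ^ 3 \<Rightarrow> 'a ^ 3 \<Rightarrow> 'a ^ 3" where
  "vprod a b = vector [a $ 2 * b $ 3 - a $ 3 * b $ 2, a $ 3 * b $ 1 - a $ 1 * b $ 3,
     a $ 1 * b $ 2 - a $ 2 * b $ 1]"

lemma vprod_nth [simp]:
  "vprod a b $ 1 = a $ 2 * b $ 3 - a $ 3 * b $ 2"
  "vprod a b $ 2 = a $ 3 * b $ 1 - a $ 1 * b $ 3"
  "vprod a b $ 3 = a $ 1 * b $ 2 - a $ 2 * b $ 1"
  by (simp_all add: vprod_def)

lemma vec3_eq_iff: "a = b \<longleftrightarrow> a $ 1 = b $ 1 \<and> a $ 2 = b $ 2 \<and> a $ (3::3) = b $ 3"
  by (simp add: vec_eq_iff forall_3)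

lemma vprod_self [simp]: "vprod a a = 0"
  by (simp add: vec3_eq_iff mult.commute)

lemma vprod_smult: "vprod (c *s a) (d *s b) = (c * d) *s vprod a b"
  by (simp add: vec3_eq_iff algebra_simps)

lemma dot3_linear:
  "dot3 a (b + c) = dot3 a b + dot3 a c" "dot3 a (x *s b) = x * dot3 a b"
  "dot3 (b + c) a = dot3 b a + dot3 c a" "dot3 (x *s b) a = x * dot3 b a"
  by (simp_all add: dot3_def algebra_simps)

lemma dot3_zero [simp]: "dot3 a 0 = 0" "dot3 0 a = 0"
  by (simp_all add: dot3_def)

lemma vprod_vprod: "vprod a (vprod b c) = dot3 a c *s b - dot3 a b *s c"
  by (simp add: vec3_eq_iff dot3_def algebra_simps)

lemma vprod_orthogonal:
  assumes "dot3 g a = 0" "dot3 g b = 0"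
  shows "vprod g (vprod a b) = 0"
  by (simp add: vprod_vprod assms)

lemma parallel_imp_scalar:
  fixes v w :: "'a::field ^ 3"
  assumes "vprod v w = 0" "v \<noteq> 0"
  obtains c where "w = c *s v"
proof -
  obtain i where i: "v $ i \<noteq> 0" using assms(2) by (auto simp: vec_eq_iff)
  have "w = (w $ i / v $ i) *s v"
    using assms(1) i exhaust_3[of i] unfolding vec3_eq_iff
    by (elim disjE) (simp_all add: field_simps)
  with that show ?thesis by blast
qed

text \<open>The vectors orthogonal to two independent ones are the multiples of their cross product.
  At a point on two lines this is applied to a generator and to the point itself.\<close>

lemma orthogonal_imp_parallel:
  fixes a b v w :: "'a::field ^ 3"
  assumes "vprod a b \<noteq> 0" "dot3 a v = 0" "dot3 b v = 0" "dot3 a w = 0" "dot3 b w = 0"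
  shows "vprod v w = 0"
proof -
  have "vprod (vprod a b) u = 0" if "dot3 a u = 0" "dot3 b u = 0" for u
  proof -
    have "vprod (vprod a b) u = dot3 a u *s b - dot3 b u *s a"
      by (simp add: vec3_eq_iff dot3_def algebra_simps)
    thus ?thesis using that by simp
  qed
  with assms obtain c c' where "v = c *s vprod a b" "w = c' *s vprod a b"
    by (metis parallel_imp_scalar)
  thus ?thesis by (simp add: vprod_smult)
qed

text \<open>Over a domain one cannot divide by a coordinate, so every coordinate of \<open>r\<close>
  is shown to be killed by every coordinate of \<open>vprod a b\<close>. The intended vectors have
  polynomial entries.\<close>

lemma parallel_both_imp_zero:
  fixes r a b :: "'a::idom ^ 3"
  assumes "vprod r a = 0" "vprod r b = 0" "vprod a b \<noteq> 0"
  shows "r = 0"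
proof -
  have e: "r $ 2 * a $ 3 = r $ 3 * a $ 2" "r $ 3 * a $ 1 = r $ 1 * a $ 3"
    "r $ 1 * a $ 2 = r $ 2 * a $ 1" "r $ 2 * b $ 3 = r $ 3 * b $ 2"
    "r $ 3 * b $ 1 = r $ 1 * b $ 3" "r $ 1 * b $ 2 = r $ 2 * b $ 1"
    using assms(1,2) by (simp_all add: vec3_eq_iff)
  have "\<forall>i j. vprod a b $ j * r $ i = 0"
    unfolding forall_3 vprod_nth by (intro conjI; insert e; algebra)
  moreover obtain j where "vprod a b $ j \<noteq> 0" using assms(3) by (auto simp: vec_eq_iff)
  ultimately show ?thesis by (auto simp: vec_eq_iff)
qed

subsection \<open>Polynomials in three variables\<close>

lemma eval3_simps [simp]:
  "eval3 0 v = 0" "eval3 1 v = 1" "eval3 (p + q) v = eval3 p v + eval3 q v"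
  "eval3 (p * q) v = eval3 p v * eval3 q v" "eval3 (Const3 c) v = c"
  "eval3 X3 v = v $ 1" "eval3 Y3 v = v $ 2" "eval3 Z3 v = v $ 3"
  by (simp_all add: eval3_def Const3_def X3_def Y3_def Z3_def)

lemma eval3_diff [simp]: "eval3 (p - q) v = eval3 p v - eval3 q v"
  by (simp add: eval3_def)

lemma eval3_power [simp]: "eval3 (p ^ n) v = eval3 p v ^ n"
  by (induction n) simp_all

lemma eval3_prod [simp]: "eval3 (prod f A) v = (\<Prod>x\<in>A. eval3 (f x) v)"
  by (induction A rule: infinite_finite_induct) simp_all

text \<open>The variables are removed one at a time: constants form an infinite subset of each
  coefficient ring, and a nonzero polynomial over a domain has finitely many roots.\<close>

lemma poly3_eq_0I:
  fixes p :: "'a::field_char_0 poly3"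
  assumes "\<And>v. eval3 p v = 0"
  shows "p = 0"
proof -
  have 1: "poly (poly p [:[:c:]:]) [:b:] = 0" for b c
  proof -
    have "poly (poly (poly p [:[:c:]:]) [:b:]) a = 0" for a
      using assms[of "vector [a, b, c]"] by (simp add: eval3_def)
    thus ?thesis using poly_all_0_iff_0 by blast
  qed
  have inf: "infinite (range (\<lambda>b::'b::{zero,ring_char_0}. [:b:]))"
    by (subst finite_image_iff) (auto simp: inj_on_def infinite_UNIV_char_0)
  have inf': "infinite (range (\<lambda>b::'a. [:[:b:]:]))"
    by (subst finite_image_iff) (auto simp: inj_on_def infinite_UNIV_char_0)
  have 2: "poly p [:[:c:]:] = 0" for c
  proof (rule ccontr)
    assume "poly p [:[:c:]:] \<noteq> 0"
    from poly_roots_finite[OF this] have "finite (range (\<lambda>b::'a. [:b:]))"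
      by (rule finite_subset[rotated]) (use 1 in auto)
    with inf show False by blast
  qed
  show ?thesis
  proof (rule ccontr)
    assume "p \<noteq> 0"
    from poly_roots_finite[OF this] have "finite (range (\<lambda>b::'a. [:[:b:]:]))"
      by (rule finite_subset[rotated]) (use 2 in auto)
    with inf' show False by blast
  qed
qed

text \<open>\<open>partial3\<close> lifts \<open>pderiv\<close> through zero, one or two levels of
  coefficients, so two applications of this lemma give its additivity and its Leibniz rule.\<close>

lemma map_poly_derivation:
  fixes D :: "'b::comm_ring_1 \<Rightarrow> 'b"
  assumes add: "\<And>p q. D (p + q) = D p + D q"
    and mult: "\<And>p q. D (p * q) = D p * q + p * D q"
  shows "map_poly D (p + q) = map_poly D p + map_poly D q"
    and "map_poly D (p * q) = map_poly D p * q + p * map_poly D q"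
proof -
  have D0: "D 0 = 0" using add[of 0 0] by simp
  have Dsum: "D (sum f A) = (\<Sum>x\<in>A. D (f x))" for f and A :: "nat set"
    by (induction A rule: infinite_finite_induct) (simp_all add: D0 add)
  show "map_poly D (p + q) = map_poly D p + map_poly D q"
    by (rule poly_eqI) (simp add: coeff_map_poly D0 add)
  show "map_poly D (p * q) = map_poly D p * q + p * map_poly D q"
    by (rule poly_eqI) (simp add: coeff_map_poly D0 coeff_mult Dsum mult sum.distrib)
qed

lemma partial3_add [simp]: "partial3 i (p + q) = partial3 i p + partial3 i q"
  and partial3_mult [simp]: "partial3 i (p * q) = partial3 i p * q + p * partial3 i q"
  for p q :: "'a::idom poly3"
proof -
  note d1 = map_poly_derivation[of pderiv, OF pderiv_add]
  have m: "pderiv (p * q) = pderiv p * q + p * pderiv q" for p q :: "'b::idom poly"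
    by (simp add: pderiv_mult mult.commute)
  note d1 = map_poly_derivation[of pderiv, OF pderiv_add m]
  note d2 = map_poly_derivation[of "map_poly pderiv", OF d1]
  show "partial3 i (p + q) = partial3 i p + partial3 i q"
    by (simp add: partial3_def d1 d2 pderiv_add)
  show "partial3 i (p * q) = partial3 i p * q + p * partial3 i q"
    by (simp add: partial3_def d1 d2 m)
qed

lemma partial3_0 [simp]: "partial3 i 0 = 0"
  by (simp add: partial3_def)

lemma partial3_1 [simp]: "partial3 i (1 :: 'a::idom poly3) = 0"
  by (simp add: partial3_def one_pCons map_poly_pCons pderiv_pCons)

lemma partial3_minus [simp]: "partial3 i (- p) = - partial3 i (p :: 'a::idom poly3)"
  using partial3_add[of i p "- p"] by (simp del: partial3_add add: eq_neg_iff_add_eq_0 add.commute)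

lemma partial3_diff [simp]: "partial3 i (p - q) = partial3 i p - partial3 i (q :: 'a::idom poly3)"
  using partial3_add[of i p "- q"] by (simp del: partial3_add)

lemma partial3_of_nat [simp]: "partial3 i (of_nat n :: 'a::idom poly3) = 0"
  by (induction n) simp_all

lemma partial3_numeral [simp]: "partial3 i (numeral n :: 'a::idom poly3) = 0"
  by (metis of_nat_numeral partial3_of_nat)

lemma partial3_power [simp]:
  "partial3 i (p ^ n) = of_nat n * p ^ (n - 1) * partial3 i (p :: 'a::idom poly3)"
proof (induction n)
  case (Suc n)
  have "partial3 i (p ^ Suc n) =
      partial3 i p * p ^ n + p * (of_nat n * p ^ (n - 1) * partial3 i p)"
    by (simp only: power_Suc partial3_mult Suc.IH)
  also have "\<dots> = of_nat (Suc n) * p ^ (Suc n - 1) * partial3 i p"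
    by (cases n) (simp_all add: algebra_simps)
  finally show ?case .
qed simp

lemma partial3_Const3 [simp]: "partial3 i (Const3 c) = 0"
  by (simp add: partial3_def Const3_def map_poly_pCons pderiv_pCons)

lemma partial3_vars [simp]:
  "partial3 1 X3 = 1" "partial3 2 X3 = 0" "partial3 3 X3 = 0"
  "partial3 1 Y3 = 0" "partial3 2 Y3 = 1" "partial3 3 Y3 = 0"
  "partial3 1 Z3 = 0" "partial3 2 Z3 = 0" "partial3 3 Z3 = 1"
  by (simp_all add: partial3_def X3_def Y3_def Z3_def map_poly_pCons pderiv_pCons one_pCons)

lemma Const3_simps [simp]:
  "Const3 0 = 0" "Const3 1 = 1" "Const3 (a + b) = Const3 a + Const3 b"
  "Const3 (a * b) = Const3 a * Const3 b"
  by (simp_all add: Const3_def flip: one_pCons)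

lemma Const3_uminus [simp]: "Const3 (- a) = - Const3 a"
  by (simp add: Const3_def)

lemma Const3_power [simp]: "Const3 (a ^ n) = Const3 a ^ n"
  by (induction n) simp_all

lemma Const3_eq_0_iff [simp]: "Const3 a = 0 \<longleftrightarrow> a = 0"
  by (simp add: Const3_def)

lemma Const3_of_nat: "Const3 (of_nat n) = of_nat n"
  by (induction n) simp_all

subsection \<open>Homogeneity and the Euler operator\<close>

text \<open>This operator turns homogeneity into a linear equation, so that closure under products
  and the homogeneity of explicit vector fields become ring identities.\<close>

definition euler3 :: "'a::idom poly3 \<Rightarrow> 'a poly3" where
  "euler3 p = X3 * partial3 1 p + Y3 * partial3 2 p + Z3 * partial3 3 p"

lemma euler3_add: "euler3 (p + q) = euler3 p + euler3 q"
  and euler3_diff: "euler3 (p - q) = euler3 p - euler3 q"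
  and euler3_mult: "euler3 (p * q) = euler3 p * q + p * euler3 q"
  by (simp_all add: euler3_def algebra_simps)

abbreviation coeff3 :: "'a::zero poly3 \<Rightarrow> nat \<Rightarrow> nat \<Rightarrow> nat \<Rightarrow> 'a" where
  "coeff3 p i j k \<equiv> coeff (coeff (coeff p k) j) i"

lemma coeff3_euler3: "coeff3 (euler3 p) i j k = of_nat (i + j + k) * coeff3 p i j k"
  by (simp add: euler3_def X3_def Y3_def Z3_def partial3_def coeff_map_poly coeff_pderiv
      coeff_pCons map_poly_pCons algebra_simps of_nat_poly split: nat.split)

text \<open>The operator multiplies each monomial by its total degree, and in characteristic zero
  different degrees remain different in the field.\<close>

lemma homogeneous3_iff_euler:
  fixes p :: "'a::field_char_0 poly3"
  shows "homogeneous3 n p \<longleftrightarrow> euler3 p = of_nat n * p"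
proof -
  have c: "coeff3 (of_nat n * p) i j k = of_nat n * coeff3 p i j k" for i j k
    by (simp add: of_nat_poly)
  have "euler3 p = of_nat n * p \<longleftrightarrow>
      (\<forall>i j k. (of_nat (i + j + k) - of_nat n) * coeff3 p i j k = 0)"
    by (simp only: poly_eq_iff coeff3_euler3 c left_diff_distrib right_minus_eq) blast
  also have "\<dots> \<longleftrightarrow> homogeneous3 n p"
    unfolding homogeneous3_def
    by (metis (no_types, lifting) eq_iff_diff_eq_0 mult_eq_0_iff of_nat_eq_iff)
  finally show ?thesis ..
qed

lemma homogeneous3_0 [simp]: "homogeneous3 n 0"
  by (simp add: homogeneous3_def)

lemma homogeneous3_add: "homogeneous3 n p \<Longrightarrow> homogeneous3 n q \<Longrightarrow> homogeneous3 n (p + q)"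
  for p :: "'a::field_char_0 poly3"
  by (simp add: homogeneous3_iff_euler euler3_add distrib_left)

lemma homogeneous3_diff: "homogeneous3 n p \<Longrightarrow> homogeneous3 n q \<Longrightarrow> homogeneous3 n (p - q)"
  for p :: "'a::field_char_0 poly3"
  by (simp add: homogeneous3_iff_euler euler3_diff right_diff_distrib)

lemma homogeneous3_mult:
  fixes p :: "'a::field_char_0 poly3"
  shows "homogeneous3 m p \<Longrightarrow> homogeneous3 n q \<Longrightarrow> homogeneous3 (m + n) (p * q)"
  by (simp add: homogeneous3_iff_euler euler3_mult algebra_simps)

lemma homogeneous3_1 [simp]: "homogeneous3 0 (1 :: 'a::field_char_0 poly3)"
  and homogeneous3_Const3 [simp]: "homogeneous3 0 (Const3 c :: 'a::field_char_0 poly3)"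
  and homogeneous3_X3 [simp]: "homogeneous3 (Suc 0) (X3 :: 'a::field_char_0 poly3)"
  and homogeneous3_Y3 [simp]: "homogeneous3 (Suc 0) (Y3 :: 'a::field_char_0 poly3)"
  and homogeneous3_Z3 [simp]: "homogeneous3 (Suc 0) (Z3 :: 'a::field_char_0 poly3)"
  by (simp_all add: homogeneous3_iff_euler euler3_def)

lemma homogeneous3_power:
  "homogeneous3 m p \<Longrightarrow> homogeneous3 (n * m) (p ^ n)" for p :: "'a::field_char_0 poly3"
  by (induction n) (auto intro: homogeneous3_mult)

lemma homogeneous3_prod:
  fixes f :: "'b \<Rightarrow> 'a::field_char_0 poly3"
  assumes "finite A" "\<And>x. x \<in> A \<Longrightarrow> homogeneous3 1 (f x)"
  shows "homogeneous3 (card A) (prod f A)"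
  using assms
proof (induction A rule: finite_induct)
  case (insert x A)
  thus ?case using homogeneous3_mult[of 1 "f x" "card A" "prod f A"] by simp
qed simp

lemma homogeneous3_partial3:
  fixes p :: "'a::field_char_0 poly3"
  assumes "homogeneous3 n p"
  shows "homogeneous3 (n - 1) (partial3 i p)"
  using assms unfolding homogeneous3_def partial3_def
  by (auto simp: coeff_map_poly coeff_pderiv of_nat_poly simp flip: of_nat_Suc split: if_splits; force)

text \<open>Since \<open>euler3\<close> is a derivation, \<open>q\<close> can be cancelled from its
  value on the product, which leaves an Euler equation for \<open>p\<close>. A nonzero coefficient
  of \<open>p\<close> is what forces \<open>m \<le> n\<close>; hence the disjunction.\<close>

lemma homogeneous3_factor:
  fixes p :: "'a::field_char_0 poly3"
  assumes "homogeneous3 n (p * q)" "homogeneous3 m q" "q \<noteq> 0"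
  shows "p = 0 \<or> m \<le> n \<and> homogeneous3 (n - m) p"
proof -
  have "(euler3 p + of_nat m * p) * q = of_nat n * p * q"
    using assms by (simp add: homogeneous3_iff_euler euler3_mult algebra_simps)
  hence e: "euler3 p + of_nat m * p = of_nat n * p" using assms(3) by simp
  have c: "coeff3 (of_nat l * p) i j k = of_nat l * coeff3 p i j k" for i j k l
    by (simp add: of_nat_poly)
  have deg: "i + j + k + m = n" if "coeff3 p i j k \<noteq> 0" for i j k
  proof -
    have "coeff3 (euler3 p + of_nat m * p) i j k = coeff3 (of_nat n * p) i j k"
      by (simp only: e)
    hence "of_nat (i + j + k + m) * coeff3 p i j k = of_nat n * coeff3 p i j k"
      by (simp add: coeff3_euler3 c distrib_right)
    thus ?thesis using that by (simp only: mult_cancel_right of_nat_eq_iff) simp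
  qed
  show ?thesis
  proof (cases "p = 0")
    case False
    then obtain i j k where "coeff3 p i j k \<noteq> 0" by (auto simp: poly_eq_iff)
    from deg[OF this] have "m \<le> n" by simp
    moreover have "homogeneous3 (n - m) p" unfolding homogeneous3_def using deg by force
    ultimately show ?thesis by simp
  qed simp
qed

section \<open>Gradients, and forms restricted to a line\<close>

definition grad3 :: "'a::idom poly3 \<Rightarrow> 'a poly3 ^ 3" where
  "grad3 F = (\<chi> i. partial3 i F)"

definition eval_vec :: "'a::comm_ring_1 poly3 ^ 3 \<Rightarrow> 'a ^ 3 \<Rightarrow> 'a ^ 3" where
  "eval_vec p v = (\<chi> i. eval3 (p $ i) v)"

definition coords3 :: "'a::comm_ring_1 poly3 ^ 3" where
  "coords3 = vector [X3, Y3, Z3]"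

lemma grad3_nth [simp]: "grad3 F $ i = partial3 i F"
  by (simp add: grad3_def)

lemma eval_vec_nth [simp]: "eval_vec p v $ i = eval3 (p $ i) v"
  by (simp add: eval_vec_def)

lemma coords3_nth [simp]: "coords3 $ 1 = X3" "coords3 $ 2 = Y3" "coords3 $ 3 = Z3"
  by (simp_all add: coords3_def)

lemma eval_vec_coords3 [simp]: "eval_vec coords3 v = v"
  by (simp add: vec3_eq_iff)

lemma eval3_dot3 [simp]: "eval3 (dot3 p q) v = dot3 (eval_vec p v) (eval_vec q v)"
  by (simp add: dot3_def)

lemma eval_vec_vprod [simp]: "eval_vec (vprod p q) v = vprod (eval_vec p v) (eval_vec q v)"
  by (simp add: vec3_eq_iff)

lemma jacobian_map_eq: "jacobian_map F s v = dot3 (eval_vec (grad3 F) v) (s v)"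
  by (simp add: jacobian_map_def dot3_def sum_3)

lemma euler3_dot3: "euler3 F = dot3 coords3 (grad3 F)"
  by (simp add: euler3_def dot3_def)

lemma eval3_altdef:
  "eval3 p v = (\<Sum>k\<le>degree p. \<Sum>j\<le>degree (coeff p k). \<Sum>i\<le>degree (coeff (coeff p k) j).
     coeff3 p i j k * (v $ 1 ^ i * v $ 2 ^ j * v $ 3 ^ k))"
proof -
  have "eval3 p v = (\<Sum>k\<le>degree p. poly (poly (coeff p k) [:v $ 2:]) (v $ 1) * v $ 3 ^ k)"
    by (simp add: eval3_def poly_altdef[of p] poly_sum)
  also have "\<dots> = (\<Sum>k\<le>degree p. (\<Sum>j\<le>degree (coeff p k).
      poly (coeff (coeff p k) j) (v $ 1) * v $ 2 ^ j) * v $ 3 ^ k)"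
    by (simp add: poly_altdef[of "coeff p _"] poly_sum)
  finally show ?thesis
    by (simp add: poly_altdef[of "coeff (coeff p _) _"] sum_distrib_left sum_distrib_right mult_ac)
qed

lemma homogeneous3_eval_scale:
  assumes "homogeneous3 n p"
  shows "eval3 p (c *s v) = c ^ n * eval3 p v"
proof -
  have "coeff3 p i j k * ((c * v $ 1) ^ i * (c * v $ 2) ^ j * (c * v $ 3) ^ k) =
      c ^ n * (coeff3 p i j k * (v $ 1 ^ i * v $ 2 ^ j * v $ 3 ^ k))" for i j k
  proof (cases "coeff3 p i j k = 0")
    case False
    hence "n = i + j + k" using assms by (auto simp: homogeneous3_def)
    thus ?thesis by (simp add: power_mult_distrib power_add mult_ac)
  qed simp
  thus ?thesis by (simp add: eval3_altdef sum_distrib_left)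
qed

lemma coeff_mult_degree_bound:
  fixes p q :: "'a::comm_semiring_0 poly"
  assumes "degree p \<le> m" "degree q \<le> n"
  shows "coeff (p * q) (m + n) = coeff p m * coeff q n"
proof -
  have "coeff (p * q) (m + n) = (\<Sum>i\<le>m + n. coeff p i * coeff q (m + n - i))"
    by (rule coeff_mult)
  also have "\<dots> = (\<Sum>i\<in>{m}. coeff p i * coeff q (m + n - i))"
  proof (rule sum.mono_neutral_right)
    show "\<forall>i\<in>{..m + n} - {m}. coeff p i * coeff q (m + n - i) = 0"
    proof
      fix i assume "i \<in> {..m + n} - {m}"
      hence "i > m \<or> m + n - i > n" by auto
      thus "coeff p i * coeff q (m + n - i) = 0" using assms by (auto simp: coeff_eq_0)
    qed
  qed auto
  finally show ?thesis by simp
qed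

text \<open>The coefficient of t^n is the value at \<open>w\<close>, the point that the
  parametrisation misses. A degree below \<open>n\<close> therefore means a zero at
  \<open>w\<close>.\<close>

lemma homogeneous3_line_poly:
  fixes p :: "'a::field poly3"
  assumes "homogeneous3 n p"
  obtains P where "degree P \<le> n" "coeff P n = eval3 p w" "\<And>t. poly P t = eval3 p (u + t *s w)"
proof
  define l where "l i = [:u $ i, w $ i:]" for i :: 3
  define m where "m i j k = l 1 ^ i * l 2 ^ j * l 3 ^ k" for i j k
  define P where "P = (\<Sum>k\<le>degree p. \<Sum>j\<le>degree (coeff p k).
    \<Sum>i\<le>degree (coeff (coeff p k) j). smult (coeff3 p i j k) (m i j k))"
  have l: "degree (l a ^ i) \<le> i \<and> coeff (l a ^ i) i = (w $ a) ^ i" for a i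
  proof (induction i)
    case (Suc i)
    have d: "degree (l a) \<le> 1" by (simp add: l_def)
    have "degree (l a ^ Suc i) \<le> 1 + i"
      using degree_mult_le[of "l a" "l a ^ i"] d Suc by simp
    moreover have "coeff (l a ^ Suc i) (1 + i) = coeff (l a) 1 * coeff (l a ^ i) i"
      unfolding power_Suc by (rule coeff_mult_degree_bound) (use d Suc in auto)
    ultimately show ?case using Suc by (simp add: l_def)
  qed simp
  have m: "degree (m i j k) \<le> i + j + k \<and>
      coeff (m i j k) (i + j + k) = w $ 1 ^ i * w $ 2 ^ j * w $ 3 ^ k" for i j k
  proof -
    have d: "degree (l 1 ^ i * l 2 ^ j) \<le> i + j"
      by (rule order_trans[OF degree_mult_le add_mono]) (use l in auto)
    moreover have "degree (m i j k) \<le> i + j + k"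
      unfolding m_def by (rule order_trans[OF degree_mult_le add_mono]) (use l d in auto)
    ultimately show ?thesis
      using l unfolding m_def by (simp add: coeff_mult_degree_bound)
  qed
  have t: "degree (smult (coeff3 p i j k) (m i j k)) \<le> n \<and>
      coeff (smult (coeff3 p i j k) (m i j k)) n =
      coeff3 p i j k * (w $ 1 ^ i * w $ 2 ^ j * w $ 3 ^ k)" for i j k
    using assms m[of i j k] unfolding homogeneous3_def
    by (cases "coeff3 p i j k = 0") auto
  show "degree P \<le> n"
    unfolding P_def by (intro degree_sum_le finite_atMost) (use t in blast)
  show "coeff P n = eval3 p w"
    unfolding P_def eval3_altdef coeff_sum by (simp only: t)
  show "poly P t = eval3 p (u + t *s w)" for t
    unfolding P_def eval3_altdef m_def l_def by (simp add: poly_sum)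
qed

subsection \<open>Zariski open sets and regular functions\<close>

lemma zariski_open_basic:
  "homogeneous3 n G \<Longrightarrow> zariski_open {v. v \<noteq> 0 \<and> eval3 G v \<noteq> 0}"
  unfolding zariski_open_def by (rule exI[of _ "{G}"]) auto

lemma zariski_open_Int:
  fixes U V :: "('a::field_char_0 ^ 3) set"
  assumes "zariski_open U" "zariski_open V"
  shows "zariski_open (U \<inter> V)"
proof -
  from assms obtain S T where S: "\<forall>G\<in>S. \<exists>n. homogeneous3 n G" "\<forall>G\<in>T. \<exists>n. homogeneous3 n G"
    and U: "U = {v. v \<noteq> 0 \<and> (\<exists>G\<in>S. eval3 G v \<noteq> 0)}" "V = {v. v \<noteq> 0 \<and> (\<exists>G\<in>T. eval3 G v \<noteq> 0)}"
    unfolding zariski_open_def by auto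
  let ?P = "(\<lambda>(G, H). G * H) ` (S \<times> T)"
  have "\<forall>G\<in>?P. \<exists>n. homogeneous3 n G" using S by (fastforce intro: homogeneous3_mult)
  moreover have "U \<inter> V = {v. v \<noteq> 0 \<and> (\<exists>G\<in>?P. eval3 G v \<noteq> 0)}" unfolding U by force
  ultimately show ?thesis unfolding zariski_open_def by blast
qed

lemma zariski_openE:
  assumes "zariski_open U" "v \<in> U"
  obtains G n where "homogeneous3 n G" "eval3 G v \<noteq> 0" "v \<noteq> 0"
    "\<And>w. w \<noteq> 0 \<Longrightarrow> eval3 G w \<noteq> 0 \<Longrightarrow> w \<in> U"
  using assms unfolding zariski_open_def by blast

lemma zariski_open_nonzero: "zariski_open U \<Longrightarrow> v \<in> U \<Longrightarrow> v \<noteq> 0"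
  by (auto elim: zariski_openE)

lemma zariski_dense:
  fixes p :: "'a::field_char_0 poly3"
  assumes "zariski_open U" "u \<in> U" "\<And>v. v \<in> U \<Longrightarrow> eval3 p v = 0"
  shows "p = 0"
proof -
  obtain G n where G: "eval3 G u \<noteq> 0" "\<And>w. w \<noteq> 0 \<Longrightarrow> eval3 G w \<noteq> 0 \<Longrightarrow> w \<in> U"
    by (rule zariski_openE[OF assms(1,2)]) (rule that)
  \<comment> \<open>The factor \<open>X3\<close> takes care of the origin, the only point outside
    \<open>U\<close> at which \<open>G\<close> may be nonzero.\<close>
  have "X3 * G * p = 0"
  proof (rule poly3_eq_0I)
    fix v show "eval3 (X3 * G * p) v = 0"
      by (cases "v = 0"; cases "eval3 G v = 0") (use G(2) assms(3) in auto)
  qed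
  moreover have "G \<noteq> 0" using G(1) by auto
  ultimately show ?thesis by (auto simp: X3_def)
qed

text \<open>Irreducibility of the plane: a form whose nonvanishing locus lies in \<open>V\<close>
  cannot vanish on all of \<open>U\<close>, by density.\<close>

lemma zariski_open_meet:
  fixes U V :: "('a::field_char_0 ^ 3) set"
  assumes "zariski_open U" "u \<in> U" "zariski_open V" "v \<in> V"
  obtains w where "w \<in> U" "w \<in> V"
proof -
  obtain G where G: "eval3 G v \<noteq> 0" "\<And>w. w \<noteq> 0 \<Longrightarrow> eval3 G w \<noteq> 0 \<Longrightarrow> w \<in> V"
    using zariski_openE[OF assms(3,4)] by metis
  have "\<exists>w\<in>U. eval3 G w \<noteq> 0"
  proof (rule ccontr)
    assume "\<not> ?thesis"
    with zariski_dense[OF assms(1,2), of G] have "G = 0" by blast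
    with G(1) show False by simp
  qed
  with G zariski_open_nonzero[OF assms(1)] that show ?thesis by blast
qed

section \<open>Regularity of a function at a point\<close>

definition local_quotient ::
    "int \<Rightarrow> ('a::field ^ 3 \<Rightarrow> 'a) \<Rightarrow> ('a ^ 3) set \<Rightarrow> 'a poly3 \<Rightarrow> 'a poly3 \<Rightarrow> bool" where
  "local_quotient k f W p q \<longleftrightarrow> zariski_open W \<and>
     (\<exists>m n. homogeneous3 m p \<and> homogeneous3 n q \<and> int m = int n + k) \<and>
     (\<forall>w\<in>W. eval3 q w \<noteq> 0 \<and> f w = eval3 p w / eval3 q w)"

text \<open>Regularity is made a property of a single point; intersecting \<open>W\<close> with
  \<open>U\<close> recovers the condition of \<open>O_sections\<close>, see
  \<open>O_sections_iff\<close>.\<close>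

definition regular_at :: "int \<Rightarrow> ('a::field ^ 3 \<Rightarrow> 'a) \<Rightarrow> 'a ^ 3 \<Rightarrow> bool" where
  "regular_at k f v \<longleftrightarrow> (\<exists>W p q. v \<in> W \<and> local_quotient k f W p q)"

lemma local_quotientI:
  assumes "zariski_open W" "homogeneous3 m p" "homogeneous3 n q" "int m = int n + k"
    "\<And>w. w \<in> W \<Longrightarrow> eval3 q w \<noteq> 0" "\<And>w. w \<in> W \<Longrightarrow> f w = eval3 p w / eval3 q w"
  shows "local_quotient k f W p q"
  using assms unfolding local_quotient_def by blast

lemma regular_atE:
  assumes "regular_at k f v"
  obtains W p q m n where "v \<in> W" "zariski_open W" "homogeneous3 m p" "homogeneous3 n q"
    "int m = int n + k" "\<And>w. w \<in> W \<Longrightarrow> eval3 q w \<noteq> 0"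
    "\<And>w. w \<in> W \<Longrightarrow> f w = eval3 p w / eval3 q w"
  using assms unfolding regular_at_def local_quotient_def by blast

lemma regular_atI:
  assumes "v \<in> W" "zariski_open W" "homogeneous3 m p" "homogeneous3 n q" "int m = int n + k"
    "\<And>w. w \<in> W \<Longrightarrow> eval3 q w \<noteq> 0" "\<And>w. w \<in> W \<Longrightarrow> f w = eval3 p w / eval3 q w"
  shows "regular_at k f v"
  using local_quotientI[OF assms(2-7)] assms(1) unfolding regular_at_def by blast

text \<open>By density the identity holds between polynomials, not only on the common domain. It can
  therefore be restricted to any line, even one that misses \<open>W \<inter> W'\<close>.\<close>

lemma local_quotient_unique:
  fixes f :: "'a::field_char_0 ^ 3 \<Rightarrow> 'a"
  assumes "local_quotient k f W p q" "u \<in> W" "local_quotient l f W' p' q'" "v \<in> W'"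
  shows "p * q' = p' * q"
proof -
  have o: "zariski_open (W \<inter> W')" using assms by (auto simp: local_quotient_def zariski_open_Int)
  obtain w where "w \<in> W \<inter> W'"
    using assms by (auto simp: local_quotient_def elim: zariski_open_meet)
  have "eval3 (p * q' - p' * q) x = 0" if "x \<in> W \<inter> W'" for x
  proof -
    have "eval3 q x \<noteq> 0" "eval3 q' x \<noteq> 0" "eval3 p x / eval3 q x = eval3 p' x / eval3 q' x"
      using that assms(1,3) unfolding local_quotient_def by (metis IntE)+
    thus ?thesis by (simp add: frac_eq_eq)
  qed
  from zariski_dense[OF o \<open>w \<in> _\<close> this] show ?thesis by simp
qed

lemma regular_at_cong:
  fixes f :: "'a::field_char_0 ^ 3 \<Rightarrow> 'a"
  assumes "regular_at k f v" "zariski_open U" "v \<in> U" "\<And>w. w \<in> U \<Longrightarrow> g w = f w"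
  shows "regular_at k g v"
  using assms(1)
proof (rule regular_atE)
  fix W p q m n
  assume "v \<in> W" "zariski_open W" "homogeneous3 m p" "homogeneous3 n q" "int m = int n + k"
    "\<And>w. w \<in> W \<Longrightarrow> eval3 q w \<noteq> 0" "\<And>w. w \<in> W \<Longrightarrow> f w = eval3 p w / eval3 q w"
  with assms(2-) show ?thesis
    by (intro regular_atI[of v "W \<inter> U" m p n q]) (simp_all add: zariski_open_Int)
qed

lemma O_sections_iff:
  fixes f :: "'a::field_char_0 ^ 3 \<Rightarrow> 'a"
  assumes "zariski_open U"
  shows "f \<in> O_sections k U \<longleftrightarrow> (\<forall>v. v \<notin> U \<longrightarrow> f v = 0) \<and> (\<forall>v\<in>U. regular_at k f v)"
proof -
  have "regular_at k f v \<longleftrightarrow> (\<exists>W p q m n. zariski_open W \<and> v \<in> W \<and> W \<subseteq> U \<and>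
        homogeneous3 m p \<and> homogeneous3 n q \<and> int m = int n + k \<and>
        (\<forall>w\<in>W. eval3 q w \<noteq> 0 \<and> f w = eval3 p w / eval3 q w))" (is "_ \<longleftrightarrow> ?R") if "v \<in> U" for v
  proof
    assume "regular_at k f v"
    thus ?R
    proof (rule regular_atE)
      fix W p q m n
      assume "v \<in> W" "zariski_open W" "homogeneous3 m p" "homogeneous3 n q" "int m = int n + k"
        "\<And>w. w \<in> W \<Longrightarrow> eval3 q w \<noteq> 0" "\<And>w. w \<in> W \<Longrightarrow> f w = eval3 p w / eval3 q w"
      with that assms show ?R
        by (intro exI[of _ "W \<inter> U"] exI[of _ p] exI[of _ q] exI[of _ m] exI[of _ n])
          (simp add: zariski_open_Int)
    qed
  next
    assume ?R thus "regular_at k f v" unfolding regular_at_def local_quotient_def by blast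
  qed
  thus ?thesis unfolding O_sections_def by auto
qed

lemma regular_at_poly:
  assumes "homogeneous3 n p" "v \<noteq> 0"
  shows "regular_at (int n) (eval3 p) (v :: 'a::field_char_0 ^ 3)"
proof -
  have "zariski_open {v :: 'a ^ 3. v \<noteq> 0}"
    using zariski_open_basic[OF homogeneous3_1] by simp
  thus ?thesis by (intro regular_atI[of v "{v. v \<noteq> 0}" n p 0 1]) (use assms in auto)
qed

lemma regular_at_const: "v \<noteq> 0 \<Longrightarrow> regular_at 0 (\<lambda>_. c) (v :: 'a::field_char_0 ^ 3)"
proof -
  assume "v \<noteq> 0"
  moreover have "eval3 (Const3 c) = (\<lambda>_. c)" by (simp add: fun_eq_iff)
  ultimately show ?thesis using regular_at_poly[of 0 "Const3 c" v] by simp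
qed

lemma regular_at_mult:
  fixes f :: "'a::field_char_0 ^ 3 \<Rightarrow> 'a"
  assumes "regular_at k f v" "regular_at l g v"
  shows "regular_at (k + l) (\<lambda>w. f w * g w) v"
proof -
  obtain W p q m n where W: "v \<in> W" "zariski_open W" "homogeneous3 m p" "homogeneous3 n q"
    "int m = int n + k" "\<And>w. w \<in> W \<Longrightarrow> eval3 q w \<noteq> 0"
    "\<And>w. w \<in> W \<Longrightarrow> f w = eval3 p w / eval3 q w" by (rule regular_atE[OF assms(1)]) (rule that)
  obtain W' p' q' m' n' where W': "v \<in> W'" "zariski_open W'" "homogeneous3 m' p'"
    "homogeneous3 n' q'" "int m' = int n' + l" "\<And>w. w \<in> W' \<Longrightarrow> eval3 q' w \<noteq> 0"
    "\<And>w. w \<in> W' \<Longrightarrow> g w = eval3 p' w / eval3 q' w" by (rule regular_atE[OF assms(2)]) (rule that)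
  show ?thesis
    by (rule regular_atI[of v "W \<inter> W'" "m + m'" "p * p'" "n + n'" "q * q'"])
      (simp_all add: W W' homogeneous3_mult zariski_open_Int)
qed

lemma regular_at_add:
  fixes f :: "'a::field_char_0 ^ 3 \<Rightarrow> 'a"
  assumes "regular_at k f v" "regular_at k g v"
  shows "regular_at k (\<lambda>w. f w + g w) v"
proof -
  obtain W p q m n where W: "v \<in> W" "zariski_open W" "homogeneous3 m p" "homogeneous3 n q"
    "int m = int n + k" "\<And>w. w \<in> W \<Longrightarrow> eval3 q w \<noteq> 0"
    "\<And>w. w \<in> W \<Longrightarrow> f w = eval3 p w / eval3 q w" by (rule regular_atE[OF assms(1)]) (rule that)
  obtain W' p' q' m' n' where W': "v \<in> W'" "zariski_open W'" "homogeneous3 m' p'"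
    "homogeneous3 n' q'" "int m' = int n' + k" "\<And>w. w \<in> W' \<Longrightarrow> eval3 q' w \<noteq> 0"
    "\<And>w. w \<in> W' \<Longrightarrow> g w = eval3 p' w / eval3 q' w" by (rule regular_atE[OF assms(2)]) (rule that)
  have "m' + n = m + n'" using W W' by simp
  hence "homogeneous3 (m + n') (p * q' + p' * q)"
    using W W' by (metis homogeneous3_add homogeneous3_mult)
  thus ?thesis
    by (intro regular_atI[of v "W \<inter> W'" "m + n'" "p * q' + p' * q" "n + n'" "q * q'"])
      (simp_all add: W W' homogeneous3_mult zariski_open_Int add_frac_eq)
qed

lemma regular_at_inverse:
  fixes f :: "'a::field_char_0 ^ 3 \<Rightarrow> 'a"
  assumes "regular_at k f v" "f v \<noteq> 0"
  shows "regular_at (- k) (\<lambda>w. 1 / f w) v"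
proof -
  obtain W p q m n where W: "v \<in> W" "zariski_open W" "homogeneous3 m p" "homogeneous3 n q"
    "int m = int n + k" "\<And>w. w \<in> W \<Longrightarrow> eval3 q w \<noteq> 0"
    "\<And>w. w \<in> W \<Longrightarrow> f w = eval3 p w / eval3 q w" by (rule regular_atE[OF assms(1)]) (rule that)
  have "v \<noteq> 0" using W zariski_open_nonzero by blast
  show ?thesis
    by (rule regular_atI[of v "W \<inter> {w. w \<noteq> 0 \<and> eval3 p w \<noteq> 0}" n q m p])
      (use W assms(2) \<open>v \<noteq> 0\<close> in \<open>simp_all add: zariski_open_Int zariski_open_basic\<close>)
qed

lemma regular_at_cmult:
  fixes f :: "'a::field_char_0 ^ 3 \<Rightarrow> 'a"
  assumes "regular_at k f v" "v \<noteq> 0"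
  shows "regular_at k (\<lambda>w. c * f w) v"
  using regular_at_mult[OF regular_at_const[OF assms(2)] assms(1)] by simp

lemma regular_at_diff:
  fixes f :: "'a::field_char_0 ^ 3 \<Rightarrow> 'a"
  assumes "regular_at k f v" "regular_at k g v" "v \<noteq> 0"
  shows "regular_at k (\<lambda>w. f w - g w) v"
  using regular_at_add[OF assms(1) regular_at_cmult[OF assms(2,3), of "-1"]] by simp

lemma regular_at_nth:
  fixes v :: "'a::field_char_0 ^ 3"
  assumes "v \<noteq> 0"
  shows "regular_at 1 (\<lambda>w. w $ i) v"
proof -
  have e: "eval3 X3 = (\<lambda>w :: 'a ^ 3. w $ 1)" "eval3 Y3 = (\<lambda>w :: 'a ^ 3. w $ 2)"
    "eval3 Z3 = (\<lambda>w :: 'a ^ 3. w $ 3)" by (simp_all add: fun_eq_iff)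
  show ?thesis
    using regular_at_poly[OF homogeneous3_X3 assms] regular_at_poly[OF homogeneous3_Y3 assms]
      regular_at_poly[OF homogeneous3_Z3 assms] exhaust_3[of i] unfolding e by auto
qed

lemma regular_at_power:
  fixes f :: "'a::field_char_0 ^ 3 \<Rightarrow> 'a"
  assumes "regular_at k f v" "v \<noteq> 0"
  shows "regular_at (int n * k) (\<lambda>w. f w ^ n) v"
proof (induction n)
  case (Suc n)
  show ?case using regular_at_mult[OF assms(1) Suc] by (simp add: algebra_simps)
qed (use regular_at_const[OF assms(2)] in simp)

text \<open>On the chart where coordinate \<open>i\<close> is nonzero its powers, negative ones
  included, trivialise the bundles O(k).\<close>

lemma regular_at_powi:
  fixes v :: "'a::field_char_0 ^ 3"
  assumes "v $ i \<noteq> 0"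
  shows "regular_at k (\<lambda>w. (w $ i) powi k) v"
proof -
  have v: "v \<noteq> 0" using assms by auto
  show ?thesis
  proof (cases "k \<ge> 0")
    case True
    thus ?thesis using regular_at_power[OF regular_at_nth[OF v, of i] v, of "nat k"]
      by (simp add: power_int_def)
  next
    case False
    thus ?thesis
      using regular_at_inverse[OF regular_at_power[OF regular_at_nth[OF v, of i] v, of "nat (- k)"]] assms
      by (simp add: power_int_def field_simps)
  qed
qed

lemma zariski_open_coord: "zariski_open {v :: 'a::field_char_0 ^ 3. v $ i \<noteq> 0}"
proof -
  have "{v :: 'a ^ 3. v $ i \<noteq> 0} = {v. v \<noteq> 0 \<and> v $ i \<noteq> 0}" by auto
  thus ?thesis
    using zariski_open_basic[OF homogeneous3_X3] zariski_open_basic[OF homogeneous3_Y3]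
      zariski_open_basic[OF homogeneous3_Z3] exhaust_3[of i] by auto
qed

lemma O_sum_sections_iff:
  fixes s :: "'a::field_char_0 ^ 3 \<Rightarrow> 'a ^ 2"
  assumes "zariski_open U"
  shows "s \<in> O_sum_sections k l U \<longleftrightarrow> (\<forall>v. v \<notin> U \<longrightarrow> s v = 0) \<and>
    (\<forall>v\<in>U. regular_at k (\<lambda>v. s v $ 1) v \<and> regular_at l (\<lambda>v. s v $ 2) v)"
  unfolding O_sum_sections_def using O_sections_iff[OF assms] by (auto simp: vec_eq_iff forall_2)

lemma derivation_sections_iff:
  fixes F :: "'a::field_char_0 poly3"
  assumes "zariski_open U"
  shows "s \<in> derivation_sections F U \<longleftrightarrow> (\<forall>v. v \<notin> U \<longrightarrow> s v = 0) \<and>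
    (\<forall>v\<in>U. \<forall>i. regular_at 0 (\<lambda>v. s v $ i) v) \<and> (\<forall>v. dot3 (eval_vec (grad3 F) v) (s v) = 0)"
  unfolding derivation_sections_def
  using O_sections_iff[OF assms] by (auto simp: vec_eq_iff fun_eq_iff jacobian_map_eq)

lemma regular_at_nonzero_nbhd:
  fixes f :: "'a::field_char_0 ^ 3 \<Rightarrow> 'a"
  assumes "regular_at k f v" "f v \<noteq> 0"
  obtains U where "zariski_open U" "v \<in> U" "\<And>w. w \<in> U \<Longrightarrow> f w \<noteq> 0"
proof -
  obtain W p q m n where W: "v \<in> W" "zariski_open W" "homogeneous3 m p" "homogeneous3 n q"
    "int m = int n + k" "\<And>w. w \<in> W \<Longrightarrow> eval3 q w \<noteq> 0"
    "\<And>w. w \<in> W \<Longrightarrow> f w = eval3 p w / eval3 q w" by (rule regular_atE[OF assms(1)]) (rule that)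
  have "v \<noteq> 0" using W zariski_open_nonzero by blast
  show ?thesis
    by (rule that[of "W \<inter> {w. w \<noteq> 0 \<and> eval3 p w \<noteq> 0}"])
      (use W assms(2) \<open>v \<noteq> 0\<close> in \<open>auto simp: zariski_open_Int zariski_open_basic\<close>)
qed

text \<open>Near \<open>v\<close> the function is a quotient of forms, and a basic neighbourhood of
  \<open>v\<close> contains all nonzero multiples of \<open>v\<close>; so the zeros form a
  cone.\<close>

lemma regular_at_zero_scale:
  fixes f :: "'a::field_char_0 ^ 3 \<Rightarrow> 'a"
  assumes "regular_at k f v" "f v = 0" "c \<noteq> 0"
  shows "f (c *s v) = 0"
proof -
  obtain W p q m n where W: "v \<in> W" "zariski_open W" "homogeneous3 m p" "homogeneous3 n q"
    "int m = int n + k" "\<And>w. w \<in> W \<Longrightarrow> eval3 q w \<noteq> 0"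
    "\<And>w. w \<in> W \<Longrightarrow> f w = eval3 p w / eval3 q w" by (rule regular_atE[OF assms(1)]) (rule that)
  obtain G l where G: "homogeneous3 l G" "eval3 G v \<noteq> 0" "v \<noteq> 0"
    "\<And>w. w \<noteq> 0 \<Longrightarrow> eval3 G w \<noteq> 0 \<Longrightarrow> w \<in> W"
    by (rule zariski_openE[OF W(2,1)]) (rule that)
  have "eval3 G (c *s v) \<noteq> 0" using G(2) assms(3) by (simp add: homogeneous3_eval_scale[OF G(1)])
  hence "c *s v \<in> W" using G(3,4) assms(3) by simp
  moreover have "eval3 p v = 0" using W(1,6,7) assms(2) by auto
  ultimately show ?thesis using W(7) by (simp add: homogeneous3_eval_scale[OF W(3)])
qed

subsection \<open>Counting zeros on a line\<close>

text \<open>Over an algebraically closed field the degree is the sum of the orders. The induction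
  divides both polynomials by a linear factor belonging to a root of \<open>p\<close>.\<close>

lemma degree_le_of_order_le:
  fixes p q :: "'a::alg_closed_field poly"
  assumes "p \<noteq> 0" "q \<noteq> 0" "\<And>t. order t p \<le> order t q"
  shows "degree p \<le> degree q"
  using assms
proof (induction "degree p" arbitrary: p q)
  case (Suc n)
  obtain t where t: "poly p t = 0" using alg_closed_imp_poly_has_root[of p] Suc.hyps(2) by auto
  hence "order t p \<noteq> 0" using Suc.prems(1) by (simp add: order_root)
  hence "order t q \<noteq> 0" using Suc.prems(3)[of t] by simp
  hence "poly q t = 0" by (metis order_root)
  with t obtain p' q' where p': "p = [:- t, 1:] * p'" and q': "q = [:- t, 1:] * q'"
    by (auto simp: poly_eq_0_iff_dvd dvd_def)
  have nz: "p' \<noteq> 0" "q' \<noteq> 0" using Suc.prems p' q' by auto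
  have "order s p' \<le> order s q'" for s
    using Suc.prems(3)[of s] order_mult[of "[:- t, 1:]" p' s] order_mult[of "[:- t, 1:]" q' s]
      Suc.prems(1,2) unfolding p' q' by linarith
  moreover have "degree p = Suc (degree p')" "degree q = Suc (degree q')"
    using nz degree_mult_eq[of "[:- t, 1:]" p'] degree_mult_eq[of "[:- t, 1:]" q']
    unfolding p' q' by simp_all
  ultimately show ?case using Suc.hyps(1)[of p' q'] Suc.hyps(2) nz by simp
qed simp

lemma order_prod_linear:
  fixes T :: "'a::idom set"
  assumes "finite T"
  shows "order t (\<Prod>s\<in>T. [:- s, 1:]) = (if t \<in> T then 1 else 0)"
  using assms
proof (induction T rule: finite_induct)
  case (insert s T)
  have "order t [:- s, 1:] = (if t = s then 1 else 0)"
    using order_power_n_n[of s 1] by (auto intro: order_0I)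
  moreover have "(\<Prod>s\<in>T. [:- s, 1:]) \<noteq> 0" using insert(1) by simp
  hence "[:- s, 1:] * (\<Prod>s\<in>T. [:- s, 1:]) \<noteq> 0" by (metis mult_eq_0_iff pCons_eq_0_iff zero_neq_one)
  ultimately show ?case using insert by (simp add: order_mult del: mult_pCons_left)
qed simp

text \<open>Here \<open>w\<close> is the point at infinity of the line through \<open>u\<close> and \<open>w\<close>.\<close>

lemma regular_zeros_on_line:
  fixes u w :: "'a::{alg_closed_field, field_char_0} ^ 3"
  assumes reg: "\<And>t. regular_at k f (u + t *s w)" and regw: "regular_at k f w"
    and T: "finite T" "\<And>t. t \<in> T \<Longrightarrow> f (u + t *s w) = 0"
    and card: "int (card T) + (if f w = 0 then 1 else 0) > k"
  shows "f (u + t0 *s w) = 0"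
proof (rule ccontr)
  assume nz: "f (u + t0 *s w) \<noteq> 0"
  obtain W p q where W: "u + t0 *s w \<in> W" "local_quotient k f W p q"
    using reg unfolding regular_at_def by blast
  then obtain m n where h: "homogeneous3 m p" "homogeneous3 n q"
    unfolding local_quotient_def by blast
  obtain P where P: "\<And>t. poly P t = eval3 p (u + t *s w)" using homogeneous3_line_poly[OF h(1)] by metis
  obtain Q where Q: "\<And>t. poly Q t = eval3 q (u + t *s w)" using homogeneous3_line_poly[OF h(2)] by metis
  have PQ0: "P \<noteq> 0" "Q \<noteq> 0" using P[of t0] Q[of t0] W nz by (auto simp: local_quotient_def)
  have cross: "P * Q' = P' * Q"
    if "local_quotient k f V p' q'" "v \<in> V" "\<And>t. poly P' t = eval3 p' (u + t *s w)"
      "\<And>t. poly Q' t = eval3 q' (u + t *s w)" for V v p' q' P' Q'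
  proof -
    have "p * q' = p' * q" using local_quotient_unique[OF W(2,1) that(1,2)] .
    hence "eval3 (p * q') v = eval3 (p' * q) v" for v by simp
    hence "poly (P * Q') t = poly (P' * Q) t" for t by (simp add: P Q that)
    thus ?thesis by (simp add: poly_eq_poly_eq_iff[symmetric] fun_eq_iff)
  qed
  \<comment> \<open>\<open>P / Q\<close> is \<open>f\<close> along the line. A local quotient whose
    denominator is nonzero at t shows that \<open>P / Q\<close> has no pole there, and a zero if t
    is in \<open>T\<close>; so the orders of \<open>R\<close> are bounded by those of
    \<open>P\<close>.\<close>
  define R where "R = Q * (\<Prod>s\<in>T. [:- s, 1:])"
  have "prod (\<lambda>s. [:- s, 1:]) T \<noteq> 0" using T(1) by simp
  hence R0: "R \<noteq> 0" using PQ0 by (simp add: R_def)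
  have "order t R \<le> order t P" for t
  proof -
    obtain V p' q' where V: "u + t *s w \<in> V" "local_quotient k f V p' q'"
      using reg unfolding regular_at_def by blast
    then obtain m' n' where h': "homogeneous3 m' p'" "homogeneous3 n' q'"
      unfolding local_quotient_def by blast
    obtain P' where P': "\<And>t. poly P' t = eval3 p' (u + t *s w)"
      using homogeneous3_line_poly[OF h'(1)] by metis
    obtain Q' where Q': "\<And>t. poly Q' t = eval3 q' (u + t *s w)"
      using homogeneous3_line_poly[OF h'(2)] by metis
    have e: "P * Q' = P' * Q" using cross[OF V(2,1) P' Q'] .
    have "poly Q' t \<noteq> 0" using V by (simp add: Q' local_quotient_def)
    hence "Q' \<noteq> 0" "order t Q' = 0" by (auto intro: order_0I)
    moreover have "P' \<noteq> 0" using e PQ0 \<open>Q' \<noteq> 0\<close> by auto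
    ultimately have o: "order t P = order t P' + order t Q"
      using arg_cong[OF e, of "order t"] PQ0 by (simp add: order_mult)
    have "order t P' \<noteq> 0" if "t \<in> T"
    proof -
      have "poly P' t = 0" using T(2)[OF that] V by (auto simp: P' local_quotient_def)
      thus ?thesis using \<open>P' \<noteq> 0\<close> by (simp add: order_root)
    qed
    thus ?thesis using R0 T(1) o unfolding R_def
      by (auto simp: order_mult order_prod_linear Suc_le_eq)
  qed
  hence "degree R \<le> degree P" using degree_le_of_order_le R0 PQ0 by blast
  moreover have "degree R = degree Q + card T"
    using PQ0 T(1) unfolding R_def by (subst degree_mult_eq) (simp_all add: degree_prod_sum_eq)
  ultimately have 1: "degree Q + card T \<le> degree P" by simp
  \<comment> \<open>Now the point \<open>w\<close>. There \<open>Q'\<close> has its full degree, so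
    the degree of \<open>P\<close> exceeds that of \<open>Q\<close> by at most \<open>k\<close>, and
    by less than \<open>k\<close> if \<open>f w = 0\<close>. This contradicts the zeros already
    counted.\<close>
  obtain V p' q' where V: "w \<in> V" "local_quotient k f V p' q'"
    using regw unfolding regular_at_def by blast
  then obtain m' n' where h': "homogeneous3 m' p'" "homogeneous3 n' q'" "int m' = int n' + k"
    unfolding local_quotient_def by blast
  obtain P' where P': "degree P' \<le> m'" "coeff P' m' = eval3 p' w"
    "\<And>t. poly P' t = eval3 p' (u + t *s w)" using homogeneous3_line_poly[OF h'(1)] by metis
  obtain Q' where Q': "degree Q' \<le> n'" "coeff Q' n' = eval3 q' w"
    "\<And>t. poly Q' t = eval3 q' (u + t *s w)" using homogeneous3_line_poly[OF h'(2)] by metis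
  have e: "P * Q' = P' * Q" using cross[OF V(2,1) P'(3) Q'(3)] .
  have "coeff Q' n' \<noteq> 0" using V Q' by (simp add: local_quotient_def)
  hence Q'0: "Q' \<noteq> 0" and dQ': "degree Q' = n'" using Q'(1) le_degree[of Q' n'] by auto
  have P'0: "P' \<noteq> 0" using e PQ0 Q'0 by auto
  have 2: "degree P + n' = degree P' + degree Q"
    using arg_cong[OF e, of degree] PQ0 Q'0 P'0 dQ' by (simp add: degree_mult_eq)
  have "int (degree P') + (if f w = 0 then 1 else 0) \<le> int m'"
  proof (cases "f w = 0")
    case True
    hence "coeff P' m' = 0" using V P' by (simp add: local_quotient_def)
    hence "degree P' \<noteq> m'" using P'0 by auto
    with P'(1) True show ?thesis by simp
  qed (use P'(1) in simp)
  with 1 2 h'(3) card show False by (auto split: if_splits)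
qed

subsection \<open>Linear forms\<close>

definition lin :: "'a::comm_ring_1 ^ 3 \<Rightarrow> 'a poly3" where
  "lin a = Const3 (a $ 1) * X3 + Const3 (a $ 2) * Y3 + Const3 (a $ 3) * Z3"

lemma eval3_lin [simp]: "eval3 (lin a) v = dot3 a v"
  by (simp add: lin_def dot3_def)

lemma partial3_lin [simp]: "partial3 i (lin a) = Const3 (a $ i)"
  using exhaust_3[of i] by (auto simp: lin_def)

lemma homogeneous3_lin: "homogeneous3 1 (lin (a :: 'a::field_char_0 ^ 3))"
  using homogeneous3_mult[OF homogeneous3_Const3 homogeneous3_X3, of "a $ 1"]
    homogeneous3_mult[OF homogeneous3_Const3 homogeneous3_Y3, of "a $ 2"]
    homogeneous3_mult[OF homogeneous3_Const3 homogeneous3_Z3, of "a $ 3"]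
  unfolding lin_def by (auto intro!: homogeneous3_add)

text \<open>Divisibility by such a polynomial means vanishing at \<open>- (b * c')\<close>, and the
  values lie in a domain.\<close>

lemma prime_elem_linear_unit:
  fixes b c :: "'a::idom"
  assumes "c * c' = 1"
  shows "prime_elem [:b, c:]"
proof -
  have dvd: "[:b, c:] dvd p \<longleftrightarrow> poly p (- (b * c')) = 0" for p
  proof -
    have "c * (b * c') = b" by (metis assms mult.left_commute mult.right_neutral)
    hence e: "[:b, c:] = [:c:] * [:b * c', 1:]" by (simp only: mult_pCons_left) simp
    have u: "[:c:] * [:c':] = 1" using assms by (simp add: one_pCons mult.commute)
    have "[:b, c:] dvd p \<longleftrightarrow> [:c:] * [:b * c', 1:] dvd p" by (simp only: e)
    also have "\<dots> \<longleftrightarrow> [:b * c', 1:] dvd p"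
    proof
      assume "[:b * c', 1:] dvd p"
      then obtain r where "p = [:b * c', 1:] * r" by (elim dvdE)
      hence "p = ([:c:] * [:b * c', 1:]) * ([:c':] * r)" using u
        by (metis (no_types, opaque_lifting) mult.assoc mult.commute mult.right_neutral)
      thus "[:c:] * [:b * c', 1:] dvd p" by (rule dvdI)
    qed (rule dvd_mult_right)
    finally show ?thesis by (simp add: poly_eq_0_iff_dvd)
  qed
  show ?thesis unfolding prime_elem_def
  proof (intro conjI allI impI)
    have "c \<noteq> 0" using assms by auto
    thus "[:b, c:] \<noteq> 0" by simp
    show "\<not> [:b, c:] dvd 1" by (simp add: dvd)
  qed (simp add: dvd)
qed

text \<open>The outermost variable that occurs has a unit as its coefficient. Variables further out
  do not occur, and primality lifts to constant polynomials.\<close>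

lemma prime_elem_lin:
  fixes a :: "'a::field ^ 3"
  assumes "a \<noteq> 0"
  shows "prime_elem (lin a)"
proof -
  have e: "lin a = [:[:[:0, a $ 1:], [:a $ 2:]:], [:[:a $ 3:]:]:]"
    by (simp add: lin_def Const3_def X3_def Y3_def Z3_def)
  consider "a $ 3 \<noteq> 0" | "a $ 3 = 0" "a $ 2 \<noteq> 0" | "a $ 3 = 0" "a $ 2 = 0" "a $ 1 \<noteq> 0"
    using assms by (auto simp: vec3_eq_iff)
  thus ?thesis
  proof cases
    case 1
    show ?thesis unfolding e
      by (rule prime_elem_linear_unit[of _ "[:[:1 / a $ 3:]:]"]) (use 1 in \<open>simp add: one_pCons\<close>)
  next
    case 2
    have "prime_elem [:[:0, a $ 1:], [:a $ 2:]:]"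
      by (rule prime_elem_linear_unit[of _ "[:1 / a $ 2:]"]) (use 2 in \<open>simp add: one_pCons\<close>)
    thus ?thesis using 2 unfolding e by (simp add: lift_prime_elem_poly)
  next
    case 3
    have "prime_elem [:0, a $ 1:]"
      by (rule prime_elem_linear_unit[of _ "1 / a $ 1"]) (use 3 in simp)
    thus ?thesis using 3 unfolding e by (simp add: lift_prime_elem_poly)
  qed
qed

lemma dot3_vprod_swap: "dot3 b (vprod a u) = dot3 u (vprod b a)"
  by (simp add: dot3_def algebra_simps)

lemma dot3_all_eq_0:
  assumes "\<And>u. dot3 u n = 0"
  shows "n = 0"
  using assms[of "vector [1, 0, 0]"] assms[of "vector [0, 1, 0]"] assms[of "vector [0, 0, 1]"]
  by (simp add: dot3_def vec3_eq_iff)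

lemma vprod_self_orthogonal [simp]: "dot3 a (vprod a b) = 0" "dot3 b (vprod a b) = 0"
  by (simp_all add: dot3_def algebra_simps)

lemma dot3_commute: "dot3 a b = dot3 b a"
  by (simp add: dot3_def mult.commute)

text \<open>Each \<open>vprod a u\<close> lies on the line of \<open>a\<close>, hence on that of
  \<open>b\<close>. By the symmetry of the triple product, \<open>vprod b a\<close> is then
  orthogonal to every \<open>u\<close>.\<close>

lemma lin_dvd_lin_imp_parallel:
  fixes a b :: "'a::field ^ 3"
  assumes "lin a dvd lin b"
  shows "vprod b a = 0"
proof (rule dot3_all_eq_0)
  fix u
  have "eval3 (lin a) (vprod a u) = 0" by simp
  hence "eval3 (lin b) (vprod a u) = 0" using assms by (elim dvdE) simp
  thus "dot3 u (vprod b a) = 0" by (simp only: eval3_lin dot3_vprod_swap[of b a u])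
qed

lemma prime_elem_dvd_prodE:
  assumes "finite A" "prime_elem p" "p dvd prod f A"
  obtains a where "a \<in> A" "p dvd f a"
  using assms by (induction A rule: finite_induct) (auto dest: prime_elem_dvd_multD prime_elem_not_unit)

lemma prod_primes_dvd:
  fixes f :: "'b \<Rightarrow> 'a::idom"
  assumes "finite A" "\<And>a. a \<in> A \<Longrightarrow> prime_elem (f a)" "\<And>a. a \<in> A \<Longrightarrow> f a dvd h"
    "\<And>a b. a \<in> A \<Longrightarrow> b \<in> A \<Longrightarrow> a \<noteq> b \<Longrightarrow> \<not> f a dvd f b"
  shows "prod f A dvd h"
  using assms
proof (induction A rule: finite_induct)
  case (insert a A)
  hence "prod f A dvd h" by auto
  then obtain r where r: "h = prod f A * r" by (elim dvdE)
  have "\<not> f a dvd prod f A"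
  proof
    assume "f a dvd prod f A"
    then obtain b where "b \<in> A" "f a dvd f b"
      using insert.prems(1)[of a] insert.hyps(1) by (auto elim: prime_elem_dvd_prodE)
    thus False using insert.prems(3)[of a b] insert.hyps(2) by auto
  qed
  moreover have "f a dvd prod f A * r" using insert.prems(2)[of a] r by simp
  ultimately have "f a dvd r" using insert.prems(1)[of a] by (simp add: prime_elem_dvd_mult_iff)
  thus ?case using insert.hyps r by (auto elim!: dvdE simp: mult_ac)
qed simp

subsection \<open>Line arrangements\<close>

text \<open>One normal vector stands for each line. By \<open>indep\<close> different vectors give
  different lines, so the product \<open>F\<close> is squarefree.\<close>

locale line_arrangement =
  fixes V :: "('a::field_char_0 ^ 3) set"
  assumes fin: "finite V" and nonempty: "V \<noteq> {}"
    and nonzero: "\<And>a. a \<in> V \<Longrightarrow> a \<noteq> 0"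
    and indep: "\<And>a b. a \<in> V \<Longrightarrow> b \<in> V \<Longrightarrow> a \<noteq> b \<Longrightarrow> vprod a b \<noteq> 0"
begin

definition F :: "'a poly3" where "F = prod lin V"

lemma homogeneous_F: "homogeneous3 (card V) F"
  unfolding F_def using fin by (intro homogeneous3_prod homogeneous3_lin)

lemma homogeneous_grad: "homogeneous3 (card V - 1) (grad3 F $ i)"
  using homogeneous3_partial3[OF homogeneous_F] by simp

lemma euler_F: "dot3 coords3 (grad3 F) = of_nat (card V) * F"
  using homogeneous_F by (simp add: homogeneous3_iff_euler euler3_dot3)

lemma F_nonzero: "F \<noteq> 0"
  unfolding F_def using fin nonzero prime_elem_lin by (auto simp: prime_elem_def)

lemma card_nonzero: "(of_nat (card V) :: 'b::semiring_char_0) \<noteq> 0"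
  using fin nonempty by simp

lemma F_factor:
  assumes "a \<in> V"
  shows "F = lin a * prod lin (V - {a})"
  unfolding F_def using fin assms by (simp add: prod.remove)

lemma partial_F_factor:
  assumes "a \<in> V"
  shows "partial3 i F = Const3 (a $ i) * prod lin (V - {a}) + lin a * partial3 i (prod lin (V - {a}))"
  by (subst F_factor[OF assms]) simp

lemma lin_not_dvd: "a \<in> V \<Longrightarrow> b \<in> V \<Longrightarrow> a \<noteq> b \<Longrightarrow> \<not> lin a dvd lin b"
  using lin_dvd_lin_imp_parallel indep by blast

text \<open>The partial derivatives have no common factor. With h the dot product of the coordinates
  and \<open>w\<close>, Euler's formula yields \<open>card V * F * w $ i = h * partial3 i F\<close>.
  Every prime factor of \<open>F\<close> must divide h, so \<open>F\<close> divides h and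
  cancels.\<close>

lemma parallel_grad:
  assumes "vprod w (grad3 F) = 0"
  obtains g where "w = g *s grad3 F"
proof -
  let ?n = "of_nat (card V) :: 'a poly3"
  define h where "h = dot3 coords3 w"
  have e: "dot3 coords3 (grad3 F) * w $ i = h * partial3 i F" for i
  proof -
    have "w $ 2 * partial3 3 F = w $ 3 * partial3 2 F" "w $ 3 * partial3 1 F = w $ 1 * partial3 3 F"
      "w $ 1 * partial3 2 F = w $ 2 * partial3 1 F" using assms by (simp_all add: vec3_eq_iff)
    hence "\<forall>i. dot3 coords3 (grad3 F) * w $ i = h * partial3 i F"
      unfolding forall_3 h_def dot3_def grad3_nth by (intro conjI) algebra+
    thus ?thesis by blast
  qed
  have "F dvd h" unfolding F_def
  proof (rule prod_primes_dvd[OF fin])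
    fix a assume a: "a \<in> V"
    show p: "prime_elem (lin a)" using nonzero[OF a] by (rule prime_elem_lin)
    obtain i where i: "a $ i \<noteq> 0" using nonzero[OF a] by (auto simp: vec_eq_iff)
    \<comment> \<open>Modulo \<open>lin a\<close>, the derivative of \<open>F\<close> is
      \<open>a $ i\<close> times the product of the other forms, and no prime \<open>lin a\<close>
      divides that when \<open>a $ i\<close> is nonzero.\<close>
    have "\<not> lin a dvd prod lin (V - {a})"
      by (metis DiffD1 DiffD2 a fin finite_Diff lin_not_dvd p prime_elem_dvd_prodE singletonI)
    moreover have "\<not> lin a dvd Const3 (a $ i)"
    proof
      assume "lin a dvd Const3 (a $ i)"
      then obtain r where "Const3 (a $ i) = lin a * r" by (elim dvdE)
      hence "eval3 (Const3 (a $ i)) 0 = eval3 (lin a * r) 0" by simp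
      with i show False by (simp add: dot3_def)
    qed
    ultimately have "\<not> lin a dvd Const3 (a $ i) * prod lin (V - {a})"
      using p by (simp add: prime_elem_dvd_mult_iff)
    hence "\<not> lin a dvd partial3 i F" unfolding partial_F_factor[OF a] by (simp add: dvd_add_left_iff)
    moreover have "lin a dvd h * partial3 i F"
      unfolding e[of i, symmetric] euler_F using F_factor[OF a] by simp
    ultimately show "lin a dvd h" using p by (simp add: prime_elem_dvd_mult_iff)
  qed (use lin_not_dvd in auto)
  then obtain g where g: "h = F * g" by (elim dvdE)
  have c: "Const3 (1 / of_nat (card V)) * ?n = 1"
    using card_nonzero by (simp flip: Const3_of_nat Const3_simps)
  have "w $ i = Const3 (1 / of_nat (card V)) * g * partial3 i F" for i
  proof -
    have "F * (?n * w $ i) = F * (g * partial3 i F)"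
      using e[of i] unfolding euler_F g by (simp add: mult_ac)
    hence "?n * w $ i = g * partial3 i F" using F_nonzero by simp
    hence "Const3 (1 / of_nat (card V)) * (?n * w $ i) = Const3 (1 / of_nat (card V)) * (g * partial3 i F)"
      by simp
    thus ?thesis unfolding mult.assoc[symmetric] c by simp
  qed
  hence "w = (Const3 (1 / of_nat (card V)) * g) *s grad3 F" by (simp add: vec_eq_iff)
  with that show ?thesis by blast
qed

end

text \<open>The bound \<open>K \<le> m\<close> keeps later differences such as \<open>m - a\<close>
  meaningful on natural numbers. It is reached by multiplying numerators and denominator by a power
  of a coordinate that is nonzero at \<open>v\<close>.\<close>

lemma regular_at_common_denominator:
  fixes s :: "'a::field_char_0 ^ 3 \<Rightarrow> 'a ^ 3"
  assumes reg: "\<And>i. regular_at 0 (\<lambda>w. s w $ i) v"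
  obtains W p q m where "v \<in> W" "zariski_open W" "K \<le> m" "\<And>i. homogeneous3 m (p $ i)"
    "homogeneous3 m q" "\<And>w. w \<in> W \<Longrightarrow> eval3 q w \<noteq> 0"
    "\<And>w. w \<in> W \<Longrightarrow> eval3 q w *s s w = eval_vec p w"
proof -
  have "\<forall>i. \<exists>W p q m. v \<in> W \<and> zariski_open W \<and> homogeneous3 m p \<and> homogeneous3 m q \<and>
    (\<forall>w\<in>W. eval3 q w \<noteq> 0 \<and> s w $ i = eval3 p w / eval3 q w)"
  proof
    fix i
    show "\<exists>W p q m. v \<in> W \<and> zariski_open W \<and> homogeneous3 m p \<and> homogeneous3 m q \<and>
      (\<forall>w\<in>W. eval3 q w \<noteq> 0 \<and> s w $ i = eval3 p w / eval3 q w)"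
      by (rule regular_atE[OF reg[of i]]) (metis add_0_right of_nat_eq_iff)
  qed
  then obtain W P Q M where W: "\<And>i. v \<in> W i" "\<And>i. zariski_open (W i)"
    "\<And>i. homogeneous3 (M i) (P i)" "\<And>i. homogeneous3 (M i) (Q i)"
    "\<And>i w. w \<in> W i \<Longrightarrow> eval3 (Q i) w \<noteq> 0"
    "\<And>i w. w \<in> W i \<Longrightarrow> s w $ i = eval3 (P i) w / eval3 (Q i) w" for i :: 3 by metis
  have "v \<noteq> 0" using W zariski_open_nonzero by blast
  then obtain j where j: "v $ j \<noteq> 0" by (auto simp: vec_eq_iff)
  define x where "x = (coords3 :: 'a poly3 ^ 3) $ j"
  have x: "homogeneous3 1 x" "\<And>w. eval3 x w = w $ j"
    using exhaust_3[of j] by (auto simp: x_def)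
  have xK: "homogeneous3 K (x ^ K)" using homogeneous3_power[OF x(1), of K] by simp
  define U where "U = {w. w $ j \<noteq> 0} \<inter> (W 1 \<inter> (W 2 \<inter> W 3))"
  define q where "q = x ^ K * (Q 1 * (Q 2 * Q 3))"
  define p where "p = (vector [x ^ K * (P 1 * (Q 2 * Q 3)), x ^ K * (Q 1 * (P 2 * Q 3)),
    x ^ K * (Q 1 * (Q 2 * P 3))] :: 'a poly3 ^ 3)"
  define m where "m = K + (M 1 + (M 2 + M 3))"
  show ?thesis
  proof (rule that[of U m p q])
    show "v \<in> U" using W(1) j by (simp add: U_def)
    show "zariski_open U" unfolding U_def by (intro zariski_open_Int W zariski_open_coord)
    show "K \<le> m" by (simp add: m_def)
    show "homogeneous3 m q" unfolding q_def m_def by (intro homogeneous3_mult xK W)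
    have "\<forall>i. homogeneous3 m (p $ i)"
      unfolding forall_3 p_def vector_3 m_def by (intro conjI homogeneous3_mult xK W)
    thus "homogeneous3 m (p $ i)" for i by blast
    fix w assume w: "w \<in> U"
    show "eval3 q w \<noteq> 0" using w W(5) x(2) by (auto simp: q_def U_def)
    have "eval3 (Q i) w \<noteq> 0 \<and> s w $ i = eval3 (P i) w / eval3 (Q i) w" for i
      using w W(5,6)[of w i] exhaust_3[of i] unfolding U_def by auto
    thus "eval3 q w *s s w = eval_vec p w"
      by (simp add: vec3_eq_iff q_def p_def)
  qed
qed

subsection \<open>Saito's criterion\<close>

locale saito_basis = line_arrangement V for V :: "('a::field_char_0 ^ 3) set" +
  fixes \<theta>1 \<theta>2 :: "'a poly3 ^ 3" and a b :: nat and c :: 'a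
  assumes hom1: "\<And>i. homogeneous3 a (\<theta>1 $ i)" and hom2: "\<And>i. homogeneous3 b (\<theta>2 $ i)"
    and saito: "vprod \<theta>1 \<theta>2 = Const3 c *s grad3 F" and c: "c \<noteq> 0"
begin

lemma grad_nonzero: "grad3 F \<noteq> 0"
proof
  assume "grad3 F = 0"
  hence "of_nat (card V) * F = 0" unfolding euler_F[symmetric] by (simp add: dot3_def)
  with card_nonzero F_nonzero show False by simp
qed

lemma vprod_nonzero: "vprod \<theta>1 \<theta>2 \<noteq> 0"
  using grad_nonzero c unfolding saito by (auto simp: vec_eq_iff)

lemma grad_eq: "grad3 F = Const3 (1 / c) *s vprod \<theta>1 \<theta>2"
  unfolding saito using c by (simp add: vec_eq_iff mult.assoc[symmetric] flip: Const3_simps(4))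

lemma tangent: "dot3 (grad3 F) \<theta>1 = 0" "dot3 (grad3 F) \<theta>2 = 0"
  unfolding grad_eq by (simp_all add: dot3_def algebra_simps)

lemma independent:
  assumes "A *s \<theta>1 + B *s \<theta>2 = 0"
  shows "A = 0" "B = 0"
proof -
  have "A *s vprod \<theta>1 \<theta>2 = vprod (A *s \<theta>1 + B *s \<theta>2) \<theta>2"
    by (simp add: vec3_eq_iff algebra_simps)
  also have "\<dots> = 0" unfolding assms by (simp add: vec3_eq_iff)
  finally show "A = 0" using vprod_nonzero by (auto simp: vec_eq_iff)
  have "B *s vprod \<theta>1 \<theta>2 = vprod \<theta>1 (A *s \<theta>1 + B *s \<theta>2)"
    by (simp add: vec3_eq_iff algebra_simps)
  also have "\<dots> = 0" unfolding assms by (simp add: vec3_eq_iff)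
  finally show "B = 0" using vprod_nonzero by (auto simp: vec_eq_iff)
qed

text \<open>Cramer's rule. \<open>vprod p \<theta>2\<close> and \<open>vprod \<theta>1 p\<close> are
  parallel to the gradient, hence polynomial multiples of \<open>vprod \<theta>1 \<theta>2\<close>
  by \<open>parallel_grad\<close>, and the multipliers are the coefficients. The remainder is
  parallel to both generators, so it vanishes.\<close>

lemma generates:
  assumes p: "dot3 (grad3 F) p = 0" and hom: "\<And>i. homogeneous3 m (p $ i)"
    and m: "a \<le> m" "b \<le> m"
  obtains g h where "p = g *s \<theta>1 + h *s \<theta>2" "homogeneous3 (m - a) g" "homogeneous3 (m - b) h"
proof -
  have mult: "\<exists>g. w = g *s vprod \<theta>1 \<theta>2" if "vprod (grad3 F) w = 0" for w
  proof -
    have "vprod w (grad3 F) = 0" using that by (simp add: vec3_eq_iff mult.commute)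
    then obtain g where "w = g *s grad3 F" by (rule parallel_grad)
    thus ?thesis unfolding grad_eq by (auto simp: vector_smult_assoc)
  qed
  obtain i where i: "vprod \<theta>1 \<theta>2 $ i \<noteq> 0" using vprod_nonzero by (auto simp: vec_eq_iff)
  have hv: "homogeneous3 (k + l) (vprod u w $ j)"
    if "\<And>i. homogeneous3 k (u $ i)" "\<And>i. homogeneous3 l (w $ i)"
    for k l j and u w :: "'a poly3 ^ 3"
  proof -
    have "\<forall>j. homogeneous3 (k + l) (vprod u w $ j)"
      unfolding forall_3 vprod_nth by (intro conjI homogeneous3_diff homogeneous3_mult that)
    thus ?thesis by blast
  qed
  from mult[OF vprod_orthogonal[OF p tangent(2)]] obtain g where
    g: "vprod p \<theta>2 = g *s vprod \<theta>1 \<theta>2" by blast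
  from mult[OF vprod_orthogonal[OF tangent(1) p]] obtain h where
    h: "vprod \<theta>1 p = h *s vprod \<theta>1 \<theta>2" by blast
  have "vprod (p - (g *s \<theta>1 + h *s \<theta>2)) \<theta>1 = h *s vprod \<theta>1 \<theta>2 - vprod \<theta>1 p"
    by (simp add: vec3_eq_iff algebra_simps)
  hence 1: "vprod (p - (g *s \<theta>1 + h *s \<theta>2)) \<theta>1 = 0" by (simp add: h)
  have "vprod (p - (g *s \<theta>1 + h *s \<theta>2)) \<theta>2 = vprod p \<theta>2 - g *s vprod \<theta>1 \<theta>2"
    by (simp add: vec3_eq_iff algebra_simps)
  hence 2: "vprod (p - (g *s \<theta>1 + h *s \<theta>2)) \<theta>2 = 0" by (simp add: g)
  have "p - (g *s \<theta>1 + h *s \<theta>2) = 0"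
    by (rule parallel_both_imp_zero[OF 1 2 vprod_nonzero])
  hence "p = g *s \<theta>1 + h *s \<theta>2" by simp
  moreover have "homogeneous3 (m - a) g"
  proof -
    have "homogeneous3 (m + b) (g * vprod \<theta>1 \<theta>2 $ i)"
      using hv[OF hom hom2, of i] unfolding g by simp
    from homogeneous3_factor[OF this hv[OF hom1 hom2] i] show ?thesis by auto
  qed
  moreover have "homogeneous3 (m - b) h"
  proof -
    have "homogeneous3 (a + m) (h * vprod \<theta>1 \<theta>2 $ i)"
      using hv[OF hom1 hom, of i] unfolding h by simp
    from homogeneous3_factor[OF this hv[OF hom1 hom2] i] show ?thesis by auto
  qed
  ultimately show ?thesis by (rule that)
qed

text \<open>The explicit direction of the isomorphism, from the split bundle to the derivation
  bundle. The definition of freeness asks for its inverse.\<close>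

definition \<psi> :: "('a ^ 3 \<Rightarrow> 'a ^ 2) \<Rightarrow> 'a ^ 3 \<Rightarrow> 'a ^ 3" where
  "\<psi> s = (\<lambda>v. s v $ 1 *s eval_vec \<theta>1 v + s v $ 2 *s eval_vec \<theta>2 v)"

abbreviation S :: "('a ^ 3) set \<Rightarrow> ('a ^ 3 \<Rightarrow> 'a ^ 2) set" where
  "S U \<equiv> O_sum_sections (- int a) (- int b) U"

lemma \<psi>_in:
  assumes U: "zariski_open U" and s: "s \<in> S U"
  shows "\<psi> s \<in> derivation_sections F U"
  unfolding derivation_sections_iff[OF U]
proof (intro conjI allI ballI impI)
  fix v assume "v \<notin> U"
  thus "\<psi> s v = 0" using s unfolding O_sum_sections_iff[OF U] \<psi>_def by simp
next
  fix v i assume v: "v \<in> U"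
  have v0: "v \<noteq> 0" using zariski_open_nonzero[OF U v] .
  have "regular_at (- int a + int a) (\<lambda>v. s v $ 1 * eval3 (\<theta>1 $ i) v) v"
    using s v unfolding O_sum_sections_iff[OF U] by (intro regular_at_mult regular_at_poly hom1 v0) auto
  moreover have "regular_at (- int b + int b) (\<lambda>v. s v $ 2 * eval3 (\<theta>2 $ i) v) v"
    using s v unfolding O_sum_sections_iff[OF U] by (intro regular_at_mult regular_at_poly hom2 v0) auto
  ultimately show "regular_at 0 (\<lambda>v. \<psi> s v $ i) v"
    unfolding \<psi>_def by (simp add: regular_at_add)
next
  fix v
  have "dot3 (eval_vec (grad3 F) v) (eval_vec \<theta>1 v) = 0" "dot3 (eval_vec (grad3 F) v) (eval_vec \<theta>2 v) = 0"
    using arg_cong[OF tangent(1), of "\<lambda>p. eval3 p v"] arg_cong[OF tangent(2), of "\<lambda>p. eval3 p v"]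
    by simp_all
  moreover have "dot3 g (x *s y + x' *s y') = x * dot3 g y + x' * dot3 g y'" for g y y' :: "'a ^ 3" and x x'
    by (simp add: dot3_def algebra_simps)
  ultimately show "dot3 (eval_vec (grad3 F) v) (\<psi> s v) = 0" unfolding \<psi>_def by simp
qed

lemma independent_on:
  assumes W: "zariski_open W" "v \<in> W"
    and z: "\<And>w. w \<in> W \<Longrightarrow> eval3 A w *s eval_vec \<theta>1 w + eval3 B w *s eval_vec \<theta>2 w = 0"
  shows "A = 0" "B = 0"
proof -
  have "A *s \<theta>1 + B *s \<theta>2 = 0"
  proof (subst vec_eq_iff, intro allI)
    fix i
    have "(A *s \<theta>1 + B *s \<theta>2) $ i = 0"
    proof (rule zariski_dense[OF W])
      fix w assume "w \<in> W"
      from arg_cong[OF z[OF this], of "\<lambda>x. x $ i"]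
      show "eval3 ((A *s \<theta>1 + B *s \<theta>2) $ i) w = 0" by simp
    qed
    thus "(A *s \<theta>1 + B *s \<theta>2) $ i = 0 $ i" by simp
  qed
  from independent[OF this] show "A = 0" "B = 0" .
qed

text \<open>Clearing the denominators of the two coefficient differences gives a polynomial relation
  between the generators on an open set, which \<open>independent_on\<close> excludes unless both
  numerators vanish.\<close>

lemma \<psi>_inj:
  assumes U: "zariski_open U"
  shows "inj_on \<psi> (S U)"
proof (rule inj_onI)
  fix s t assume s: "s \<in> S U" and t: "t \<in> S U" and e: "\<psi> s = \<psi> t"
  show "s = t"
  proof
    fix v
    show "s v = t v"
    proof (cases "v \<in> U")
      case False
      thus ?thesis using s t unfolding O_sum_sections_iff[OF U] by simp
    next
      case v: True
      have v0: "v \<noteq> 0" using zariski_open_nonzero[OF U v] .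
      have 1: "regular_at (- int a) (\<lambda>v. s v $ 1 - t v $ 1) v"
        using s t v unfolding O_sum_sections_iff[OF U] by (intro regular_at_diff v0) auto
      have 2: "regular_at (- int b) (\<lambda>v. s v $ 2 - t v $ 2) v"
        using s t v unfolding O_sum_sections_iff[OF U] by (intro regular_at_diff v0) auto
      obtain W p q m n where W: "v \<in> W" "zariski_open W" "homogeneous3 m p" "homogeneous3 n q"
        "int m = int n + - int a" "\<And>w. w \<in> W \<Longrightarrow> eval3 q w \<noteq> 0"
        "\<And>w. w \<in> W \<Longrightarrow> s w $ 1 - t w $ 1 = eval3 p w / eval3 q w"
        by (rule regular_atE[OF 1]) (rule that)
      obtain W' p' q' m' n' where W': "v \<in> W'" "zariski_open W'" "homogeneous3 m' p'" "homogeneous3 n' q'"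
        "int m' = int n' + - int b" "\<And>w. w \<in> W' \<Longrightarrow> eval3 q' w \<noteq> 0"
        "\<And>w. w \<in> W' \<Longrightarrow> s w $ 2 - t w $ 2 = eval3 p' w / eval3 q' w"
        by (rule regular_atE[OF 2]) (rule that)
      have z: "eval3 (p * q') w *s eval_vec \<theta>1 w + eval3 (p' * q) w *s eval_vec \<theta>2 w = 0"
        if w: "w \<in> W \<inter> W'" for w
      proof -
        have "(s w $ 1 - t w $ 1) *s eval_vec \<theta>1 w + (s w $ 2 - t w $ 2) *s eval_vec \<theta>2 w = 0"
          using fun_cong[OF e, of w] unfolding \<psi>_def by (simp add: vec_eq_iff algebra_simps)
        hence "(eval3 q w * eval3 q' w) *s ((s w $ 1 - t w $ 1) *s eval_vec \<theta>1 w + (s w $ 2 - t w $ 2) *s eval_vec \<theta>2 w) = 0"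
          by simp
        moreover have "eval3 p w = eval3 q w * (s w $ 1 - t w $ 1)"
          "eval3 p' w = eval3 q' w * (s w $ 2 - t w $ 2)"
          using w W(6,7)[of w] W'(6,7)[of w] by simp_all
        hence "eval3 (p * q') w *s eval_vec \<theta>1 w + eval3 (p' * q) w *s eval_vec \<theta>2 w =
          (eval3 q w * eval3 q' w) *s ((s w $ 1 - t w $ 1) *s eval_vec \<theta>1 w + (s w $ 2 - t w $ 2) *s eval_vec \<theta>2 w)"
          by (simp only: eval3_simps) (simp add: vec_eq_iff algebra_simps)
        ultimately show ?thesis by simp
      qed
      have o: "zariski_open (W \<inter> W')" "v \<in> W \<inter> W'" using W W' by (auto intro: zariski_open_Int)
      have "p * q' = 0" "p' * q = 0" using independent_on[OF o z] by auto
      hence "eval3 (p * q') v = 0" "eval3 (p' * q) v = 0" by (simp_all only: eval3_simps(1))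
      hence "s v $ 1 - t v $ 1 = 0" "s v $ 2 - t v $ 2 = 0"
        using W W' by auto
      thus ?thesis by (simp add: vec_eq_iff forall_2)
    qed
  qed
qed

lemma \<psi>_surj:
  assumes U: "zariski_open U" and s: "s \<in> derivation_sections F U"
  shows "\<exists>f\<in>S U. \<psi> f = s"
proof -
  define rep where "rep v W g h q m \<longleftrightarrow> v \<in> W \<and> zariski_open W \<and> W \<subseteq> U \<and> a \<le> m \<and> b \<le> m \<and>
    homogeneous3 (m - a) g \<and> homogeneous3 (m - b) h \<and> homogeneous3 m q \<and>
    (\<forall>w\<in>W. eval3 q w \<noteq> 0 \<and>
      eval3 q w *s s w = eval3 g w *s eval_vec \<theta>1 w + eval3 h w *s eval_vec \<theta>2 w)" for v W g h q m
  have "\<exists>W g h q m. rep v W g h q m" if v: "v \<in> U" for v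
  proof -
    have "regular_at 0 (\<lambda>w. s w $ i) v" for i using s v unfolding derivation_sections_iff[OF U] by blast
    then obtain W p q m where W: "v \<in> W" "zariski_open W" "a + b \<le> m" "\<And>i. homogeneous3 m (p $ i)"
      "homogeneous3 m q" "\<And>w. w \<in> W \<Longrightarrow> eval3 q w \<noteq> 0"
      "\<And>w. w \<in> W \<Longrightarrow> eval3 q w *s s w = eval_vec p w"
      by (rule regular_at_common_denominator) (rule that)
    have "dot3 (grad3 F) p = 0"
    proof (rule zariski_dense[OF W(2,1)])
      fix w assume "w \<in> W"
      have "dot3 (eval_vec (grad3 F) w) (eval3 q w *s s w) = eval3 q w * dot3 (eval_vec (grad3 F) w) (s w)"
        by (simp add: dot3_def algebra_simps)
      also have "\<dots> = 0" using s unfolding derivation_sections_iff[OF U] by simp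
      finally show "eval3 (dot3 (grad3 F) p) w = 0" using W(7)[OF \<open>w \<in> W\<close>] by simp
    qed
    then obtain g h where "p = g *s \<theta>1 + h *s \<theta>2" "homogeneous3 (m - a) g" "homogeneous3 (m - b) h"
      using W(3,4) by (metis generates add_leE)
    hence "rep v (W \<inter> U) g h q m"
      unfolding rep_def using W v U by (auto simp: zariski_open_Int vec_eq_iff)
    thus ?thesis by blast
  qed
  then obtain W g h q m where rep: "\<And>v. v \<in> U \<Longrightarrow> rep v (W v) (g v) (h v) (q v) (m v)" by metis
  \<comment> \<open>The local coefficients \<open>g / q\<close> and \<open>h / q\<close> found at
    different points are the same rational functions. So \<open>f\<close>, defined by choosing a
    representation at every point separately, agrees on \<open>W v\<close> with the quotient
    belonging to \<open>v\<close>.\<close>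
  have unique: "g v * q w = g w * q v" "h v * q w = h w * q v" if v: "v \<in> U" and w: "w \<in> U" for v w
  proof -
    obtain x where x: "x \<in> W v \<inter> W w"
      using rep[OF v] rep[OF w] unfolding rep_def by (auto elim: zariski_open_meet)
    have o: "zariski_open (W v \<inter> W w)"
      using rep[OF v] rep[OF w] unfolding rep_def by (auto intro: zariski_open_Int)
    have z: "eval3 (g v * q w - g w * q v) y *s eval_vec \<theta>1 y + eval3 (h v * q w - h w * q v) y *s eval_vec \<theta>2 y = 0"
      if y: "y \<in> W v \<inter> W w" for y
    proof -
      have e: "eval3 (q v) y *s s y = eval3 (g v) y *s eval_vec \<theta>1 y + eval3 (h v) y *s eval_vec \<theta>2 y"
        "eval3 (q w) y *s s y = eval3 (g w) y *s eval_vec \<theta>1 y + eval3 (h w) y *s eval_vec \<theta>2 y"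
        using rep[OF v] rep[OF w] y unfolding rep_def by blast+
      have "eval3 (g v * q w - g w * q v) y *s eval_vec \<theta>1 y + eval3 (h v * q w - h w * q v) y *s eval_vec \<theta>2 y
        = eval3 (q w) y *s (eval3 (g v) y *s eval_vec \<theta>1 y + eval3 (h v) y *s eval_vec \<theta>2 y)
        - eval3 (q v) y *s (eval3 (g w) y *s eval_vec \<theta>1 y + eval3 (h w) y *s eval_vec \<theta>2 y)"
        by (simp add: vec_eq_iff algebra_simps)
      also have "\<dots> = 0" unfolding e[symmetric] by (simp add: vec_eq_iff)
      finally show ?thesis .
    qed
    from independent_on[OF o x z] show "g v * q w = g w * q v" "h v * q w = h w * q v" by auto
  qed
  define f :: "'a ^ 3 \<Rightarrow> 'a ^ 2" where "f v = (if v \<in> U then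
    vector [eval3 (g v) v / eval3 (q v) v, eval3 (h v) v / eval3 (q v) v] else 0)" for v
  have f: "f w $ 1 = eval3 (g v) w / eval3 (q v) w" "f w $ 2 = eval3 (h v) w / eval3 (q v) w"
    if v: "v \<in> U" and w: "w \<in> W v" for v w
  proof -
    have wU: "w \<in> U" using rep[OF v] w unfolding rep_def by blast
    have nz: "eval3 (q v) w \<noteq> 0" "eval3 (q w) w \<noteq> 0"
      using rep[OF v] rep[OF wU] w unfolding rep_def by blast+
    from unique[OF v wU] have "eval3 (g v * q w) w = eval3 (g w * q v) w"
      "eval3 (h v * q w) w = eval3 (h w * q v) w" by simp_all
    with nz wU show "f w $ 1 = eval3 (g v) w / eval3 (q v) w" "f w $ 2 = eval3 (h v) w / eval3 (q v) w"
      by (simp_all add: f_def frac_eq_eq)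
  qed
  have "f \<in> S U" unfolding O_sum_sections_iff[OF U]
  proof (intro conjI allI ballI impI)
    fix v assume v: "v \<in> U"
    note r = rep[OF v, unfolded rep_def]
    show "regular_at (- int a) (\<lambda>v. f v $ 1) v"
      by (rule regular_atI[of v "W v" "m v - a" "g v" "m v" "q v"]) (use r f[OF v] in auto)
    show "regular_at (- int b) (\<lambda>v. f v $ 2) v"
      by (rule regular_atI[of v "W v" "m v - b" "h v" "m v" "q v"]) (use r f[OF v] in auto)
  qed (simp add: f_def)
  moreover have "\<psi> f = s"
  proof
    fix v show "\<psi> f v = s v"
    proof (cases "v \<in> U")
      case False
      thus ?thesis using s unfolding derivation_sections_iff[OF U] by (simp add: \<psi>_def f_def)
    next
      case True
      note r = rep[OF True, unfolded rep_def]
      have nz: "eval3 (q v) v \<noteq> 0" using r by blast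
      have "eval3 (q v) v *s \<psi> f v = eval3 (g v) v *s eval_vec \<theta>1 v + eval3 (h v) v *s eval_vec \<theta>2 v"
        using nz True by (simp add: \<psi>_def f_def vec_eq_iff field_simps)
      also have "\<dots> = eval3 (q v) v *s s v" using r by simp
      finally show ?thesis using nz by simp
    qed
  qed
  ultimately show ?thesis by blast
qed

theorem free: "free_with_exponents F (int a) (int b)"
  unfolding free_with_exponents_def O_module_isomorphic_def
proof (intro exI conjI allI impI ballI)
  \<comment> \<open>For each required identity the right-hand side is shown to be a section whose
    image under \<open>\<psi>\<close> is the given one; injectivity of \<open>\<psi>\<close> then
    yields the identity.\<close>
  let ?\<phi> = "\<lambda>U. inv_into (S U) \<psi>"
  have bij: "bij_betw \<psi> (S U) (derivation_sections F U)" if "zariski_open U" for U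
    unfolding bij_betw_def using \<psi>_inj[OF that] \<psi>_in[OF that] \<psi>_surj[OF that] by blast
  have eq: "?\<phi> U s = f" if "zariski_open U" "f \<in> S U" "\<psi> f = s" for U s f
    using \<psi>_inj that by (metis inv_into_f_f)
  have \<phi>: "?\<phi> U s \<in> S U" "\<psi> (?\<phi> U s) = s" if "zariski_open U" "s \<in> derivation_sections F U" for U s
    using bij[OF that(1)] that(2) by (auto simp: bij_betw_def inv_into_into f_inv_into_f)
  fix U :: "('a ^ 3) set" assume U: "zariski_open U"
  show "bij_betw (?\<phi> U) (derivation_sections F U) (S U)"
    using bij[OF U] by (rule bij_betw_inv_into)
  {
    fix s t assume s: "s \<in> derivation_sections F U" and t: "t \<in> derivation_sections F U"
    show "?\<phi> U (\<lambda>v. s v + t v) = (\<lambda>v. ?\<phi> U s v + ?\<phi> U t v)"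
    proof (rule eq[OF U])
      show "(\<lambda>v. ?\<phi> U s v + ?\<phi> U t v) \<in> S U"
        using \<phi>(1)[OF U s] \<phi>(1)[OF U t] unfolding O_sum_sections_iff[OF U] by (auto intro: regular_at_add)
      have "\<psi> (\<lambda>v. ?\<phi> U s v + ?\<phi> U t v) = (\<lambda>v. \<psi> (?\<phi> U s) v + \<psi> (?\<phi> U t) v)"
        unfolding \<psi>_def by (simp add: fun_eq_iff vec_eq_iff algebra_simps)
      thus "\<psi> (\<lambda>v. ?\<phi> U s v + ?\<phi> U t v) = (\<lambda>v. s v + t v)"
        using \<phi>(2)[OF U s] \<phi>(2)[OF U t] by simp
    qed
  next
    fix f s assume f: "f \<in> O_sections 0 U" and s: "s \<in> derivation_sections F U"
    show "?\<phi> U (\<lambda>v. f v *s s v) = (\<lambda>v. f v *s ?\<phi> U s v)"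
    proof (rule eq[OF U])
      show "(\<lambda>v. f v *s ?\<phi> U s v) \<in> S U"
        using \<phi>(1)[OF U s] f regular_at_mult[of 0 f _ "- int a"] regular_at_mult[of 0 f _ "- int b"]
        unfolding O_sum_sections_iff[OF U] O_sections_iff[OF U] by auto
      have "\<psi> (\<lambda>v. f v *s ?\<phi> U s v) = (\<lambda>v. f v *s \<psi> (?\<phi> U s) v)"
        unfolding \<psi>_def by (simp add: fun_eq_iff vec_eq_iff algebra_simps)
      thus "\<psi> (\<lambda>v. f v *s ?\<phi> U s v) = (\<lambda>v. f v *s s v)"
        using \<phi>(2)[OF U s] by simp
    qed
  }
next
  let ?\<phi> = "\<lambda>U. inv_into (S U) \<psi>"
  fix U V' s
  assume "zariski_open U \<and> zariski_open V' \<and> V' \<subseteq> U" and s: "s \<in> derivation_sections F U"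
  hence U: "zariski_open U" and V': "zariski_open V'" "V' \<subseteq> U" by auto
  from \<psi>_surj[OF U s] obtain f where f: "f \<in> S U" "\<psi> f = s" by blast
  have "?\<phi> U s = f" using \<psi>_inj[OF U] f by (metis inv_into_f_f)
  moreover have "restrict_section V' f \<in> S V'"
    unfolding O_sum_sections_iff[OF V'(1)]
  proof (intro conjI allI ballI impI)
    fix v assume v: "v \<in> V'"
    have r: "regular_at (- int a) (\<lambda>v. f v $ 1) v" "regular_at (- int b) (\<lambda>v. f v $ 2) v"
      using f(1) v V' unfolding O_sum_sections_iff[OF U] by blast+
    show "regular_at (- int a) (\<lambda>v. restrict_section V' f v $ 1) v"
      by (rule regular_at_cong[OF r(1) V'(1) v]) (simp add: restrict_section_def)
    show "regular_at (- int b) (\<lambda>v. restrict_section V' f v $ 2) v"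
      by (rule regular_at_cong[OF r(2) V'(1) v]) (simp add: restrict_section_def)
  qed (simp add: restrict_section_def)
  moreover have "\<psi> (restrict_section V' f) = restrict_section V' s"
    unfolding f(2)[symmetric] by (simp add: fun_eq_iff \<psi>_def restrict_section_def)
  ultimately show "?\<phi> V' (restrict_section V' s) = restrict_section V' (?\<phi> U s)"
    using \<psi>_inj[OF V'(1)] by (metis inv_into_f_f)
qed

end

subsection \<open>Generators of a free derivation bundle\<close>

lemma derivation_restrict:
  fixes F :: "'a::field_char_0 poly3"
  assumes U: "zariski_open U" and V: "zariski_open V" "V \<subseteq> U" and s: "s \<in> derivation_sections F U"
  shows "restrict_section V s \<in> derivation_sections F V"
  unfolding derivation_sections_iff[OF V(1)]
proof (intro conjI allI ballI impI)
  fix v i assume v: "v \<in> V"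
  have "regular_at 0 (\<lambda>v. s v $ i) v" using s v V unfolding derivation_sections_iff[OF U] by blast
  thus "regular_at 0 (\<lambda>v. restrict_section V s v $ i) v"
    by (rule regular_at_cong[OF _ V(1) v]) (simp add: restrict_section_def)
next
  fix v
  show "dot3 (eval_vec (grad3 F) v) (restrict_section V s v) = 0"
    using s unfolding derivation_sections_iff[OF U] by (simp add: restrict_section_def dot3_def)
qed (simp add: restrict_section_def)

lemma derivation_smult:
  fixes F :: "'a::field_char_0 poly3"
  assumes U: "zariski_open U" and f: "f \<in> O_sections 0 U" and s: "s \<in> derivation_sections F U"
  shows "(\<lambda>v. f v *s s v) \<in> derivation_sections F U"
  using s f regular_at_mult[of 0 f _ 0] unfolding derivation_sections_iff[OF U] O_sections_iff[OF U]
  by (auto simp: dot3_linear)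

lemma derivation_add:
  fixes F :: "'a::field_char_0 poly3"
  assumes U: "zariski_open U" and s: "s \<in> derivation_sections F U" and t: "t \<in> derivation_sections F U"
  shows "(\<lambda>v. s v + t v) \<in> derivation_sections F U"
  using s t unfolding derivation_sections_iff[OF U]
  by (auto simp: dot3_linear intro: regular_at_add)

text \<open>On the chart \<open>x_i \<noteq> 0\<close> the summand O(-k) is generated by
  \<open>x_i powi (- k)\<close>. The corresponding derivation times \<open>x_i powi k\<close> does
  not depend on the chart, which gives a vector field of degree k on the whole cone.\<close>

lemma free_imp_generators:
  fixes F :: "'a::field_char_0 poly3"
  assumes free: "free_with_exponents F k l" and hom: "homogeneous3 n F"
  obtains \<theta> :: "2 \<Rightarrow> 'a ^ 3 \<Rightarrow> 'a ^ 3" where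
    "\<And>v i. v \<noteq> 0 \<Longrightarrow> regular_at k (\<lambda>w. \<theta> 1 w $ i) v"
    "\<And>v i. v \<noteq> 0 \<Longrightarrow> regular_at l (\<lambda>w. \<theta> 2 w $ i) v"
    "\<And>c v. v \<noteq> 0 \<Longrightarrow> dot3 (eval_vec (grad3 F) v) (\<theta> c v) = 0"
    "\<And>v. v \<noteq> 0 \<Longrightarrow> eval_vec (grad3 F) v \<noteq> 0 \<Longrightarrow> vprod (\<theta> 1 v) (\<theta> 2 v) \<noteq> 0"
proof -
  define x :: "2 \<Rightarrow> int" where "x c = (if c = 1 then k else l)" for c
  have x: "x 1 = k" "x 2 = l" by (simp_all add: x_def)
  define S :: "('a ^ 3) set \<Rightarrow> ('a ^ 3 \<Rightarrow> 'a ^ 2) set" where "S U = O_sum_sections (- k) (- l) U" for U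
  define D where "D i = {v :: 'a ^ 3. v $ i \<noteq> 0}" for i
  have D: "zariski_open (D i)" for i unfolding D_def by (rule zariski_open_coord)
  have S: "s \<in> S U \<longleftrightarrow> (\<forall>v. v \<notin> U \<longrightarrow> s v = 0) \<and> (\<forall>v\<in>U. \<forall>c. regular_at (- x c) (\<lambda>v. s v $ c) v)"
    if "zariski_open U" for s U
    unfolding S_def O_sum_sections_iff[OF that] by (auto simp: forall_2 x)
  obtain \<phi> where \<phi>: "\<forall>U. zariski_open U \<longrightarrow>
      bij_betw (\<phi> U) (derivation_sections F U) (S U) \<and>
      (\<forall>s\<in>derivation_sections F U. \<forall>t\<in>derivation_sections F U.
        \<phi> U (\<lambda>v. s v + t v) = (\<lambda>v. \<phi> U s v + \<phi> U t v)) \<and>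
      (\<forall>f\<in>O_sections 0 U. \<forall>s\<in>derivation_sections F U.
        \<phi> U (\<lambda>v. f v *s s v) = (\<lambda>v. f v *s \<phi> U s v))"
    "\<forall>U V. zariski_open U \<and> zariski_open V \<and> V \<subseteq> U \<longrightarrow>
      (\<forall>s\<in>derivation_sections F U. \<phi> V (restrict_section V s) = restrict_section V (\<phi> U s))"
    using free unfolding free_with_exponents_def O_module_isomorphic_def S_def[symmetric] by (elim exE conjE)
  have bij: "bij_betw (\<phi> U) (derivation_sections F U) (S U)" if "zariski_open U" for U
    using \<phi>(1) that by blast
  have add: "\<phi> U (\<lambda>v. s v + t v) = (\<lambda>v. \<phi> U s v + \<phi> U t v)"
    if "zariski_open U" "s \<in> derivation_sections F U" "t \<in> derivation_sections F U" for U s t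
    using \<phi>(1) that by blast
  have smult: "\<phi> U (\<lambda>v. f v *s s v) = (\<lambda>v. f v *s \<phi> U s v)"
    if "zariski_open U" "f \<in> O_sections 0 U" "s \<in> derivation_sections F U" for U f s
    using \<phi>(1) that by blast
  have restr: "\<phi> V (restrict_section V s) = restrict_section V (\<phi> U s)"
    if "zariski_open U" "zariski_open V" "V \<subseteq> U" "s \<in> derivation_sections F U" for U V s
    using \<phi>(2) that by blast
  define e :: "2 \<Rightarrow> 3 \<Rightarrow> 'a ^ 3 \<Rightarrow> 'a ^ 2" where
    "e c i v = (if v $ i \<noteq> 0 then axis c ((v $ i) powi (- x c)) else 0)" for c i v
  have e: "e c i \<in> S (D i)" for c i
    unfolding S[OF D]
  proof (intro conjI ballI allI impI)
    fix v c' assume v: "v \<in> D i"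
    hence "v \<noteq> 0" by (auto simp: D_def)
    show "regular_at (- x c') (\<lambda>v. e c i v $ c') v"
    proof (cases "c' = c")
      case True
      have "regular_at (- x c) (\<lambda>v. (v $ i) powi (- x c)) v"
        by (rule regular_at_powi) (use v in \<open>simp add: D_def\<close>)
      thus ?thesis unfolding True
        by (rule regular_at_cong[OF _ D v]) (simp add: e_def D_def)
    next
      case False
      have "regular_at (- x c') (\<lambda>v. 0 * (v $ i) powi (- x c')) v"
        by (rule regular_at_cmult[OF regular_at_powi \<open>v \<noteq> 0\<close>]) (use v in \<open>simp add: D_def\<close>)
      thus ?thesis
        by (rule regular_at_cong[OF _ D v]) (use False in \<open>simp add: e_def D_def axis_def\<close>)
    qed
  qed (simp add: D_def e_def)
  define \<sigma> where "\<sigma> c i = inv_into (derivation_sections F (D i)) (\<phi> (D i)) (e c i)" for c i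
  have \<sigma>: "\<sigma> c i \<in> derivation_sections F (D i)" "\<phi> (D i) (\<sigma> c i) = e c i" for c i
    using bij[OF D, of i] e[of c i] unfolding \<sigma>_def
    by (auto simp: bij_betw_def inv_into_into f_inv_into_f)
  have glue: "(v $ i) powi x c *s \<sigma> c i v = (v $ j) powi x c *s \<sigma> c j v"
    if v: "v $ i \<noteq> 0" "v $ j \<noteq> 0" for v c i j
  proof -
    define W where "W = D i \<inter> D j"
    have W: "zariski_open W" "W \<subseteq> D i" "W \<subseteq> D j" "v \<in> W"
      using v D by (auto simp: W_def D_def zariski_open_Int[OF D D, unfolded D_def])
    \<comment> \<open>The transition function of degree 0 that takes \<open>e c j\<close> to
      \<open>e c i\<close> on the overlap.\<close>
    define f where "f v = (if v \<in> W then (v $ j) powi x c * (v $ i) powi (- x c) else 0)" for v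
    have f: "f \<in> O_sections 0 W" unfolding O_sections_iff[OF W(1)]
    proof (intro conjI ballI allI impI)
      fix v assume v: "v \<in> W"
      have "regular_at (x c + - x c) (\<lambda>v. (v $ j) powi x c * (v $ i) powi (- x c)) v"
        by (intro regular_at_mult regular_at_powi) (use v in \<open>auto simp: W_def D_def\<close>)
      hence "regular_at 0 (\<lambda>v. (v $ j) powi x c * (v $ i) powi (- x c)) v" by simp
      thus "regular_at 0 f v" by (rule regular_at_cong[OF _ W(1) v]) (simp add: f_def)
    qed (simp add: f_def)
    note r = derivation_restrict[OF D W(1,2) \<sigma>(1)] derivation_restrict[OF D W(1,3) \<sigma>(1)]
    have "\<phi> W (\<lambda>v. f v *s restrict_section W (\<sigma> c j) v) = (\<lambda>v. f v *s restrict_section W (e c j) v)"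
      using smult[OF W(1) f r(2)] restr[OF D W(1,3) \<sigma>(1)] by (simp add: \<sigma>(2))
    also have "\<dots> = restrict_section W (e c i)"
      by (auto simp: fun_eq_iff restrict_section_def e_def f_def vec_eq_iff axis_def W_def D_def power_int_minus)
    also have "\<dots> = \<phi> W (restrict_section W (\<sigma> c i))"
      using restr[OF D W(1,2) \<sigma>(1)] by (simp add: \<sigma>(2))
    finally have "(\<lambda>v. f v *s restrict_section W (\<sigma> c j) v) = restrict_section W (\<sigma> c i)"
      using bij[OF W(1)] derivation_smult[OF W(1) f r(2)] r(1) by (auto simp: bij_betw_def dest: inj_onD)
    from fun_cong[OF this, of v] have "((v $ j) powi x c * (v $ i) powi (- x c)) *s \<sigma> c j v = \<sigma> c i v"
      using W(4) by (simp add: restrict_section_def f_def)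
    thus ?thesis using v by (auto simp: vec_eq_iff power_int_minus field_simps)
  qed
  define \<theta> where "\<theta> c v = (let i = (SOME i. v $ i \<noteq> 0) in (v $ i) powi x c *s \<sigma> c i v)" for c v
  have \<theta>: "\<theta> c v = (v $ i) powi x c *s \<sigma> c i v" if "v $ i \<noteq> 0" for c v i
    unfolding \<theta>_def Let_def by (rule glue[OF someI[of "\<lambda>i. v $ i \<noteq> 0", OF that] that])
  have reg: "regular_at (x c) (\<lambda>w. \<theta> c w $ a) v" if v: "v \<noteq> 0" for c a v
  proof -
    obtain i where i: "v $ i \<noteq> 0" using v by (auto simp: vec_eq_iff)
    hence vD: "v \<in> D i" by (simp add: D_def)
    have "regular_at 0 (\<lambda>w. \<sigma> c i w $ a) v"
      using \<sigma>(1)[of c i] vD unfolding derivation_sections_iff[OF D] by blast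
    from regular_at_mult[OF regular_at_powi[OF i, of "x c"] this]
    have "regular_at (x c) (\<lambda>w. (w $ i) powi x c * \<sigma> c i w $ a) v" by simp
    thus ?thesis by (rule regular_at_cong[OF _ D vD]) (simp add: \<theta> D_def)
  qed
  have tang: "dot3 (eval_vec (grad3 F) v) (\<theta> c v) = 0" if v: "v \<noteq> 0" for c v
  proof -
    obtain i where i: "v $ i \<noteq> 0" using v by (auto simp: vec_eq_iff)
    show ?thesis
      using \<sigma>(1)[of c i] unfolding derivation_sections_iff[OF D] \<theta>[OF i] by (simp add: dot3_linear)
  qed
  \<comment> \<open>Fibrewise surjectivity: \<open>h\<close> holds the coefficients of the image of
    \<open>s\<close> with respect to the local generators \<open>e c i\<close>.\<close>
  have span: "\<exists>\<alpha> \<beta>. s v = \<alpha> *s \<theta> 1 v + \<beta> *s \<theta> 2 v"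
    if i: "v $ i \<noteq> 0" and s: "s \<in> derivation_sections F (D i)" for s v i
  proof -
    define f where "f = \<phi> (D i) s"
    have f: "f \<in> S (D i)" using bij[OF D, of i] s by (auto simp: f_def bij_betw_def)
    define h where "h c v = (if v \<in> D i then f v $ c * (v $ i) powi x c else 0)" for c v
    have h: "h c \<in> O_sections 0 (D i)" for c unfolding O_sections_iff[OF D]
    proof (intro conjI ballI allI impI)
      fix v assume v: "v \<in> D i"
      have "regular_at (- x c) (\<lambda>v. f v $ c) v" using f v unfolding S[OF D] by blast
      moreover have "regular_at (x c) (\<lambda>v. (v $ i) powi x c) v"
        by (rule regular_at_powi) (use v in \<open>simp add: D_def\<close>)
      ultimately have "regular_at (- x c + x c) (\<lambda>v. f v $ c * (v $ i) powi x c) v"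
        by (rule regular_at_mult)
      hence "regular_at 0 (\<lambda>v. f v $ c * (v $ i) powi x c) v" by simp
      thus "regular_at 0 (h c) v" by (rule regular_at_cong[OF _ D v]) (simp add: h_def)
    qed (simp add: h_def)
    have m: "(\<lambda>v. h c v *s \<sigma> c i v) \<in> derivation_sections F (D i)" for c
      by (rule derivation_smult[OF D h \<sigma>(1)])
    have "\<phi> (D i) (\<lambda>v. h 1 v *s \<sigma> 1 i v + h 2 v *s \<sigma> 2 i v) = (\<lambda>v. h 1 v *s e 1 i v + h 2 v *s e 2 i v)"
      unfolding add[OF D m m] smult[OF D h \<sigma>(1)] \<sigma>(2) ..
    also have "\<dots> = f"
    proof
      fix w
      show "h 1 w *s e 1 i w + h 2 w *s e 2 i w = f w"
      proof (cases "w \<in> D i")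
        case True
        thus ?thesis by (simp add: h_def e_def D_def vec_eq_iff forall_2 axis_def power_int_minus)
      next
        case False
        moreover have "f w = 0" using f False unfolding S[OF D] by blast
        ultimately show ?thesis by (simp add: h_def)
      qed
    qed
    finally have "\<phi> (D i) (\<lambda>v. h 1 v *s \<sigma> 1 i v + h 2 v *s \<sigma> 2 i v) = \<phi> (D i) s" by (simp add: f_def)
    hence e: "(\<lambda>v. h 1 v *s \<sigma> 1 i v + h 2 v *s \<sigma> 2 i v) = s"
      by (rule inj_onD[OF bij_betw_imp_inj_on[OF bij[OF D]] _ derivation_add[OF D m m] s])
    have "s v = (h 1 v * (v $ i) powi (- x 1)) *s \<theta> 1 v + (h 2 v * (v $ i) powi (- x 2)) *s \<theta> 2 v"
      unfolding e[symmetric] \<theta>[OF i] using i by (simp add: vec_eq_iff power_int_minus field_simps)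
    thus ?thesis by blast
  qed
  have basis: "vprod (\<theta> 1 v) (\<theta> 2 v) \<noteq> 0"
    if v: "v \<noteq> 0" and g: "eval_vec (grad3 F) v \<noteq> 0" for v
  proof
    assume z: "vprod (\<theta> 1 v) (\<theta> 2 v) = 0"
    obtain i where i: "v $ i \<noteq> 0" using v by (auto simp: vec_eq_iff)
    define m where "m = int (n - 1)"
    \<comment> \<open>Test sections: the cross product of the gradient with a constant vector
      \<open>u\<close>, brought to degree 0. Two of them have at \<open>v\<close> a cross product
      that is a multiple of the gradient by the determinant of g, u, u'. If the generators were
      parallel at \<open>v\<close>, so would be all sections, and the gradient would vanish.\<close>
    define s where "s u w = (if w \<in> D i then (w $ i) powi (- m) *s vprod (eval_vec (grad3 F) w) u else 0)"
      for u w
    have s: "s u \<in> derivation_sections F (D i)" for u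
      unfolding derivation_sections_iff[OF D]
    proof (intro conjI ballI allI impI)
      fix v j assume v: "v \<in> D i"
      hence v0: "v \<noteq> 0" by (auto simp: D_def)
      have p: "regular_at m (\<lambda>v. eval3 (partial3 j F) v) v" for j
        using regular_at_poly[OF homogeneous3_partial3[OF hom] v0] by (simp add: m_def)
      have pc: "regular_at m (\<lambda>w. eval3 (partial3 j F) w * c) v" for j c
        using regular_at_cmult[OF p v0, of c j] by (simp only: mult.commute)
      have "\<forall>j. regular_at m (\<lambda>w. vprod (eval_vec (grad3 F) w) u $ j) v"
        unfolding forall_3 using regular_at_diff[OF pc pc v0] by simp
      hence "regular_at (- m + m) (\<lambda>w. (w $ i) powi (- m) * vprod (eval_vec (grad3 F) w) u $ j) v"
        by (intro regular_at_mult regular_at_powi) (use v in \<open>auto simp: D_def\<close>)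
      hence "regular_at 0 (\<lambda>w. (w $ i) powi (- m) * vprod (eval_vec (grad3 F) w) u $ j) v" by simp
      thus "regular_at 0 (\<lambda>w. s u w $ j) v"
        by (rule regular_at_cong[OF _ D v]) (simp add: s_def)
    next
      fix w show "dot3 (eval_vec (grad3 F) w) (s u w) = 0"
        by (simp add: s_def dot3_linear)
    qed (simp add: s_def)
    define g where "g = eval_vec (grad3 F) v"
    have "vprod (s u v) (s u' v) = 0" for u u'
    proof -
      obtain \<alpha> \<beta> \<alpha>' \<beta>' where "s u v = \<alpha> *s \<theta> 1 v + \<beta> *s \<theta> 2 v" "s u' v = \<alpha>' *s \<theta> 1 v + \<beta>' *s \<theta> 2 v"
        using span[OF i s] by metis
      moreover have "vprod (\<alpha> *s p + \<beta> *s q) (\<alpha>' *s p + \<beta>' *s q) = (\<alpha> * \<beta>' - \<alpha>' * \<beta>) *s vprod p q"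
        for p q :: "'a ^ 3" by (simp add: vec3_eq_iff algebra_simps)
      ultimately show ?thesis using z by simp
    qed
    moreover have "vprod (s u v) (s u' v) = ((v $ i) powi (- m) * (v $ i) powi (- m)) *s (dot3 g (vprod u u') *s g)"
      for u u'
    proof -
      have "vprod (vprod g u) (vprod g u') = dot3 g (vprod u u') *s g"
        by (simp add: vec3_eq_iff dot3_def algebra_simps)
      thus ?thesis using i by (simp add: s_def D_def vprod_smult g_def)
    qed
    ultimately have o: "dot3 g (vprod u u') = 0" for u u'
      using g i by (simp add: g_def)
    have "g $ 1 = 0" "g $ 2 = 0" "g $ 3 = 0"
      using o[of "vector [0, 1, 0]" "vector [0, 0, 1]"] o[of "vector [0, 0, 1]" "vector [1, 0, 0]"]
        o[of "vector [1, 0, 0]" "vector [0, 1, 0]"] by (simp_all add: dot3_def)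
    hence "g = 0" by (simp add: vec3_eq_iff)
    thus False using g by (simp add: g_def)
  qed
  show ?thesis
    by (rule that[of \<theta>]) (use reg[of _ 1] reg[of _ 2] tang basis in \<open>simp_all add: x\<close>)
qed

subsection \<open>A criterion for non-freeness\<close>

lemma exists_nonroot:
  fixes P :: "'b \<Rightarrow> 'a::{idom, ring_char_0} poly"
  assumes "finite A" "\<And>x. x \<in> A \<Longrightarrow> P x \<noteq> 0"
  obtains t where "\<And>x. x \<in> A \<Longrightarrow> poly (P x) t \<noteq> 0"
proof -
  have "prod P A \<noteq> 0" using assms by simp
  then obtain t where "poly (prod P A) t \<noteq> 0" using poly_all_0_iff_0 by blast
  thus ?thesis using assms(1) that by (auto simp: poly_prod)
qed

text \<open>The plane is the cone over a projective line, and the lines in \<open>B\<close> cut it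
  in more than \<open>k\<close> distinct points. With \<open>B\<close> empty this says that a
  section of negative degree vanishes. The normalisation \<open>m $ 1 = 1\<close> provides the
  explicit basis \<open>u\<close>, \<open>w\<close> of the plane.\<close>

lemma regular_zeros_on_plane:
  fixes m :: "'a::{alg_closed_field, field_char_0} ^ 3"
  assumes m: "m $ 1 = 1" and reg: "\<And>v. dot3 m v = 0 \<Longrightarrow> v \<noteq> 0 \<Longrightarrow> regular_at k f v"
    and B: "finite B" "k < int (card B)"
    and distinct: "\<And>b b'. b \<in> B \<Longrightarrow> b' \<in> B \<Longrightarrow> b \<noteq> b' \<Longrightarrow> dot3 m (vprod b b') \<noteq> 0"
    and zero: "\<And>b v. b \<in> B \<Longrightarrow> v \<noteq> 0 \<Longrightarrow> dot3 m v = 0 \<Longrightarrow> dot3 b v = 0 \<Longrightarrow> f v = 0"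
    and v: "dot3 m v = 0" "v \<noteq> 0"
  shows "f v = 0"
proof -
  define u w :: "'a ^ 3" where "u = vector [- m $ 2, 1, 0]" and "w = vector [- m $ 3, 0, 1]"
  have mu: "dot3 m (u + t *s w) = 0" "dot3 m (w + t *s u) = 0" "dot3 m u = 0" "dot3 m w = 0" for t
    using m by (simp_all add: u_def w_def dot3_def algebra_simps)
  have nz: "u + t *s w \<noteq> 0" "w + t *s u \<noteq> 0" "u \<noteq> 0" "w \<noteq> 0" for t
    by (simp_all add: u_def w_def vec3_eq_iff)
  \<comment> \<open>The line of \<open>b\<close> meets the plane in \<open>u + t *s w\<close> with
    \<open>t = num b / den b\<close>, or in \<open>w\<close> if \<open>den b = 0\<close>. By
    \<open>det\<close> different lines give different t, and at most one of them passes through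
    \<open>w\<close>.\<close>
  define den num where "den b = dot3 b w" and "num b = - dot3 b u" for b
  have det: "num b * den b' - num b' * den b = - dot3 m (vprod b b')" for b b'
    unfolding den_def num_def u_def w_def dot3_def using m by (simp add: algebra_simps)
  define B0 where "B0 = {b \<in> B. den b = 0}"
  define T where "T = (\<lambda>b. num b / den b) ` (B - B0)"
  have inj: "inj_on (\<lambda>b. num b / den b) (B - B0)"
  proof (rule inj_onI, rule ccontr)
    fix b b' assume b: "b \<in> B - B0" "b' \<in> B - B0" "num b / den b = num b' / den b'" "b \<noteq> b'"
    hence "num b * den b' - num b' * den b = 0" by (simp add: B0_def frac_eq_eq)
    thus False using distinct[of b b'] b unfolding det by auto
  qed
  have B0: "card B0 \<le> 1"
  proof -
    have "finite B0" using B(1) by (simp add: B0_def)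
    moreover have "b = b'" if "b \<in> B0" "b' \<in> B0" for b b'
      using distinct[of b b'] det[of b b'] that by (auto simp: B0_def)
    ultimately show ?thesis using card_le_Suc0_iff_eq by (metis One_nat_def)
  qed
  have T: "f (u + t *s w) = 0" if t: "t \<in> T" for t
  proof -
    obtain b where b: "b \<in> B" "den b \<noteq> 0" "t = num b / den b" using t by (auto simp: T_def B0_def)
    have "dot3 b (u + t *s w) = 0" using b(2) unfolding b(3) dot3_linear by (simp add: den_def num_def)
    thus ?thesis using zero[OF b(1)] nz mu by blast
  qed
  have fw: "f w = 0" if "B0 \<noteq> {}"
    using that zero[of _ w] nz mu unfolding B0_def den_def by blast
  have cardT: "int (card T) + (if f w = 0 then 1 else 0) > k"
  proof -
    have "card B = card (B - B0) + card B0"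
      using B(1) by (metis (no_types, lifting) B0_def add.commute card_Int_Diff inf.absorb_iff2 mem_Collect_eq subsetI)
    moreover have "card T = card (B - B0)" unfolding T_def using inj by (rule card_image)
    moreover have "B0 = {} \<Longrightarrow> card B0 = 0" by simp
    ultimately show ?thesis using B0 B(2) fw by (cases "B0 = {}") auto
  qed
  have finT: "finite T" using B(1) by (simp add: T_def)
  have 1: "f (u + t *s w) = 0" for t
    by (rule regular_zeros_on_line[OF reg[OF mu(1) nz(1)] reg[OF mu(4) nz(4)] finT T cardT])
  \<comment> \<open>The first parametrisation never reaches \<open>w\<close>. With \<open>u\<close>
    and \<open>w\<close> exchanged, all nonzero parameters give multiples of points already treated,
    and \<open>w\<close> has parameter 0.\<close>
  have 2: "f w = 0"
  proof -
    have "infinite (- {0 :: 'a})" by (simp add: infinite_UNIV_char_0 Compl_eq_Diff_UNIV)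
    then obtain T' :: "'a set" where T': "finite T'" "card T' = nat k + 1" "T' \<subseteq> - {0}"
      using infinite_arbitrarily_large by blast
    have "f (w + t *s u) = 0" if "t \<in> T'" for t
    proof -
      have "t \<noteq> 0" using that T' by auto
      hence e: "w + t *s u = t *s (u + inverse t *s w)" by (simp add: vec_eq_iff field_simps)
      show ?thesis unfolding e
        by (rule regular_at_zero_scale[OF reg[OF mu(1) nz(1)] 1 \<open>t \<noteq> 0\<close>])
    qed
    hence "f (w + 0 *s u) = 0"
      by (rule regular_zeros_on_line[OF reg[OF mu(2) nz(2)] reg[OF mu(3) nz(3)] T'(1)])
        (simp_all add: T'(2))
    thus ?thesis by simp
  qed
  have v1: "v $ 1 = - (m $ 2 * v $ 2) - m $ 3 * v $ 3"
    using m v(1) by (simp add: dot3_def algebra_simps eq_neg_iff_add_eq_0)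
  show ?thesis
  proof (cases "v $ 2 = 0")
    case True
    hence e: "v = v $ 3 *s w" using v1 by (simp add: w_def vec3_eq_iff)
    hence "v $ 3 \<noteq> 0" using v(2) by auto
    have "f (v $ 3 *s w) = 0"
      by (rule regular_at_zero_scale[OF reg[OF mu(4) nz(4)] 2 \<open>v $ 3 \<noteq> 0\<close>])
    thus ?thesis unfolding e[symmetric] .
  next
    case False
    have e: "v = v $ 2 *s (u + (v $ 3 / v $ 2) *s w)"
      using v1 False by (simp add: u_def w_def vec3_eq_iff field_simps)
    have "f (v $ 2 *s (u + (v $ 3 / v $ 2) *s w)) = 0"
      by (rule regular_at_zero_scale[OF reg[OF mu(1) nz(1)] 1 False])
    thus ?thesis unfolding e[symmetric] .
  qed
qed

section \<open>Lines that avoid the singular points of the arrangement\<close>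

context line_arrangement
begin

lemma eval_F: "eval3 F v = (\<Prod>a\<in>V. dot3 a v)"
  by (simp add: F_def)

lemma grad_on_line:
  assumes "a \<in> V" "dot3 a v = 0"
  shows "eval_vec (grad3 F) v = (\<Prod>b\<in>V - {a}. dot3 b v) *s a"
  using assms by (simp add: vec_eq_iff partial_F_factor mult.commute)

text \<open>At a point on a single line the gradient is a nonzero multiple of the normal vector. At
  a point on no line, Euler's formula would make \<open>F\<close> vanish together with its
  gradient.\<close>

lemma grad_nonzero_if_smooth:
  assumes v: "v \<noteq> 0" and smooth: "\<And>a b. a \<in> V \<Longrightarrow> b \<in> V \<Longrightarrow> a \<noteq> b \<Longrightarrow> dot3 a v = 0 \<Longrightarrow> dot3 b v \<noteq> 0"
  shows "eval_vec (grad3 F) v \<noteq> 0"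
proof (cases "\<exists>a\<in>V. dot3 a v = 0")
  case True
  then obtain a where a: "a \<in> V" "dot3 a v = 0" by blast
  have "(\<Prod>b\<in>V - {a}. dot3 b v) \<noteq> 0" using fin smooth a by auto
  thus ?thesis using nonzero[OF a(1)] grad_on_line[OF a] by auto
next
  case False
  hence "eval3 F v \<noteq> 0" using fin by (auto simp: eval_F)
  moreover have "dot3 v (eval_vec (grad3 F) v) = of_nat (card V) * eval3 F v"
    using arg_cong[OF euler_F, of "\<lambda>p. eval3 p v"] by (simp flip: Const3_of_nat)
  ultimately show ?thesis using card_nonzero by (metis dot3_zero(1) mult_eq_0_iff)
qed

text \<open>On the curve (1, c, c^2) each pair of lines excludes only the roots of one nonzero
  polynomial. The line with normal \<open>m\<close> then misses every intersection point
  \<open>vprod a b\<close>.\<close>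

lemma exists_generic:
  obtains m where "m $ 1 = 1" "\<And>a b. a \<in> V \<Longrightarrow> b \<in> V \<Longrightarrow> a \<noteq> b \<Longrightarrow> dot3 m (vprod a b) \<noteq> 0"
proof -
  define A where "A = {(a, b). a \<in> V \<and> b \<in> V \<and> a \<noteq> b}"
  have A: "finite A" by (rule finite_subset[of _ "V \<times> V"]) (use fin in \<open>auto simp: A_def\<close>)
  define P :: "('a ^ 3) \<times> ('a ^ 3) \<Rightarrow> 'a poly" where "P = (\<lambda>(a, b). [:vprod a b $ 1, vprod a b $ 2, vprod a b $ 3:])"
  have "P x \<noteq> 0" if "x \<in> A" for x
    using that indep[of "fst x" "snd x"] by (auto simp: P_def A_def vec3_eq_iff)
  from exists_nonroot[OF A, where P = P, OF this] obtain c where c: "\<And>x. x \<in> A \<Longrightarrow> poly (P x) c \<noteq> 0" by blast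
  show ?thesis
  proof (rule that[of "vector [1, c, c\<^sup>2]"])
    fix a b assume "a \<in> V" "b \<in> V" "a \<noteq> b"
    hence "poly (P (a, b)) c \<noteq> 0" by (intro c) (simp add: A_def)
    thus "dot3 (vector [1, c, c\<^sup>2]) (vprod a b) \<noteq> 0"
      by (simp add: P_def dot3_def power2_eq_square algebra_simps)
  qed simp
qed

lemma generic_line_smooth:
  assumes m: "\<And>a b. a \<in> V \<Longrightarrow> b \<in> V \<Longrightarrow> a \<noteq> b \<Longrightarrow> dot3 m (vprod a b) \<noteq> 0"
    and v: "v \<noteq> 0" "dot3 m v = 0"
  shows "eval_vec (grad3 F) v \<noteq> 0"
proof (rule grad_nonzero_if_smooth[OF v(1)])
  fix a b assume ab: "a \<in> V" "b \<in> V" "a \<noteq> b" "dot3 a v = 0"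
  show "dot3 b v \<noteq> 0"
  proof
    assume "dot3 b v = 0"
    hence "vprod v (vprod a b) = 0" using ab by (intro vprod_orthogonal) (simp_all add: dot3_commute)
    then obtain c where "vprod a b = c *s v" using v(1) by (rule parallel_imp_scalar)
    thus False using m[OF ab(1-3)] v(2) by (simp add: dot3_linear)
  qed
qed

end

locale free_line_arrangement = line_arrangement V
  for V :: "('a::{alg_closed_field, field_char_0} ^ 3) set" +
  fixes k l :: int and \<theta> :: "2 \<Rightarrow> 'a ^ 3 \<Rightarrow> 'a ^ 3"
  assumes two_lines: "card V \<ge> 2"
    and reg1: "\<And>v i. v \<noteq> 0 \<Longrightarrow> regular_at k (\<lambda>w. \<theta> 1 w $ i) v"
    and reg2: "\<And>v i. v \<noteq> 0 \<Longrightarrow> regular_at l (\<lambda>w. \<theta> 2 w $ i) v"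
    and tang: "\<And>c v. v \<noteq> 0 \<Longrightarrow> dot3 (eval_vec (grad3 F) v) (\<theta> c v) = 0"
    and basis: "\<And>v. v \<noteq> 0 \<Longrightarrow> eval_vec (grad3 F) v \<noteq> 0 \<Longrightarrow> vprod (\<theta> 1 v) (\<theta> 2 v) \<noteq> 0"
begin

text \<open>On a line missing the singular points, \<open>\<nabla>F\<close> is a nowhere vanishing multiple of
  \<open>\<theta>\<^sub>1 \<times> \<theta>\<^sub>2\<close>, and the multiplier is a section of \<open>\<O>(deg F - 1 - k - l)\<close>.\<close>

lemma exponents_le: "k + l \<le> int (card V) - 1"
proof (rule ccontr)
  assume neg: "\<not> ?thesis"
  obtain m where m: "m $ 1 = 1" "\<And>a b. a \<in> V \<Longrightarrow> b \<in> V \<Longrightarrow> a \<noteq> b \<Longrightarrow> dot3 m (vprod a b) \<noteq> 0"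
    by (rule exists_generic) (rule that)
  define n where "n v = vprod (\<theta> 1 v) (\<theta> 2 v)" for v
  define g where "g = eval_vec (grad3 F)"
  \<comment> \<open>The multiplier is chosen pointwise. It is regular because near a point with
    \<open>n v $ i\<close> nonzero it equals \<open>g v $ i / n v $ i\<close>.\<close>
  define r where "r v = (SOME r. g v = r *s n v)" for v
  have r: "g v = r v *s n v" if v: "v \<noteq> 0" "n v \<noteq> 0" for v
  proof -
    have t: "dot3 (\<theta> c v) (g v) = 0" for c using tang[OF v(1)] by (simp add: g_def dot3_commute)
    have "vprod (n v) (g v) = 0"
      using v(2) unfolding n_def by (rule orthogonal_imp_parallel) (simp_all add: t)
    hence "\<exists>r. g v = r *s n v" using v(2) by (metis parallel_imp_scalar)
    thus ?thesis unfolding r_def by (rule someI_ex)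
  qed
  have reg: "regular_at (int (card V) - 1 - (k + l)) r v" if v: "v \<noteq> 0" "n v \<noteq> 0" for v
  proof -
    obtain i where i: "n v $ i \<noteq> 0" using v(2) by (auto simp: vec_eq_iff)
    have "\<forall>i. regular_at (k + l) (\<lambda>w. n w $ i) v"
      unfolding forall_3 n_def vprod_nth
      by (intro conjI regular_at_diff regular_at_mult reg1 reg2 v(1))
    hence n: "regular_at (k + l) (\<lambda>w. n w $ i) v" by blast
    obtain U where U: "zariski_open U" "v \<in> U" "\<And>w. w \<in> U \<Longrightarrow> n w $ i \<noteq> 0"
      by (rule regular_at_nonzero_nbhd[OF n i]) (rule that)
    have "regular_at (int (card V - 1)) (\<lambda>w. g w $ i) v"
      using regular_at_poly[OF homogeneous_grad v(1), of i] by (simp add: g_def)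
    from regular_at_mult[OF this regular_at_inverse[OF n i]]
    have "regular_at (int (card V - 1) + - (k + l)) (\<lambda>w. g w $ i * (1 / n w $ i)) v" .
    moreover have "int (card V - 1) + - (k + l) = int (card V) - 1 - (k + l)" using two_lines by simp
    ultimately have "regular_at (int (card V) - 1 - (k + l)) (\<lambda>w. g w $ i * (1 / n w $ i)) v" by (simp only:)
    thus ?thesis
    proof (rule regular_at_cong[OF _ U(1,2)])
      fix w assume w: "w \<in> U"
      have "g w $ i = r w * n w $ i"
        using r[of w] U(3)[OF w] zariski_open_nonzero[OF U(1) w] by (metis vector_smult_component zero_index)
      thus "r w = g w $ i * (1 / n w $ i)" using U(3)[OF w] by simp
    qed
  qed
  have smooth: "v \<noteq> 0 \<and> n v \<noteq> 0 \<and> g v \<noteq> 0" if "dot3 m v = 0" "v \<noteq> 0" for v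
    using generic_line_smooth[OF m(2) that(2,1)] basis[OF that(2)] that(2) by (simp add: n_def g_def)
  define v :: "'a ^ 3" where "v = vector [- m $ 2, 1, 0]"
  have v: "dot3 m v = 0" "v \<noteq> 0" using m(1) by (simp_all add: v_def dot3_def vec3_eq_iff)
  \<comment> \<open>The degree of \<open>r\<close> is negative, hence below the cardinality of the
    empty set of prescribed crossing lines.\<close>
  have "r v = 0"
    by (rule regular_zeros_on_plane[OF m(1), of "int (card V) - 1 - (k + l)" r "{}"])
      (use reg smooth neg v in auto)
  thus False using r[of v] smooth[OF v] by simp
qed

text \<open>Where no other line passes, the gradient is a nonzero multiple of \<open>a\<close>, so
  the claim is tangency there. These are all but finitely many points of the line, and the section
  \<open>dot3 a (\<theta> c v)\<close> has only boundedly many zeros unless it vanishes on the whole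
  line.\<close>

lemma tangent_at_all_points:
  assumes reg: "\<And>v i. v \<noteq> 0 \<Longrightarrow> regular_at x (\<lambda>w. \<theta> c w $ i) v"
    and a: "a \<in> V" and v: "v \<noteq> 0" "dot3 a v = 0"
  shows "dot3 a (\<theta> c v) = 0"
proof -
  define G where "G = prod lin (V - {a})"
  have hG: "homogeneous3 (card (V - {a})) G"
    unfolding G_def using fin by (intro homogeneous3_prod homogeneous3_lin) auto
  have smooth: "dot3 a (\<theta> c w) = 0" if w: "w \<noteq> 0" "dot3 a w = 0" "eval3 G w \<noteq> 0" for w
    using tang[OF w(1), of c] w(3) unfolding grad_on_line[OF a w(2)] by (auto simp: dot3_linear G_def)
  obtain m where m: "m $ 1 = 1" "\<And>a b. a \<in> V \<Longrightarrow> b \<in> V \<Longrightarrow> a \<noteq> b \<Longrightarrow> dot3 m (vprod a b) \<noteq> 0"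
    by (rule exists_generic) (rule that)
  \<comment> \<open>The intersection with a generic line: a point of the line of \<open>a\<close>
    that lies on no other line of the arrangement. It serves as the point at infinity.\<close>
  define z where "z = vprod a m"
  have az: "dot3 a z = 0" by (simp add: z_def)
  have "dot3 b z \<noteq> 0" if "b \<in> V" "b \<noteq> a" for b
    using m(2)[OF that(1) a that(2)] by (simp add: z_def dot3_vprod_swap[of b a m])
  hence Gz: "eval3 G z \<noteq> 0" using fin by (auto simp: G_def)
  have z0: "z \<noteq> 0"
  proof
    assume z: "z = 0"
    obtain b where "b \<in> V" "b \<noteq> a"
      using two_lines a by (metis card_le_Suc0_iff_eq fin not_less_eq_eq numeral_2_eq_2)
    with \<open>\<And>b. b \<in> V \<Longrightarrow> b \<noteq> a \<Longrightarrow> dot3 b z \<noteq> 0\<close> z show False by (simp add: dot3_def)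
  qed
  show ?thesis
  proof (cases "vprod z v = 0")
    case True
    then obtain c' where c': "v = c' *s z" using z0 by (rule parallel_imp_scalar)
    hence "c' \<noteq> 0" using v by auto
    hence "eval3 G v \<noteq> 0" using Gz unfolding c' by (simp add: homogeneous3_eval_scale[OF hG])
    thus ?thesis using smooth v by blast
  next
    case False
    have nz: "v + t *s z \<noteq> 0" for t
    proof
      assume "v + t *s z = 0"
      hence "vprod z (v + t *s z) = 0" by (simp add: vec3_eq_iff)
      moreover have "vprod z (v + t *s z) = vprod z v" by (simp add: vec3_eq_iff algebra_simps)
      ultimately show False using False by simp
    qed
    have r: "regular_at x (\<lambda>w. dot3 a (\<theta> c w)) w" if "w \<noteq> 0" for w
      unfolding dot3_def by (intro regular_at_add regular_at_cmult reg that)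
    obtain P where P: "coeff P (card (V - {a})) = eval3 G z" "\<And>t. poly P t = eval3 G (v + t *s z)"
      using homogeneous3_line_poly[OF hG] by metis
    have "P \<noteq> 0" using P(1) Gz by auto
    hence "infinite (- {t. poly P t = 0})"
      using poly_roots_finite[of P] unfolding Compl_eq_Diff_UNIV
      by (intro Diff_infinite_finite) (auto simp: infinite_UNIV_char_0)
    then obtain T where T: "finite T" "card T = nat x + 1" "T \<subseteq> - {t. poly P t = 0}"
      using infinite_arbitrarily_large by blast
    have "dot3 a (\<theta> c (v + t *s z)) = 0" if "t \<in> T" for t
    proof (rule smooth[OF nz])
      show "dot3 a (v + t *s z) = 0" using v az by (simp add: dot3_linear)
      show "eval3 G (v + t *s z) \<noteq> 0" using that T(3) P(2) by auto
    qed
    hence "dot3 a (\<theta> c (v + 0 *s z)) = 0"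
      by (rule regular_zeros_on_line[OF r[OF nz] r[OF z0] T(1)]) (simp_all add: T(2))
    thus ?thesis by simp
  qed
qed

text \<open>\<open>B a\<close> represents points on the line of \<open>a\<close> by other lines
  through them, one line for each point. The number \<open>r\<close> bounds both the points on each
  line and the lines in \<open>A\<close>, since zeros are counted twice: along each line of
  \<open>A\<close>, and then along a line that crosses all of them.\<close>

lemma exponent_ge:
  assumes reg: "\<And>v i. v \<noteq> 0 \<Longrightarrow> regular_at x (\<lambda>w. \<theta> c w $ i) v"
    and A: "A \<subseteq> V" "\<And>a. a \<in> A \<Longrightarrow> a $ 1 = 1" "r \<le> card A"
    and B: "\<And>a. a \<in> A \<Longrightarrow> B a \<subseteq> V - {a}" "\<And>a. a \<in> A \<Longrightarrow> r \<le> card (B a)"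
      "\<And>a b b'. a \<in> A \<Longrightarrow> b \<in> B a \<Longrightarrow> b' \<in> B a \<Longrightarrow> b \<noteq> b' \<Longrightarrow> dot3 a (vprod b b') \<noteq> 0"
  shows "int r \<le> x + 1"
proof (rule ccontr)
  assume "\<not> ?thesis"
  hence x: "x + 1 < int r" by simp
  have finA: "finite A" using A(1) fin finite_subset by blast
  have rad: "regular_at (x + 1) (\<lambda>w. vprod (\<theta> c w) w $ i) v" if v: "v \<noteq> 0" for v i
  proof -
    have "\<forall>i. regular_at (x + 1) (\<lambda>w. vprod (\<theta> c w) w $ i) v"
      unfolding forall_3 vprod_nth
      by (intro conjI regular_at_diff regular_at_mult reg regular_at_nth v)
    thus ?thesis by blast
  qed
  have double: "vprod (\<theta> c v) v = 0"
    if ab: "a \<in> V" "b \<in> V" "a \<noteq> b" and v: "v \<noteq> 0" "dot3 a v = 0" "dot3 b v = 0" for a b v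
    using indep[OF ab] by (rule orthogonal_imp_parallel)
      (use tangent_at_all_points[OF reg] ab v in auto)
  have on_A: "vprod (\<theta> c v) v = 0" if a: "a \<in> A" and v: "v \<noteq> 0" "dot3 a v = 0" for a v
  proof -
    have "vprod (\<theta> c v) v $ i = 0" for i
    proof (rule regular_zeros_on_plane[OF A(2)[OF a] rad _ _ B(3)[OF a] _ v(2,1)])
      show "finite (B a)" using B(1)[OF a] fin finite_subset by blast
      show "x + 1 < int (card (B a))" using B(2)[OF a] x by linarith
      fix b v assume b: "b \<in> B a" and v: "v \<noteq> 0" "dot3 a v = 0" "dot3 b v = 0"
      have "vprod (\<theta> c v) v = 0" by (rule double[OF _ _ _ v]) (use a b A(1) B(1)[OF a] in auto)
      thus "vprod (\<theta> c v) v $ i = 0" by simp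
    qed
    thus ?thesis by (simp add: vec_eq_iff)
  qed
  \<comment> \<open>Vanishing of \<open>vprod (\<theta> c v) v\<close> along one generic line is
    enough, because that line contains a point off the arrangement where \<open>basis\<close> can be
    contradicted.\<close>
  obtain m where m: "m $ 1 = 1" "\<And>a b. a \<in> V \<Longrightarrow> b \<in> V \<Longrightarrow> a \<noteq> b \<Longrightarrow> dot3 m (vprod a b) \<noteq> 0"
    by (rule exists_generic) (rule that)
  have on_m: "vprod (\<theta> c v) v = 0" if v: "v \<noteq> 0" "dot3 m v = 0" for v
  proof -
    have "vprod (\<theta> c v) v $ i = 0" for i
    proof (rule regular_zeros_on_plane[OF m(1) rad finA _ _ _ v(2,1)])
      show "x + 1 < int (card A)" using A(3) x by linarith
      fix b b' assume "b \<in> A" "b' \<in> A" "b \<noteq> b'"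
      thus "dot3 m (vprod b b') \<noteq> 0" using A(1) by (intro m(2)) auto
    next
      fix b v assume "b \<in> A" "v \<noteq> 0" "dot3 b v = 0"
      thus "vprod (\<theta> c v) v $ i = 0" using on_A by simp
    qed
    thus ?thesis by (simp add: vec_eq_iff)
  qed
  define u w :: "'a ^ 3" where "u = vector [- m $ 2, 1, 0]" and "w = vector [- m $ 3, 0, 1]"
  \<comment> \<open>Otherwise \<open>b\<close> would be a multiple of \<open>m\<close>, and the
    generic line would pass through the intersection of \<open>b\<close> with a second line.\<close>
  have "[:dot3 b u, dot3 b w:] \<noteq> 0" if b: "b \<in> V" for b
  proof
    assume "[:dot3 b u, dot3 b w:] = 0"
    hence bm: "b $ 2 = b $ 1 * m $ 2" "b $ 3 = b $ 1 * m $ 3"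
      by (simp_all add: u_def w_def dot3_def)
    obtain b' where b': "b' \<in> V" "b' \<noteq> b"
      using two_lines b by (metis card_le_Suc0_iff_eq fin not_less_eq_eq numeral_2_eq_2)
    have "dot3 m (vprod b b') = 0" using bm m(1) by (simp add: dot3_def algebra_simps)
    with m(2)[OF b b'(1)] b'(2) show False by simp
  qed
  from exists_nonroot[OF fin, of "\<lambda>b. [:dot3 b u, dot3 b w:]", OF this] obtain t where
    t: "\<And>b. b \<in> V \<Longrightarrow> poly [:dot3 b u, dot3 b w:] t \<noteq> 0" by blast
  define v where "v = u + t *s w"
  have v: "v \<noteq> 0" "dot3 m v = 0" using m(1) by (simp_all add: v_def u_def w_def dot3_def vec3_eq_iff)
  have Fv: "eval3 F v \<noteq> 0" using t fin by (auto simp: eval_F v_def dot3_linear)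
  have "vprod v (\<theta> c v) = 0" using on_m[OF v] by (simp add: vec3_eq_iff mult.commute)
  then obtain y where lam: "\<theta> c v = y *s v" using v(1) by (rule parallel_imp_scalar)
  \<comment> \<open>With \<open>\<theta> c v = y *s v\<close>, tangency says that y times Euler's
    expression is zero, and that expression is nonzero off the arrangement.\<close>
  have "dot3 (eval_vec (grad3 F) v) v = of_nat (card V) * eval3 F v"
    using arg_cong[OF euler_F, of "\<lambda>p. eval3 p v"] by (simp add: dot3_commute flip: Const3_of_nat)
  hence "y * (of_nat (card V) * eval3 F v) = 0"
    using tang[OF v(1), of c] unfolding lam by (simp add: dot3_linear)
  hence "y = 0" using Fv card_nonzero by simp
  hence "\<theta> c v = 0" using lam by simp
  hence "vprod (\<theta> 1 v) (\<theta> 2 v) = 0" using exhaust_2[of c] by (auto simp: vec3_eq_iff)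
  thus False using basis[OF v(1) generic_line_smooth[OF m(2) v]] by simp
qed

end


text \<open>\<open>exponent_ge\<close> applies to both generators, so the exponents have sum at
  least \<open>2 * r - 2\<close>, which exceeds the bound \<open>card V - 1\<close> of
  \<open>exponents_le\<close>.\<close>

theorem not_free_if_many_points:
  fixes V :: "('a::{alg_closed_field, field_char_0} ^ 3) set"
  assumes "line_arrangement V"
    and A: "A \<subseteq> V" "\<And>a. a \<in> A \<Longrightarrow> a $ 1 = 1" "r \<le> card A"
    and B: "\<And>a. a \<in> A \<Longrightarrow> B a \<subseteq> V - {a}" "\<And>a. a \<in> A \<Longrightarrow> r \<le> card (B a)"
      "\<And>a b b'. a \<in> A \<Longrightarrow> b \<in> B a \<Longrightarrow> b' \<in> B a \<Longrightarrow> b \<noteq> b' \<Longrightarrow> dot3 a (vprod b b') \<noteq> 0"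
    and r: "2 \<le> card V" "card V + 1 < 2 * r"
  shows "\<not> free_arrangement (line_arrangement.F V)"
proof
  interpret line_arrangement V by fact
  assume "free_arrangement F"
  then obtain k l where free: "free_with_exponents F k l" by (auto simp: free_arrangement_def)
  obtain \<theta> :: "2 \<Rightarrow> 'a ^ 3 \<Rightarrow> 'a ^ 3" where \<theta>:
    "\<And>v i. v \<noteq> 0 \<Longrightarrow> regular_at k (\<lambda>w. \<theta> 1 w $ i) v"
    "\<And>v i. v \<noteq> 0 \<Longrightarrow> regular_at l (\<lambda>w. \<theta> 2 w $ i) v"
    "\<And>c v. v \<noteq> 0 \<Longrightarrow> dot3 (eval_vec (grad3 F) v) (\<theta> c v) = 0"
    "\<And>v. v \<noteq> 0 \<Longrightarrow> eval_vec (grad3 F) v \<noteq> 0 \<Longrightarrow> vprod (\<theta> 1 v) (\<theta> 2 v) \<noteq> 0"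
    by (rule free_imp_generators[OF free homogeneous_F]) (rule that)
  interpret free_line_arrangement V k l \<theta>
    by unfold_locales (rule r(1) \<theta>; assumption?)+
  have "int r \<le> k + 1" using reg1 A B by (rule exponent_ge)
  moreover have "int r \<le> l + 1" using reg2 A B by (rule exponent_ge)
  ultimately show False using exponents_le r(2) by linarith
qed

subsection \<open>Roots of unity\<close>

text \<open>Rational coefficients can be evaluated in every field of characteristic zero, so
  relations can be moved from K to the complex numbers and back.\<close>

definition rat_eval :: "rat poly \<Rightarrow> 'a::field_char_0 \<Rightarrow> 'a" where
  "rat_eval p x = poly (map_poly of_rat p) x"

lemma rat_eval_simps [simp]:
  "rat_eval (p + q) x = rat_eval p x + rat_eval q x" "rat_eval (p - q) x = rat_eval p x - rat_eval q x"
  "rat_eval (p * q) x = rat_eval p x * rat_eval q x" "rat_eval (monom 1 n) x = x ^ n"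
  "rat_eval 0 x = 0" "rat_eval [:c:] x = of_rat c" "rat_eval 1 x = 1"
proof -
  have "map_poly of_rat (p + q) = (map_poly of_rat p + map_poly of_rat q :: 'a poly)"
    by (rule poly_eqI) (simp add: coeff_map_poly of_rat_add)
  thus "rat_eval (p + q) x = rat_eval p x + rat_eval q x" by (simp add: rat_eval_def)
  have "map_poly of_rat (p - q) = (map_poly of_rat p - map_poly of_rat q :: 'a poly)"
    by (rule poly_eqI) (simp add: coeff_map_poly of_rat_diff)
  thus "rat_eval (p - q) x = rat_eval p x - rat_eval q x" by (simp add: rat_eval_def)
  have "map_poly of_rat (p * q) = (map_poly of_rat p * map_poly of_rat q :: 'a poly)"
    by (rule poly_eqI) (simp add: coeff_map_poly coeff_mult of_rat_sum of_rat_mult)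
  thus "rat_eval (p * q) x = rat_eval p x * rat_eval q x" by (simp add: rat_eval_def)
  show "rat_eval (monom 1 n) x = x ^ n" by (simp add: rat_eval_def map_poly_monom poly_monom)
qed (simp_all add: rat_eval_def map_poly_pCons)

lemma rat_eval_pCons: "rat_eval (pCons c p) x = of_rat c + x * rat_eval p x"
  by (simp add: rat_eval_def map_poly_pCons)

lemma minimal_polynomial:
  fixes x :: "'a::field_char_0"
  assumes "p0 \<noteq> 0" "rat_eval p0 x = 0"
  obtains \<mu> where "\<mu> \<noteq> 0" "\<And>p. rat_eval p x = 0 \<longleftrightarrow> \<mu> dvd p"
proof -
  have "p0 \<noteq> 0 \<and> rat_eval p0 x = 0" using assms by blast
  from ex_has_least_nat[of "\<lambda>p. p \<noteq> 0 \<and> rat_eval p x = 0", OF this, of degree]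
  obtain \<mu> where \<mu>: "\<mu> \<noteq> 0" "rat_eval \<mu> x = 0"
    and min: "\<And>p. p \<noteq> 0 \<Longrightarrow> rat_eval p x = 0 \<Longrightarrow> degree \<mu> \<le> degree p" by blast
  have 1: "\<mu> dvd p" if "rat_eval p x = 0" for p
  proof -
    have "rat_eval (p mod \<mu>) x = rat_eval (p - p div \<mu> * \<mu>) x" by (simp only: minus_div_mult_eq_mod)
    also have "\<dots> = 0" using that \<mu>(2) by simp
    finally have "p mod \<mu> = 0" using min[of "p mod \<mu>"] degree_mod_less[OF \<mu>(1), of p] by linarith
    thus ?thesis by (simp add: dvd_eq_mod_eq_0)
  qed
  have 2: "rat_eval p x = 0" if "\<mu> dvd p" for p
  proof -
    from that obtain q where "p = \<mu> * q" ..
    thus ?thesis by (simp add: \<mu>(2))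
  qed
  show ?thesis by (rule that[OF \<mu>(1)]) (rule iffI; erule 1 2)
qed

text \<open>A rational relation satisfied by a root of unity \<open>e\<close> also holds for a complex root \<open>z\<close> of its
  minimal polynomial; there it can be conjugated, and \<open>cnj z = 1 / z\<close>.\<close>

lemma rat_eval_inverse_root_of_unity:
  fixes e :: "'a::field_char_0"
  assumes e: "e ^ d = 1" "d > 0" and p: "rat_eval p e = 0"
  shows "rat_eval p (inverse e) = 0"
proof -
  define q :: "rat poly" where "q = monom 1 d - 1"
  have "coeff q d = 1" using e(2) by (simp add: q_def)
  hence q: "q \<noteq> 0" by auto
  have qe: "rat_eval q e = 0" using e by (simp add: q_def)
  obtain \<mu> where \<mu>: "\<mu> \<noteq> 0" "\<And>p. rat_eval p e = 0 \<longleftrightarrow> \<mu> dvd p"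
    by (rule minimal_polynomial[OF q qe]) (rule that)
  have mu_e: "rat_eval \<mu> e = 0" by (simp add: \<mu>)
  have deg: "degree (map_poly of_rat \<mu> :: complex poly) = degree \<mu>"
    by (intro degree_map_poly) simp
  have "degree \<mu> \<noteq> 0"
  proof
    assume "degree \<mu> = 0"
    then obtain c where "\<mu> = [:c:]" by (rule degree_eq_zeroE)
    with mu_e \<mu>(1) show False by simp
  qed
  then obtain z :: complex where z: "rat_eval \<mu> z = 0"
    using alg_closed_imp_poly_has_root[of "map_poly of_rat \<mu> :: complex poly"] deg
    by (auto simp: rat_eval_def)
  have dvd_z: "rat_eval p z = 0" if "\<mu> dvd p" for p
  proof -
    from that obtain r where "p = \<mu> * r" ..
    thus ?thesis by (simp add: z)
  qed
  have "rat_eval q z = 0" using dvd_z \<mu>(2) qe by blast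
  hence zd: "z ^ d = 1" by (simp add: q_def)
  hence "norm z ^ d = 1" by (metis norm_one norm_power)
  hence "norm z = 1" using e(2) power_eq_1_iff by fastforce
  hence "z * cnj z = 1" by (simp add: complex_norm_square[symmetric])
  hence cnj: "cnj z = z ^ (d - 1)"
    using zd e(2) by (metis (no_types, lifting) mult.assoc mult.commute mult.right_neutral power_minus_mult)
  \<comment> \<open>For the way back, the minimal polynomial \<open>\<nu>\<close> of
    \<open>z\<close> must be divisible by \<open>\<mu>\<close>. One of the factors of
    \<open>\<mu> = \<nu> * \<tau>\<close> vanishes at \<open>e\<close>; if it is
    \<open>\<tau>\<close>, degrees force \<open>\<nu>\<close> to be constant, contradicting its root
    \<open>z\<close>.\<close>
  obtain \<nu> where \<nu>: "\<nu> \<noteq> 0" "\<And>p. rat_eval p z = 0 \<longleftrightarrow> \<nu> dvd p"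
    by (rule minimal_polynomial[OF \<mu>(1) z]) (rule that)
  have "\<nu> dvd \<mu>" using z \<nu> by blast
  then obtain \<tau> where \<tau>: "\<mu> = \<nu> * \<tau>" by (elim dvdE)
  have nz: "\<tau> \<noteq> 0" using \<mu>(1) \<tau> by auto
  have d\<tau>: "degree \<mu> = degree \<nu> + degree \<tau>" unfolding \<tau> using \<nu>(1) nz by (rule degree_mult_eq)
  have "rat_eval \<nu> e * rat_eval \<tau> e = 0" using mu_e \<tau> by simp
  hence "\<mu> dvd \<nu>"
  proof (cases "rat_eval \<nu> e = 0")
    case False
    hence "\<mu> dvd \<tau>" using \<open>rat_eval \<nu> e * rat_eval \<tau> e = 0\<close> \<mu>(2) by simp
    hence "degree \<nu> = 0" using d\<tau> dvd_imp_degree_le[OF _ nz] by fastforce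
    then obtain c where c: "\<nu> = [:c:]" by (rule degree_eq_zeroE)
    have "rat_eval \<nu> z = 0" using \<nu>(2) by simp
    with c \<nu>(1) show ?thesis by simp
  qed (use \<mu>(2) in blast)
  hence dvd_e: "rat_eval p e = 0" if "rat_eval p z = 0" for p
    using that \<mu>(2) \<nu>(2) dvd_trans by blast
  \<comment> \<open>Substituting X^(d-1) expresses inversion by a rational polynomial, so that the
    conjugated relation at \<open>z\<close> can be carried back to \<open>e\<close>.\<close>
  define p' where "p' = pcompose p (monom 1 (d - 1))"
  have p': "rat_eval p' x = rat_eval p (x ^ (d - 1))" for x :: "'b::field_char_0"
    unfolding p'_def by (induction p rule: pCons_induct) (simp_all add: pcompose_pCons rat_eval_pCons)
  have "rat_eval p z = 0" using p \<mu>(2) dvd_z by blast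
  hence "rat_eval p (cnj z) = 0"
  proof -
    have "cnj (of_rat r) = of_rat r" for r by (cases r) (simp add: of_rat_rat)
    hence "map_poly cnj (map_poly of_rat p) = map_poly of_rat p"
      by (intro poly_eqI) (simp add: coeff_map_poly)
    hence "cnj (rat_eval p z) = rat_eval p (cnj z)" by (simp add: rat_eval_def poly_cnj)
    thus ?thesis using \<open>rat_eval p z = 0\<close> by simp
  qed
  hence "rat_eval p' z = 0" unfolding p' cnj .
  hence "rat_eval p' e = 0" by (rule dvd_e)
  moreover have "e ^ (d - 1) = inverse e"
  proof -
    have "e * e ^ (d - 1) = 1" using e by (metis power_eq_if less_numeral_extra(3))
    thus ?thesis by (metis inverse_unique)
  qed
  ultimately show ?thesis unfolding p' by simp
qed

text \<open>Comparing the equation with its inverted form gives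
  \<open>\<rho>' * \<sigma> = \<rho> * \<sigma>'\<close>, and then
  \<open>\<rho> + \<sigma>' = \<rho>' + \<sigma>\<close>. The pairs \<open>\<rho>, \<sigma>'\<close>
  and \<open>\<rho>', \<sigma>\<close> have the same sum and product, so they agree up to order, and
  \<open>\<rho> \<noteq> \<sigma>\<close> fixes the order.\<close>

lemma root_of_unity_ratio_inj:
  fixes e :: "'a::field_char_0"
  assumes e: "e ^ d = 1" "d > 0"
    and powers: "\<rho> = e ^ i" "\<sigma> = e ^ j" "\<rho>' = e ^ i'" "\<sigma>' = e ^ j'"
    and eq: "(\<rho> - 1) * (\<sigma>' - 1) = (\<rho>' - 1) * (\<sigma> - 1)"
    and ne: "\<rho> \<noteq> \<sigma>" "\<rho> \<noteq> 1" "\<sigma>' \<noteq> 1"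
  shows "\<rho>' = \<rho> \<and> \<sigma>' = \<sigma>"
proof -
  define p :: "rat poly" where
    "p = (monom 1 i - 1) * (monom 1 j' - 1) - (monom 1 i' - 1) * (monom 1 j - 1)"
  have "rat_eval p e = 0" using eq unfolding p_def powers by simp
  from rat_eval_inverse_root_of_unity[OF e this]
  have inv: "(inverse \<rho> - 1) * (inverse \<sigma>' - 1) = (inverse \<rho>' - 1) * (inverse \<sigma> - 1)"
    unfolding p_def powers by (simp add: power_inverse)
  have "e \<noteq> 0" using e by (metis power_0_left less_numeral_extra(3) zero_neq_one)
  hence nz: "\<rho> \<noteq> 0" "\<sigma> \<noteq> 0" "\<rho>' \<noteq> 0" "\<sigma>' \<noteq> 0" unfolding powers by simp_all
  have "(\<rho> - 1) * (\<sigma>' - 1) * (\<rho>' * \<sigma>) = (\<rho>' - 1) * (\<sigma> - 1) * (\<rho> * \<sigma>')"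
    using inv nz by (simp add: field_simps)
  hence "(\<rho> - 1) * (\<sigma>' - 1) * (\<rho>' * \<sigma> - \<rho> * \<sigma>') = 0"
    unfolding eq[symmetric] by (simp add: algebra_simps)
  hence prod: "\<rho>' * \<sigma> = \<rho> * \<sigma>'" using ne by simp
  have "(\<rho> - \<rho>') * (\<rho> - \<sigma>) = 0" using eq prod by algebra
  hence "\<rho>' = \<rho>" using ne by simp
  thus ?thesis using prod nz by simp
qed

subsection \<open>The arrangements\<close>

lemma (in line_arrangement) inj_line_of_form: "inj_on (\<lambda>a. line_of_form (lin a)) V"
proof (rule inj_onI, rule ccontr)
  fix a b assume ab: "a \<in> V" "b \<in> V" "line_of_form (lin a) = line_of_form (lin b)" "a \<noteq> b"
  have "vprod b a = 0"
  proof (rule dot3_all_eq_0)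
    fix u
    have "dot3 b (vprod a u) = 0"
    proof (cases "vprod a u = 0")
      case False
      hence "vprod a u \<in> line_of_form (lin b)" unfolding ab(3)[symmetric] by (simp add: line_of_form_def)
      thus ?thesis by (simp add: line_of_form_def)
    qed simp
    thus "dot3 u (vprod b a) = 0" by (simp only: dot3_vprod_swap[of b a u])
  qed
  thus False using indep ab by metis
qed

section \<open>Normal vectors of the lines of H_d\<close>

locale primitive_root =
  fixes d :: nat and e :: "'a::field_char_0"
  assumes primitive: "primitive_root_of_one d e"
begin

lemma d_pos: "d > 0" and e_d: "e ^ d = 1"
  using primitive by (auto simp: primitive_root_of_one_def)

lemma e_nonzero: "e \<noteq> 0"
  using e_d d_pos by (metis power_0_left less_numeral_extra(3) zero_neq_one)

definition U :: "'a set" where "U = (\<lambda>i. e ^ i) ` {..<d}"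

lemma inj_powers: "inj_on (\<lambda>i. e ^ i) {..<d}"
proof (rule linorder_inj_onI')
  fix i j assume ij: "i \<in> {..<d}" "j \<in> {..<d}" "i < j"
  show "e ^ i \<noteq> e ^ j"
  proof
    assume "e ^ i = e ^ j"
    also have "\<dots> = e ^ i * e ^ (j - i)" using ij by (simp flip: power_add)
    finally have "e ^ (j - i) = 1" using e_nonzero by simp
    moreover have "0 < j - i" "j - i < d" using ij by auto
    ultimately show False using primitive unfolding primitive_root_of_one_def by blast
  qed
qed

lemma finite_U [simp]: "finite U" and card_U: "card U = d"
  unfolding U_def using card_image[OF inj_powers] by simp_all

lemma U_iff: "x \<in> U \<longleftrightarrow> (\<exists>n. x = e ^ n)"
proof
  assume "\<exists>n. x = e ^ n"
  then obtain n where "x = e ^ n" ..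
  also have "e ^ n = e ^ (d * (n div d) + n mod d)" by simp
  also have "\<dots> = e ^ (n mod d)" unfolding power_add power_mult e_d by simp
  finally show "x \<in> U" using d_pos by (auto simp: U_def)
qed (auto simp: U_def)

lemma U_mult: "x \<in> U \<Longrightarrow> y \<in> U \<Longrightarrow> x * y \<in> U"
  unfolding U_iff by (metis power_add)

lemma U_inverse: "x \<in> U \<Longrightarrow> inverse x \<in> U"
proof -
  assume "x \<in> U"
  then obtain n where x: "x = e ^ n" by (auto simp: U_iff)
  have "x * e ^ (n * (d - 1)) = (e ^ d) ^ n"
    unfolding x using d_pos by (simp flip: power_add power_mult add: algebra_simps)
  hence "x * e ^ (n * (d - 1)) = 1" by (simp add: e_d)
  hence "inverse x = e ^ (n * (d - 1))" by (rule inverse_unique)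
  thus ?thesis by (auto simp: U_iff)
qed

lemma U_divide: "x \<in> U \<Longrightarrow> y \<in> U \<Longrightarrow> x / y \<in> U"
  unfolding divide_inverse by (intro U_mult U_inverse)

lemma U_nonzero: "x \<in> U \<Longrightarrow> x \<noteq> 0"
  using e_nonzero by (auto simp: U_def)

definition E :: "('a ^ 3) set" where
  "E = {vector [1, 0, 0], vector [0, 1, 0], vector [0, 0, 1]}"

definition A :: "('a ^ 3) set" where
  "A = (\<lambda>(s, t). vector [1, s, t]) ` (U \<times> U)"

definition V :: "('a ^ 3) set" where "V = E \<union> A"

lemma A_iff: "a \<in> A \<longleftrightarrow> a $ 1 = 1 \<and> a $ 2 \<in> U \<and> a $ 3 \<in> U"
proof
  assume "a $ 1 = 1 \<and> a $ 2 \<in> U \<and> a $ 3 \<in> U"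
  hence "(a $ 2, a $ 3) \<in> U \<times> U" "a = (\<lambda>(s, t). vector [1, s, t]) (a $ 2, a $ 3)"
    by (simp_all add: vec3_eq_iff)
  thus "a \<in> A" unfolding A_def by blast
qed (auto simp: A_def)

lemma inj_A: "inj_on (\<lambda>(s, t). vector [1, s, t] :: 'a ^ 3) (U \<times> U)"
  by (auto simp: inj_on_def vec3_eq_iff)

lemma finite_E [simp]: "finite E" and card_E: "card E = 3"
  by (simp_all add: E_def vec3_eq_iff)

lemma finite_A [simp]: "finite A" and card_A: "card A = d\<^sup>2"
  unfolding A_def using card_image[OF inj_A] by (simp_all add: card_cartesian_product card_U power2_eq_square)

lemma disjoint_E_A: "E \<inter> A = {}"
  using U_nonzero by (auto simp: E_def A_iff)

lemma card_V: "card V = d\<^sup>2 + 3"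
  unfolding V_def by (subst card_Un_disjoint) (simp_all add: disjoint_E_A card_A card_E)

sublocale line_arrangement V
proof
  show "finite V" "V \<noteq> {}" by (simp_all add: V_def E_def)
  show "a \<noteq> 0" if "a \<in> V" for a
    using that by (auto simp: V_def E_def A_iff vec3_eq_iff)
  show "vprod a b \<noteq> 0" if "a \<in> V" "b \<in> V" "a \<noteq> b" for a b
    using that U_nonzero by (auto simp: V_def E_def A_iff vec3_eq_iff)
qed

lemma lin_E: "lin (vector [1, 0, 0]) = X3" "lin (vector [0, 1, 0]) = Y3" "lin (vector [0, 0, 1]) = Z3"
  by (simp_all add: lin_def)

lemma lin_A: "lin (vector [1, e ^ i, e ^ j]) = L_form e i j"
  by (simp add: lin_def L_form_def)

lemma H_polynomial_eq: "H_polynomial d e = F"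
proof -
  have "prod lin A = (\<Prod>(s, t)\<in>U \<times> U. lin (vector [1, s, t]))"
    unfolding A_def by (subst prod.reindex[OF inj_A]) (simp add: case_prod_unfold)
  also have "\<dots> = (\<Prod>s\<in>U. \<Prod>t\<in>U. lin (vector [1, s, t]))"
    by (rule prod.cartesian_product[symmetric])
  also have "\<dots> = (\<Prod>i<d. \<Prod>j<d. L_form e i j)"
    unfolding U_def by (simp add: prod.reindex[OF inj_powers] lin_A)
  finally have "prod lin A = (\<Prod>i<d. \<Prod>j<d. L_form e i j)" .
  moreover have "prod lin E = X3 * Y3 * Z3"
    by (simp add: E_def vec3_eq_iff lin_E mult.assoc)
  moreover have "F = prod lin E * prod lin A"
    unfolding F_def unfolding V_def by (rule prod.union_disjoint) (simp_all add: disjoint_E_A)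
  ultimately show ?thesis by (simp add: H_polynomial_def)
qed

lemma card_H_arrangement: "card (H_arrangement d e) = d\<^sup>2 + 3"
proof -
  have "{L_form e i j |i j. i < d \<and> j < d} = lin ` A"
    by (force simp: A_def U_def lin_A)
  moreover have "{X3, Y3, Z3} = lin ` E" by (simp add: E_def lin_E)
  ultimately have "H_arrangement d e = (\<lambda>a. line_of_form (lin a)) ` V"
    unfolding H_arrangement_def V_def by (simp add: image_Un image_image)
  thus ?thesis using card_image[OF inj_line_of_form] card_V by simp
qed

text \<open>The three conditions say that no coordinate of \<open>vprod a b\<close> is zero: the
  lines of \<open>a\<close> and \<open>b\<close> meet outside xyz = 0.\<close>

definition nodes :: "'a ^ 3 \<Rightarrow> ('a ^ 3) set" where
  "nodes a = {b \<in> A. b $ 2 \<noteq> a $ 2 \<and> b $ 3 \<noteq> a $ 3 \<and> b $ 2 * a $ 3 \<noteq> b $ 3 * a $ 2}"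

lemma card_nodes:
  assumes a: "a \<in> A"
  shows "(d - 1) * (d - 2) \<le> card (nodes a)"
proof -
  \<comment> \<open>There are d - 1 choices of s, and then d - 2 of t: the two excluded values of t
    differ because s is not \<open>a $ 2\<close>.\<close>
  define I where "I = Sigma (U - {a $ 2}) (\<lambda>s. U - {a $ 3, s * a $ 3 / a $ 2})"
  have aU: "a $ 2 \<in> U" "a $ 3 \<in> U" using a by (auto simp: A_iff)
  have "(\<lambda>(s, t). vector [1, s, t]) ` I \<subseteq> nodes a"
    using aU U_nonzero by (auto simp: I_def nodes_def A_iff field_simps)
  moreover have "inj_on (\<lambda>(s, t). vector [1, s, t] :: 'a ^ 3) I"
    by (rule inj_on_subset[OF inj_A]) (auto simp: I_def)
  ultimately have "card I \<le> card (nodes a)"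
    by (metis (no_types, lifting) card_image card_mono finite_A finite_subset mem_Collect_eq nodes_def subsetI)
  moreover have "card I = (d - 1) * (d - 2)"
  proof -
    have "card (U - {a $ 3, s * a $ 3 / a $ 2}) = d - 2" if s: "s \<in> U - {a $ 2}" for s
    proof -
      have "a $ 3 \<noteq> s * a $ 3 / a $ 2" using s U_nonzero[OF aU(1)] U_nonzero[OF aU(2)] by (auto simp: field_simps)
      moreover have "s * a $ 3 / a $ 2 \<in> U" using s aU by (intro U_divide U_mult) auto
      ultimately show ?thesis using aU by (subst card_Diff_subset) (auto simp: card_U)
    qed
    thus ?thesis unfolding I_def using aU by (subst card_SigmaI) (auto simp: card_U)
  qed
  ultimately show ?thesis by simp
qed

text \<open>The determinant of \<open>a\<close>, \<open>b\<close>, \<open>b'\<close> vanishes when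
  the three lines concur. Dividing by the coordinates of \<open>a\<close> replaces \<open>a\<close>
  by (1, 1, 1) and turns this into the equation of \<open>root_of_unity_ratio_inj\<close>. The
  definition of \<open>nodes\<close> excludes its degenerate cases.\<close>

lemma nodes_distinct:
  assumes a: "a \<in> A" and b: "b \<in> nodes a" "b' \<in> nodes a" "b \<noteq> b'"
  shows "dot3 a (vprod b b') \<noteq> 0"
proof
  assume z: "dot3 a (vprod b b') = 0"
  have U: "a $ 2 \<in> U" "a $ 3 \<in> U" "b $ 2 \<in> U" "b $ 3 \<in> U" "b' $ 2 \<in> U" "b' $ 3 \<in> U"
    and one: "a $ 1 = 1" "b $ 1 = 1" "b' $ 1 = 1"
    using a b by (auto simp: nodes_def A_iff)
  have nz: "a $ 2 \<noteq> 0" "a $ 3 \<noteq> 0" using U U_nonzero by blast+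
  define \<rho> \<sigma> \<rho>' \<sigma>' where "\<rho> = b' $ 3 / a $ 3" and "\<sigma> = b' $ 2 / a $ 2"
    and "\<rho>' = b $ 3 / a $ 3" and "\<sigma>' = b $ 2 / a $ 2"
  have "\<rho> \<in> U" "\<sigma> \<in> U" "\<rho>' \<in> U" "\<sigma>' \<in> U"
    unfolding \<rho>_def \<sigma>_def \<rho>'_def \<sigma>'_def by (intro U_divide U)+
  then obtain i j i' j' where p: "\<rho> = e ^ i" "\<sigma> = e ^ j" "\<rho>' = e ^ i'" "\<sigma>' = e ^ j'"
    unfolding U_iff by blast
  have s: "b' $ 3 = \<rho> * a $ 3" "b' $ 2 = \<sigma> * a $ 2" "b $ 3 = \<rho>' * a $ 3" "b $ 2 = \<sigma>' * a $ 2"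
    using nz by (simp_all add: \<rho>_def \<sigma>_def \<rho>'_def \<sigma>'_def)
  have "a $ 2 * a $ 3 * ((\<rho> - 1) * (\<sigma>' - 1) - (\<rho>' - 1) * (\<sigma> - 1)) = dot3 a (vprod b b')"
    unfolding dot3_def vprod_nth one s by (simp add: algebra_simps)
  hence eq: "(\<rho> - 1) * (\<sigma>' - 1) = (\<rho>' - 1) * (\<sigma> - 1)" using z nz by simp
  have "\<rho> \<noteq> \<sigma>" "\<rho> \<noteq> 1" "\<sigma>' \<noteq> 1" using b(1,2) s by (auto simp: nodes_def)
  from root_of_unity_ratio_inj[OF e_d d_pos p eq this] have "b = b'"
    using s one by (simp add: vec3_eq_iff)
  with b(3) show False by simp
qed

end

lemma H_not_free:
  fixes e :: "'a::{alg_closed_field, field_char_0}"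
  assumes "primitive_root_of_one d e" "d \<ge> 5"
  shows "\<not> free_arrangement (H_polynomial d e)"
proof -
  interpret primitive_root d e by unfold_locales fact
  \<comment> \<open>The nodes off the coordinate lines together with the three points on them. The
    condition \<open>card V + 1 < 2 * r\<close> amounts to d^2 - 6 d + 6 > 0.\<close>
  define r where "r = (d - 1) * (d - 2) + 3"
  have "\<not> free_arrangement F"
  proof (rule not_free_if_many_points[of V A r "\<lambda>a. E \<union> nodes a"])
    show "line_arrangement V" by unfold_locales
    show "A \<subseteq> V" by (simp add: V_def)
    show "a $ 1 = 1" if "a \<in> A" for a using that by (simp add: A_iff)
    obtain k where k: "d = k + 5" using assms(2) by (metis add.commute le_Suc_ex)
    have "r \<le> d\<^sup>2" "d\<^sup>2 + 3 + 1 < 2 * r"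
      unfolding r_def k by (simp_all add: power2_eq_square algebra_simps)
    thus "r \<le> card A" "card V + 1 < 2 * r" by (simp_all only: card_A card_V)
    show "2 \<le> card V" by (simp add: card_V)
    fix a assume a: "a \<in> A"
    show "E \<union> nodes a \<subseteq> V - {a}" using disjoint_E_A a by (auto simp: V_def nodes_def)
    have "card (E \<union> nodes a) = 3 + card (nodes a)"
      by (subst card_Un_disjoint) (use disjoint_E_A in \<open>auto simp: nodes_def card_E\<close>)
    thus "r \<le> card (E \<union> nodes a)" using card_nodes[OF a] by (simp add: r_def)
    fix b b' assume b: "b \<in> E \<union> nodes a" "b' \<in> E \<union> nodes a" "b \<noteq> b'"
    have anz: "a $ 1 = 1" "a $ 2 \<noteq> 0" "a $ 3 \<noteq> 0" using a U_nonzero by (auto simp: A_iff)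
    have E: "dot3 a (vprod x y) \<noteq> 0 \<and> dot3 a (vprod y x) \<noteq> 0" if "x \<in> E" "y \<in> nodes a" for x y
      using that anz by (auto simp: E_def nodes_def A_iff dot3_def mult.commute)
    show "dot3 a (vprod b b') \<noteq> 0"
    proof (cases "b \<in> E \<and> b' \<in> E")
      case True
      thus ?thesis using b(3) anz by (auto simp: E_def dot3_def)
    next
      case False
      thus ?thesis using b E nodes_distinct[OF a] by blast
    qed
  qed
  thus ?thesis by (simp add: H_polynomial_eq)
qed

subsection \<open>The free cases\<close>

text \<open>The product over j is u^3 + z^3. With a, b, c for the cubes of x, y, z, the whole
  product is the norm of a sum of cube roots, (a + b + c)^3 - 27 a b c.\<close>

lemma prod_L_cube:
  fixes x y z w :: "'b::idom"
  assumes "w\<^sup>2 + w + 1 = 0"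
  shows "(\<Prod>i<3. \<Prod>j<3. x + w ^ i * y + w ^ j * z) =
    (x ^ 3 + y ^ 3 + z ^ 3) ^ 3 - 27 * x ^ 3 * y ^ 3 * z ^ 3"
proof -
  have three: "{..<3::nat} = {0, 1, 2}" by auto
  have j: "(\<Prod>j<3. u + w ^ j * z) = u ^ 3 + z ^ 3" for u
  proof -
    have "(u + z) * (u + w * z) * (u + w\<^sup>2 * z) = u ^ 3 + z ^ 3" using assms by algebra
    thus ?thesis by (simp add: three mult_ac)
  qed
  have "(c + (x + y) ^ 3) * (c + (x + w * y) ^ 3) * (c + (x + w\<^sup>2 * y) ^ 3) =
    (x ^ 3 + y ^ 3 + c) ^ 3 - 27 * x ^ 3 * y ^ 3 * c" for c
    using assms by algebra
  from this[of "z ^ 3"] show ?thesis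
    unfolding j by (simp add: three add_ac mult_ac)
qed

text \<open>The factors for i and i + 2 differ by the sign of y. Multiplied in these pairs they
  become A - B and A + B with B = 4 x^2 y^2 (3 z^4 + x^4 + y^4), and the result is A^2 -
  B^2.\<close>

lemma prod_L_fourth:
  fixes x y z w :: "'b::idom"
  assumes "w\<^sup>2 + 1 = 0"
  shows "(\<Prod>i<4. \<Prod>j<4. x + w ^ i * y + w ^ j * z) =
    (z ^ 8 - 2 * (x ^ 4 + y ^ 4) * z ^ 4 + (x ^ 4 + y ^ 4)\<^sup>2 + 4 * x ^ 4 * y ^ 4)\<^sup>2
    - 16 * x ^ 4 * y ^ 4 * (3 * z ^ 4 + x ^ 4 + y ^ 4)\<^sup>2"
proof -
  have four: "{..<4::nat} = {0, 1, 2, 3}" by auto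
  have w3: "w ^ 2 = - 1" "w ^ 3 = - w" using assms by algebra+
  have j: "(\<Prod>j<4. u + w ^ j * z) = u ^ 4 - z ^ 4" for u
  proof -
    have "(u + z) * (u + w * z) * (u - z) * (u - w * z) = u ^ 4 - z ^ 4" using assms by algebra
    thus ?thesis by (simp add: four w3 mult_ac)
  qed
  have 1: "((x + y) ^ 4 - c) * ((x - y) ^ 4 - c) =
    c\<^sup>2 - 2 * (x ^ 4 + y ^ 4) * c + (x ^ 4 + y ^ 4)\<^sup>2 + 4 * x ^ 4 * y ^ 4
      - 4 * x\<^sup>2 * y\<^sup>2 * (3 * c + x ^ 4 + y ^ 4)" for c
    by algebra
  have 2: "((x + w * y) ^ 4 - c) * ((x - w * y) ^ 4 - c) =
    c\<^sup>2 - 2 * (x ^ 4 + y ^ 4) * c + (x ^ 4 + y ^ 4)\<^sup>2 + 4 * x ^ 4 * y ^ 4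
      + 4 * x\<^sup>2 * y\<^sup>2 * (3 * c + x ^ 4 + y ^ 4)" for c
    using assms by algebra
  have "(\<Prod>i<4. \<Prod>j<4. x + w ^ i * y + w ^ j * z) =
    (((x + y) ^ 4 - z ^ 4) * ((x - y) ^ 4 - z ^ 4)) * (((x + w * y) ^ 4 - z ^ 4) * ((x - w * y) ^ 4 - z ^ 4))"
    unfolding j by (simp add: four w3 mult_ac)
  also have "\<dots> = (z ^ 8 - 2 * (x ^ 4 + y ^ 4) * z ^ 4 + (x ^ 4 + y ^ 4)\<^sup>2 + 4 * x ^ 4 * y ^ 4)\<^sup>2
    - 16 * x ^ 4 * y ^ 4 * (3 * z ^ 4 + x ^ 4 + y ^ 4)\<^sup>2"
    unfolding 1 2 by algebra
  finally show ?thesis .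
qed

lemma H3_polynomial:
  fixes e :: "'a::field_char_0"
  assumes "primitive_root_of_one 3 e"
  shows "H_polynomial 3 e = X3 * Y3 * Z3 *
    ((X3 ^ 3 + Y3 ^ 3 + Z3 ^ 3) ^ 3 - 27 * X3 ^ 3 * Y3 ^ 3 * Z3 ^ 3)"
proof -
  have "e ^ 3 = 1" "e \<noteq> 1"
    using assms unfolding primitive_root_of_one_def by (auto dest: spec[of _ 1])
  moreover have "(e - 1) * (e\<^sup>2 + e + 1) = e ^ 3 - 1" by algebra
  ultimately have "e\<^sup>2 + e + 1 = 0" by simp
  hence "Const3 (e\<^sup>2 + e + 1) = 0" by simp
  hence "(Const3 e)\<^sup>2 + Const3 e + 1 = 0" by simp
  from prod_L_cube[OF this, of X3 Y3 Z3] show ?thesis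
    by (simp add: H_polynomial_def L_form_def)
qed

lemma H4_polynomial:
  fixes e :: "'a::field_char_0"
  assumes "primitive_root_of_one 4 e"
  shows "H_polynomial 4 e = X3 * Y3 * Z3 *
    ((Z3 ^ 8 - 2 * (X3 ^ 4 + Y3 ^ 4) * Z3 ^ 4 + (X3 ^ 4 + Y3 ^ 4)\<^sup>2 + 4 * X3 ^ 4 * Y3 ^ 4)\<^sup>2
    - 16 * X3 ^ 4 * Y3 ^ 4 * (3 * Z3 ^ 4 + X3 ^ 4 + Y3 ^ 4)\<^sup>2)"
proof -
  have "e ^ 4 = 1" "e\<^sup>2 \<noteq> 1"
    using assms unfolding primitive_root_of_one_def by (auto dest: spec[of _ 2])
  moreover have "(e\<^sup>2 - 1) * (e\<^sup>2 + 1) = e ^ 4 - 1" by algebra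
  ultimately have "e\<^sup>2 + 1 = 0" by simp
  hence "Const3 (e\<^sup>2 + 1) = 0" by simp
  hence "(Const3 e)\<^sup>2 + 1 = 0" by simp
  from prod_L_fourth[OF this, of X3 Y3 Z3] show ?thesis
    by (simp add: H_polynomial_def L_form_def)
qed

lemma H3_free:
  fixes e :: "'a::field_char_0"
  assumes e: "primitive_root_of_one 3 e"
  shows "free_with_exponents (H_polynomial 3 e) 4 7"
proof -
  interpret primitive_root 3 e by unfold_locales fact
  \<comment> \<open>\<open>\<theta>1\<close> is one third of the cross product of the gradients of
    x^3 + y^3 + z^3 and xyz, so it kills both, and \<open>F\<close> is a polynomial in these two.
    \<open>\<theta>2\<close> multiplies xyz by 9 (x^3 + y^3 + z^3)^2 and the remaining factor of
    \<open>F\<close> by the negative of this.\<close>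
  define \<theta>1 \<theta>2 :: "'a poly3 ^ 3" where "\<theta>1 = vector [X3 * (Y3 ^ 3 - Z3 ^ 3),
      Y3 * (Z3 ^ 3 - X3 ^ 3), Z3 * (X3 ^ 3 - Y3 ^ 3)]"
    and "\<theta>2 = vector
     [X3 * (34 * Y3 ^ 3 * Z3 ^ 3 - X3 ^ 6 + 5 * (Y3 ^ 6 + Z3 ^ 6) - 8 * X3 ^ 3 * (Y3 ^ 3 + Z3 ^ 3)),
      Y3 * (34 * Z3 ^ 3 * X3 ^ 3 - Y3 ^ 6 + 5 * (Z3 ^ 6 + X3 ^ 6) - 8 * Y3 ^ 3 * (Z3 ^ 3 + X3 ^ 3)),
      Z3 * (34 * X3 ^ 3 * Y3 ^ 3 - Z3 ^ 6 + 5 * (X3 ^ 6 + Y3 ^ 6) - 8 * Z3 ^ 3 * (X3 ^ 3 + Y3 ^ 3))]"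
  \<comment> \<open>The constant can be read off from the monomial x y z^9 in the third coordinates:
    -10 on the left, 10 in the gradient.\<close>
  interpret saito_basis V \<theta>1 \<theta>2 4 7 "- 1"
  proof
    have "\<forall>i. homogeneous3 4 (\<theta>1 $ i)"
      unfolding forall_3 \<theta>1_def vector_3 homogeneous3_iff_euler euler3_def
      by (intro conjI; simp; algebra)
    thus "homogeneous3 4 (\<theta>1 $ i)" for i by blast
    have "\<forall>i. homogeneous3 7 (\<theta>2 $ i)"
      unfolding forall_3 \<theta>2_def vector_3 homogeneous3_iff_euler euler3_def
      by (intro conjI; simp; algebra)
    thus "homogeneous3 7 (\<theta>2 $ i)" for i by blast
    show "vprod \<theta>1 \<theta>2 = Const3 (- 1) *s grad3 F"
      unfolding H_polynomial_eq[symmetric] H3_polynomial[OF e] vec3_eq_iff \<theta>1_def \<theta>2_def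
        vprod_nth vector_3 vector_smult_component grad3_nth
      by (intro conjI; simp; algebra)
  qed simp
  show ?thesis using free unfolding H_polynomial_eq by simp
qed

lemma H4_free:
  fixes e :: "'a::field_char_0"
  assumes e: "primitive_root_of_one 4 e"
  shows "free_with_exponents (H_polynomial 4 e) 9 9"
proof -
  interpret primitive_root 4 e by unfold_locales fact
  \<comment> \<open>The field \<open>\<theta>1\<close> changes sign when x and y are exchanged, and
    \<open>\<theta>2\<close> is its cyclic shift; the three cyclic shifts have sum zero.
    \<open>\<theta>1\<close> multiplies xyz by 16 (x^4 - y^4)(x^4 + y^4 - 9 z^4), and the remaining
    factor of \<open>F\<close> by the negative of this.\<close>
  define a b c :: "'a poly3 \<Rightarrow> 'a poly3 \<Rightarrow> 'a poly3 \<Rightarrow> 'a poly3" where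
    "a x y z = 95 * z\<^sup>2 + 314 * y * z + 39 * y\<^sup>2 + 66 * x * z - 38 * x * y - x\<^sup>2" and
    "b x y z = - a y x z" and "c x y z = (x - y) * (104 * z + 56 * (x + y))" for x y z
  note abc = a_def b_def c_def
  define \<theta>1 \<theta>2 :: "'a poly3 ^ 3" where
    "\<theta>1 = vector [X3 * a (X3 ^ 4) (Y3 ^ 4) (Z3 ^ 4), Y3 * b (X3 ^ 4) (Y3 ^ 4) (Z3 ^ 4),
      Z3 * c (X3 ^ 4) (Y3 ^ 4) (Z3 ^ 4)]"
    and "\<theta>2 = vector [X3 * c (Y3 ^ 4) (Z3 ^ 4) (X3 ^ 4), Y3 * a (Y3 ^ 4) (Z3 ^ 4) (X3 ^ 4),
      Z3 * b (Y3 ^ 4) (Z3 ^ 4) (X3 ^ 4)]"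
  \<comment> \<open>In the third coordinates x y z^16 has coefficient 95 * 39 - 95 * 56 = -95 * 17
    on the left and 17 in the gradient.\<close>
  interpret saito_basis V \<theta>1 \<theta>2 9 9 "- 95"
  proof
    have "\<forall>i. homogeneous3 9 (\<theta>1 $ i)"
      unfolding forall_3 \<theta>1_def vector_3 homogeneous3_iff_euler euler3_def abc
      by (intro conjI; simp; algebra)
    thus "homogeneous3 9 (\<theta>1 $ i)" for i by blast
    have "\<forall>i. homogeneous3 9 (\<theta>2 $ i)"
      unfolding forall_3 \<theta>2_def vector_3 homogeneous3_iff_euler euler3_def abc
      by (intro conjI; simp; algebra)
    thus "homogeneous3 9 (\<theta>2 $ i)" for i by blast
    have n: "Const3 (- 95) = - (95 :: 'a poly3)" using Const3_of_nat[of 95, where 'a = 'a] by simp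
    show "vprod \<theta>1 \<theta>2 = Const3 (- 95) *s grad3 F"
      unfolding H_polynomial_eq[symmetric] H4_polynomial[OF e] vec3_eq_iff \<theta>1_def \<theta>2_def
        vprod_nth vector_3 vector_smult_component grad3_nth abc n
      by (intro conjI; simp; algebra)
  qed simp
  show ?thesis using free unfolding H_polynomial_eq by simp
qed

theorem proposition8p2:
  fixes d :: nat and e :: "'a :: {alg_closed_field, field_char_0}"
  assumes "d \<ge> 3" and "primitive_root_of_one d e"
  shows "card (H_arrangement d e) = d\<^sup>2 + 3
    \<and> (free_arrangement (H_polynomial d e) \<longleftrightarrow> 3 \<le> d \<and> d \<le> 4)
    \<and> (d = 3 \<longrightarrow> card (H_arrangement d e) = 12 \<and> free_with_exponents (H_polynomial d e) 4 7)
    \<and> (d = 4 \<longrightarrow> card (H_arrangement d e) = 19 \<and> free_with_exponents (H_polynomial d e) 9 9)"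
proof -
  interpret primitive_root d e by unfold_locales fact
  have card: "card (H_arrangement d e) = d\<^sup>2 + 3" by (rule card_H_arrangement)
  have three: "free_with_exponents (H_polynomial d e) 4 7" if "d = 3"
    using H3_free assms(2) that by simp
  have four: "free_with_exponents (H_polynomial d e) 9 9" if "d = 4"
    using H4_free assms(2) that by simp
  have "free_arrangement (H_polynomial d e) \<longleftrightarrow> d \<le> 4"
  proof
    assume "free_arrangement (H_polynomial d e)"
    with H_not_free[OF assms(2)] show "d \<le> 4" by fastforce
  next
    assume "d \<le> 4"
    with assms(1) have "d = 3 \<or> d = 4" by auto
    with three four show "free_arrangement (H_polynomial d e)"
      unfolding free_arrangement_def by blast
  qed
  moreover have "card (H_arrangement d e) = 12" if "d = 3"
    unfolding card unfolding that by simp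
  moreover have "card (H_arrangement d e) = 19" if "d = 4"
    unfolding card unfolding that by simp
  ultimately show ?thesis using card three four assms(1) by blast
qed

end
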